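(* Let $q=p$ be a prime number congruent to $1$ modulo $6$, let $\mathbb{F}_q$ be the finite field of order $q$, and let $\omega$ be a primitive third root of unity of $\mathbb{F}_q$. Let $k\in\{1,-1\}$ and $i\in\{1,2\}$. Consider the elements of $\mathrm{PSL}(3,q)$ represented by the matrices $$\sigma_1 = \begin{pmatrix} 1 & 0 & 0 \\ 0 & \omega^i & 0 \\ 0 & 0 & \omega^{2i} \end{pmatrix},\quad \sigma_2 = \begin{pmatrix} -1 & 0 & -k \\ 0 & -\omega^{2i} & -k\omega^{2i} \\ 0 & 0 & \omega^i \end{pmatrix},$$ $$\sigma_3 = \begin{pmatrix} 1 & k & 0 \\ 0 & k & 1 \\ 0 & -1 & 0 \end{pmatrix},\quad \sigma_4 = \begin{pmatrix} 0 & 1 & 0 \\ 0 & 0 & 1 \\ 1 & 0 & 0 \end{pmatrix}.$$ Then $(\mathrm{PSL}(3,q),(\sigma_1,\sigma_2,\sigma_3,\sigma_4))$ gives a chiral polytope of rank five. Its Schläfli type is $\{3,6,6,3\}$ if $k=1$ and $\{3,6,3,3\}$ if $k=-1$.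
   Context: A matrix of determinant $1$ denotes its class in $\mathrm{PSL}(3,q)$. Chiral polytopes are described through groups. Let $G$ be a group, $r\ge 3$, and $(\sigma_1,\dots,\sigma_{r-1})$ a tuple of elements of $G$. For $1\le i\le j\le r-1$ put $\tau_{i,j}=\sigma_i\sigma_{i+1}\cdots\sigma_j$ (so $\tau_{i,i}=\sigma_i$). The pair $(G,(\sigma_1,\dots,\sigma_{r-1}))$ gives a chiral polytope of rank $r$ with automorphism group $G$ if the $\sigma_i$ generate $G$ and: (1) (string property) $\tau_{i,j}$ is an involution (element of order exactly $2$) whenever $1\le i<j\le r-1$; (2) (intersection property) for all $I,J\subseteq\{0,\dots,r-1\}$, $\langle \tau_{i,j} \mid i\le j,\ i-1,j\notin I\rangle\cap\langle \tau_{i,j}\mid i\le j,\ i-1,j\notin J\rangle=\langle \tau_{i,j}\mid i\le j,\ i-1,j\notin I\cup J\rangle$; (3) (chirality) there is no automorphism of $G$ sending $\sigma_1$ to $\sigma_1^{-1}$ and fixing $\tau_{1,i}$ for all $i=2,\dots,r-1$. A group is the automorphism group of a chiral polytope of rank $r$ if and only if such a tuple exists. The Schläfli type is the tuple of the orders of $\sigma_1,\dots,\sigma_{r-1}$. *)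

theory Defs
  imports
    "HOL-Analysis.Determinants"
    "HOL-Algebra.Generated_Groups"
    "HOL-Algebra.Multiplicative_Group"
    "HOL-Number_Theory.Cong"
begin

definition primitive_root_of_unity :: "nat \<Rightarrow> 'a::field \<Rightarrow> bool" where
  "primitive_root_of_unity n x \<longleftrightarrow>
     0 < n \<and> x ^ n = 1 \<and> (\<forall>m. 0 < m \<and> m < n \<longrightarrow> x ^ m \<noteq> 1)"


section \<open>The groups SL and PSL\<close>

definition SL :: "('a::field^'n^'n) monoid" where
  "SL = \<lparr>carrier = {A. det A = 1}, mult = (**), one = mat 1\<rparr>"

definition SL_scalars :: "('a::field^'n^'n) set" where
  "SL_scalars = {A \<in> carrier SL. \<exists>c. A = mat c}"

definition PSL :: "('a::field^'n^'n) set monoid" where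
  "PSL = SL Mod SL_scalars"

definition PSL_class :: "'a::field^'n^'n \<Rightarrow> ('a^'n^'n) set" where
  "PSL_class A = SL_scalars #>\<^bsub>SL\<^esub> A"


section \<open>Chiral polytopes described through groups\<close>

text \<open>
  A tuple of \<open>r - 1\<close> group elements is a list \<open>\<sigma>s\<close> of length \<open>r - 1\<close>. Mathematical indices
  start at 1 and list positions at 0, so the \<open>m\<close>-th entry of the tuple is \<open>\<sigma>s ! (m - 1)\<close>.
\<close>

definition chiral_tau :: "('g, 'b) monoid_scheme \<Rightarrow> 'g list \<Rightarrow> nat \<Rightarrow> nat \<Rightarrow> 'g" where
  "chiral_tau G \<sigma>s i j =
     foldr (\<lambda>m x. \<sigma>s ! (m - 1) \<otimes>\<^bsub>G\<^esub> x) [i..<Suc j] \<one>\<^bsub>G\<^esub>"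

definition chiral_subgroup ::
    "('g, 'b) monoid_scheme \<Rightarrow> nat \<Rightarrow> 'g list \<Rightarrow> nat set \<Rightarrow> 'g set" where
  "chiral_subgroup G r \<sigma>s I =
     generate G {chiral_tau G \<sigma>s i j | i j.
       1 \<le> i \<and> i \<le> j \<and> j \<le> r - 1 \<and> i - 1 \<notin> I \<and> j \<notin> I}"

definition string_property :: "('g, 'b) monoid_scheme \<Rightarrow> nat \<Rightarrow> 'g list \<Rightarrow> bool" where
  "string_property G r \<sigma>s \<longleftrightarrow>
     (\<forall>i j. 1 \<le> i \<and> i < j \<and> j \<le> r - 1 \<longrightarrow> group.ord G (chiral_tau G \<sigma>s i j) = 2)"

definition intersection_property :: "('g, 'b) monoid_scheme \<Rightarrow> nat \<Rightarrow> 'g list \<Rightarrow> bool" where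
  "intersection_property G r \<sigma>s \<longleftrightarrow>
     (\<forall>I J. I \<subseteq> {0..r - 1} \<and> J \<subseteq> {0..r - 1} \<longrightarrow>
        chiral_subgroup G r \<sigma>s I \<inter> chiral_subgroup G r \<sigma>s J = chiral_subgroup G r \<sigma>s (I \<union> J))"

definition chirality :: "('g, 'b) monoid_scheme \<Rightarrow> nat \<Rightarrow> 'g list \<Rightarrow> bool" where
  "chirality G r \<sigma>s \<longleftrightarrow>
     \<not> (\<exists>\<phi> \<in> iso G G.
          \<phi> (\<sigma>s ! 0) = inv\<^bsub>G\<^esub> (\<sigma>s ! 0) \<and>
          (\<forall>i \<in> {2..r - 1}. \<phi> (chiral_tau G \<sigma>s 1 i) = chiral_tau G \<sigma>s 1 i))"

definition gives_chiral_polytope :: "('g, 'b) monoid_scheme \<Rightarrow> nat \<Rightarrow> 'g list \<Rightarrow> bool" where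
  "gives_chiral_polytope G r \<sigma>s \<longleftrightarrow>
     group G \<and> 3 \<le> r \<and> length \<sigma>s = r - 1 \<and> set \<sigma>s \<subseteq> carrier G \<and>
     generate G (set \<sigma>s) = carrier G \<and>
     string_property G r \<sigma>s \<and> intersection_property G r \<sigma>s \<and> chirality G r \<sigma>s"

definition schlaefli_type :: "('g, 'b) monoid_scheme \<Rightarrow> 'g list \<Rightarrow> nat list" where
  "schlaefli_type G \<sigma>s = map (group.ord G) \<sigma>s"

end

theory Submission
  imports Defs "HOL-Number_Theory.Residues"
begin

text \<open>
  Everything is computed with matrices of determinant 1, up to scalar cube roots of unity. Write \<open>G(I)\<close> for
  the subgroup generated by the \<open>\<tau>\<close>s avoiding the vertices in \<open>I\<close>. For each vertex \<open>c\<close> there is a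
  geometric invariant \<open>Qc\<close> shared by all elements of \<open>G({c})\<close>, and whenever \<open>I\<close> has at least two elements
  the invariants \<open>Qc\<close> with \<open>c \<in> I\<close> together characterise \<open>G(I)\<close>. This gives \<open>G(I) \<inter> G(J) = G(I \<union> J)\<close>,
  since for incomparable \<open>I\<close>, \<open>J\<close> the union has at least two elements. To see that a matrix with the right
  invariants lies in \<open>G(I)\<close>, multiply it by generators until its eigenvalues on the invariant points are 1;
  what remains is trivial or lies in a unipotent radical, which is a vector space over the prime field
  spanned by conjugates of one element.

  The elements \<open>\<sigma>\<^sub>1\<close>, \<open>\<sigma>\<^sub>2\<close> generate all transvections with entries in the last column, and conjugation by
  \<open>\<sigma>\<^sub>4\<close> turns them into all elementary matrices, so the whole group is generated. An automorphism violating
  chirality would exchange the transvections \<open>E\<^sub>1\<^sub>3\<close> and \<open>E\<^sub>2\<^sub>3\<close> and commute with conjugation by \<open>\<sigma>\<^sub>4\<close>, hence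
  exchange \<open>E\<^sub>3\<^sub>2\<close> and \<open>E\<^sub>1\<^sub>2\<close>, which contradicts \<open>[E\<^sub>1\<^sub>3, E\<^sub>3\<^sub>2] = E\<^sub>1\<^sub>2\<close>.
\<close>

section \<open>The groups SL and PSL\<close>

text \<open>The stabiliser in SL(3) of a point, a pair of points or a triangle contains tori whose
  order grows with \<open>q\<close>, whereas every \<open>G(I)\<close> acts on its invariant points
  through sixth roots of unity. This is why an invariant couples an incidence condition with a
  condition on multipliers, and why that condition must tolerate scalar cube roots of unity: a class
  determines its matrix only up to these.

  The sign \<open>k\<close> changes the invariants only at the vertices 0 and 1. For
  \<open>k = 1\<close> the matrices \<open>s3\<close> and \<open>s4\<close> have the common
  eigenvectors \<open>v1\<close> and \<open>v2\<close>, and \<open>s2\<close> also fixes the line of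
  \<open>v1\<close>, so the subgroup avoiding 0 is of parabolic type. For \<open>k = - 1\<close> the
  matrices \<open>s3\<close> and \<open>s4\<close> rotate the triangle \<open>f1\<close>,
  \<open>f2\<close>, \<open>f3\<close> instead, and \<open>s2\<close>, \<open>s3\<close>,
  \<open>s4\<close> preserve a quadratic form up to scalars, so the same subgroup is of orthogonal
  type. Hence the separate treatment of the two signs whenever neither the triangle
  \<open>e1\<close>, \<open>e2\<close>, \<open>e3\<close> nor the pair \<open>e1\<close>,
  \<open>e2\<close> is available as an invariant.\<close>

lemma carrier_SL [simp]: "A \<in> carrier SL \<longleftrightarrow> det A = 1"
  by (simp add: SL_def)

lemma mult_SL [simp]: "A \<otimes>\<^bsub>SL\<^esub> B = A ** B"
  by (simp add: SL_def)

lemma one_SL [simp]: "\<one>\<^bsub>SL\<^esub> = mat 1"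
  by (simp add: SL_def)

lemma group_SL: "group (SL :: ('a::field^'n^'n) monoid)"
proof (rule groupI)
  fix A :: "'a^'n^'n"
  assume "A \<in> carrier SL"
  then have "invertible A" and d: "det A = 1"
    by (auto simp: invertible_det_nz)
  then obtain B where "B ** A = mat 1"
    by (auto simp: invertible_def)
  moreover from this have "det B = 1"
    by (metis d det_I det_mul mult.right_neutral)
  ultimately show "\<exists>B\<in>carrier SL. B \<otimes>\<^bsub>SL\<^esub> A = \<one>\<^bsub>SL\<^esub>"
    by auto
qed (simp_all add: det_mul matrix_mul_assoc)

lemma mat_mult_nth: "(mat c ** A) $ i $ j = (c :: 'a::comm_semiring_1) * A $ i $ j"
  by (simp add: matrix_matrix_mult_def mat_def if_distrib[of "\<lambda>x. x * y" for y] cong: if_cong)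

lemma mult_mat_nth: "(A ** mat c) $ i $ j = A $ i $ j * (c :: 'a::comm_semiring_1)"
  by (simp add: matrix_matrix_mult_def mat_def if_distrib[of "\<lambda>x. y * x" for y] cong: if_cong)

lemma mat_mult_commute: "mat c ** A = A ** mat (c :: 'a::comm_semiring_1)"
  by (simp add: vec_eq_iff mat_mult_nth mult_mat_nth mult.commute)

lemma mat_mult_mat: "mat a ** mat b = (mat (a * b) :: 'a::comm_semiring_1^'n^'n)"
  by (simp add: vec_eq_iff mat_mult_nth) (simp add: mat_def)

lemma normal_SL_scalars: "SL_scalars \<lhd> (SL :: ('a::field^'n^'n) monoid)"
proof -
  interpret group "SL :: ('a^'n^'n) monoid" by (rule group_SL)
  have inv_scalar: "inv\<^bsub>SL\<^esub> A \<in> SL_scalars" if "A \<in> SL_scalars" for A :: "'a^'n^'n"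
  proof -
    from that obtain c where c: "A = mat c" "det A = 1"
      by (auto simp: SL_scalars_def)
    then have "c \<noteq> 0"
      by (metis det_0 mat_0 zero_neq_one)
    then have "A ** mat (inverse c) = mat 1"
      using c by (simp add: mat_mult_mat)
    moreover from this have "det (mat (inverse c) :: 'a^'n^'n) = 1"
      by (metis c(2) det_I det_mul mult.left_neutral)
    ultimately have "inv\<^bsub>SL\<^esub> A = mat (inverse c)"
      using c mat_mult_commute[of "inverse c" A] by (intro inv_equality) simp_all
    then show ?thesis
      using \<open>det (mat (inverse c)) = 1\<close> by (auto simp: SL_scalars_def)
  qed
  have "subgroup SL_scalars (SL :: ('a^'n^'n) monoid)"
  proof (rule subgroupI)
    show "SL_scalars \<subseteq> carrier (SL :: ('a^'n^'n) monoid)"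
      by (auto simp: SL_scalars_def)
    show "SL_scalars \<noteq> ({} :: ('a^'n^'n) set)"
      by (auto simp: SL_scalars_def intro!: exI[of _ "mat 1"])
    fix A B :: "'a^'n^'n"
    assume A: "A \<in> SL_scalars"
    then show "inv\<^bsub>SL\<^esub> A \<in> SL_scalars" by (rule inv_scalar)
    assume "B \<in> SL_scalars"
    with A obtain a b where "A = mat a" "B = mat b" "det A = 1" "det B = 1"
      by (auto simp: SL_scalars_def)
    then show "A \<otimes>\<^bsub>SL\<^esub> B \<in> SL_scalars"
      using det_mul[of A B] by (auto simp: SL_scalars_def mat_mult_mat)
  qed
  then show ?thesis
  proof (rule normal_invI)
    fix x h :: "'a^'n^'n"
    assume "x \<in> carrier SL" "h \<in> SL_scalars"
    moreover from this obtain c where "h = mat c" by (auto simp: SL_scalars_def)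
    ultimately have "x \<otimes>\<^bsub>SL\<^esub> h = h \<otimes>\<^bsub>SL\<^esub> x" "h \<in> carrier SL"
      using mat_mult_commute[of c x] by (auto simp: SL_scalars_def)
    then show "x \<otimes>\<^bsub>SL\<^esub> h \<otimes>\<^bsub>SL\<^esub> inv\<^bsub>SL\<^esub> x \<in> SL_scalars"
      using \<open>x \<in> carrier SL\<close> \<open>h \<in> SL_scalars\<close> by (simp add: m_assoc del: mult_SL carrier_SL one_SL)
  qed
qed

lemma group_PSL: "group (PSL :: ('a::field^'n^'n) set monoid)"
  unfolding PSL_def by (rule normal.factorgroup_is_group[OF normal_SL_scalars])

lemma PSL_class_hom: "PSL_class \<in> hom (SL :: ('a::field^'n^'n) monoid) PSL"
  using normal.r_coset_hom_Mod[OF normal_SL_scalars]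
  by (simp add: PSL_def PSL_class_def[abs_def])

lemma PSL_class_mult:
  assumes "det A = 1" "det B = 1"
  shows "PSL_class A \<otimes>\<^bsub>PSL\<^esub> PSL_class B = PSL_class (A ** B)"
  using hom_mult[OF PSL_class_hom, of A B] assms by simp

lemma PSL_class_in_carrier [simp]: "det A = 1 \<Longrightarrow> PSL_class A \<in> carrier PSL"
  using hom_in_carrier[OF PSL_class_hom] by auto

lemma PSL_class_one: "PSL_class (mat 1) = \<one>\<^bsub>PSL\<^esub>"
  using hom_one[OF PSL_class_hom group_SL group_PSL] by simp

lemma carrier_PSL: "carrier PSL = {PSL_class A | A. det A = 1}"
  by (auto simp: PSL_def FactGroup_def RCOSETS_def PSL_class_def)

lemma PSL_class_eq_iff:
  fixes A B :: "'a::field^'n^'n"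
  assumes "det A = 1" "det B = 1"
  shows "PSL_class A = PSL_class B \<longleftrightarrow> (\<exists>c. det (mat c :: 'a^'n^'n) = 1 \<and> A = mat c ** B)"
proof -
  interpret normal SL_scalars "SL :: ('a^'n^'n) monoid" by (rule normal_SL_scalars)
  have class_def: "PSL_class C = {mat c ** C | c. det (mat c :: 'a^'n^'n) = 1}" for C :: "'a^'n^'n"
    unfolding PSL_class_def r_coset_def SL_scalars_def mult_SL carrier_SL by blast
  have "A \<in> PSL_class B \<longleftrightarrow> PSL_class A = PSL_class B"
  proof
    assume "A \<in> PSL_class B"
    then show "PSL_class A = PSL_class B"
      using assms repr_independence[OF _ _ is_subgroup, of A B] by (simp add: PSL_class_def)
  next
    assume "PSL_class A = PSL_class B"
    then show "A \<in> PSL_class B"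
      using assms rcos_self[OF _ is_subgroup, of A] by (simp add: PSL_class_def)
  qed
  then show ?thesis
    unfolding class_def by blast
qed

lemma PSL_class_pow:
  assumes "det A = 1"
  shows "PSL_class A [^]\<^bsub>PSL\<^esub> n = PSL_class (((**) A ^^ n) (mat 1)) \<and> det (((**) A ^^ n) (mat 1)) = 1"
proof (induction n)
  case 0
  interpret group PSL by (rule group_PSL)
  show ?case by (simp add: PSL_class_one)
next
  case (Suc n)
  interpret group PSL by (rule group_PSL)
  show ?case
    using Suc assms by (subst nat_pow_Suc2) (auto simp: PSL_class_mult det_mul)
qed

text \<open>In a finite group \<open>inv s\<close> is the power \<open>s [^] (order G - 1)\<close>,
  so closure under right multiplication by generators already covers their inverses, for any set
  \<open>H\<close> containing the identity.\<close>

lemma (in group) generate_subset_finite: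
  assumes fin: "finite (carrier G)" and S: "S \<subseteq> carrier G" and H: "H \<subseteq> carrier G"
    and one: "\<one> \<in> H" and step: "\<And>h s. h \<in> H \<Longrightarrow> s \<in> S \<Longrightarrow> h \<otimes> s \<in> H"
  shows "generate G S \<subseteq> H"
proof -
  have pow: "h \<otimes> s [^] (n::nat) \<in> H" if "h \<in> H" "s \<in> S" for h s n
  proof (induction n)
    case 0
    show ?case using that H by auto
  next
    case (Suc n)
    have "h \<otimes> s [^] Suc n = h \<otimes> s [^] n \<otimes> s"
      using that H S by (simp add: m_assoc subset_iff)
    then show ?case using step[OF Suc that(2)] by simp
  qed
  \<comment> \<open>Keeping \<open>h\<close> arbitrary lets the product case absorb \<open>x\<close>
    first and \<open>y\<close> afterwards.\<close>
  have "h \<otimes> x \<in> H" if "x \<in> generate G S" "h \<in> H" for h x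
    using that
  proof (induction arbitrary: h rule: generate.induct)
    case one
    then show ?case using H by auto
  next
    case (incl s)
    then show ?case using step by auto
  next
    case (inv s)
    then have "s \<in> carrier G" using S by auto
    moreover have "Suc (order G - 1) = order G"
      using fin by (simp add: order_gt_0_iff_finite)
    ultimately have "s [^] (order G - 1) \<otimes> s = \<one>"
      using pow_order_eq_1[of s] nat_pow_Suc[of s "order G - 1"] by simp
    then have "inv s = s [^] (order G - 1)"
      using \<open>s \<in> carrier G\<close> by (intro inv_equality) auto
    then show ?case using pow inv by simp
  next
    case (eng x y)
    then have "x \<in> carrier G" "y \<in> carrier G"
      using generate_in_carrier[OF S] by auto
    then show ?case using eng H by (simp add: m_assoc[symmetric] subset_iff)
  qed
  from this[OF _ one] show ?thesis
    using generate_in_carrier[OF S] by auto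
qed

section \<open>Preimages in SL of generated subgroups of PSL\<close>

definition PSL_lift :: "('a::field^'n^'n) set set \<Rightarrow> ('a^'n^'n) set" where
  "PSL_lift S = {A. det A = 1 \<and> PSL_class A \<in> generate PSL S}"

lemma PSL_lift_incl: "det A = 1 \<Longrightarrow> PSL_class A \<in> S \<Longrightarrow> A \<in> PSL_lift S"
  by (simp add: PSL_lift_def generate.incl)

lemma PSL_lift_mult: "A \<in> PSL_lift S \<Longrightarrow> B \<in> PSL_lift S \<Longrightarrow> A ** B \<in> PSL_lift S"
  by (auto simp: PSL_lift_def det_mul PSL_class_mult[symmetric] intro: generate.eng)

lemma PSL_lift_scalar:
  assumes "det (mat c :: 'a::field^'n^'n) = 1"
  shows "(mat c :: 'a^'n^'n) \<in> PSL_lift S"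
proof -
  have "PSL_class (mat c :: 'a^'n^'n) = PSL_class (mat 1)"
    using assms by (subst PSL_class_eq_iff) (auto intro!: exI[of _ c] simp: mat_mult_mat)
  then show ?thesis
    using assms by (simp add: PSL_lift_def PSL_class_one generate.one)
qed

text \<open>Allows a membership proof to multiply an unknown matrix by a known element, recognise
  the simpler product, and return to the original matrix.\<close>

lemma PSL_lift_cancel_right:
  assumes S: "S \<subseteq> carrier PSL" and "det A = 1" "B \<in> PSL_lift S" "A ** B \<in> PSL_lift S"
  shows "A \<in> PSL_lift S"
proof -
  interpret group PSL by (rule group_PSL)
  have B: "PSL_class B \<in> generate PSL S" "det B = 1"
    and AB: "PSL_class A \<otimes>\<^bsub>PSL\<^esub> PSL_class B \<in> generate PSL S"
    using assms by (auto simp: PSL_lift_def PSL_class_mult)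
  have "PSL_class A = PSL_class A \<otimes>\<^bsub>PSL\<^esub> PSL_class B \<otimes>\<^bsub>PSL\<^esub> inv\<^bsub>PSL\<^esub> PSL_class B"
    using assms B by (simp add: m_assoc)
  also have "\<dots> \<in> generate PSL S"
    by (rule generate.eng[OF AB generate_m_inv_closed[OF S B(1)]])
  finally show ?thesis
    using assms by (simp add: PSL_lift_def)
qed

lemma PSL_lift_cancel_left:
  assumes S: "S \<subseteq> carrier PSL" and "det A = 1" "B \<in> PSL_lift S" "B ** A \<in> PSL_lift S"
  shows "A \<in> PSL_lift S"
proof -
  interpret group PSL by (rule group_PSL)
  have B: "PSL_class B \<in> generate PSL S" "det B = 1"
    and BA: "PSL_class B \<otimes>\<^bsub>PSL\<^esub> PSL_class A \<in> generate PSL S"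
    using assms by (auto simp: PSL_lift_def PSL_class_mult)
  have "PSL_class A = inv\<^bsub>PSL\<^esub> PSL_class B \<otimes>\<^bsub>PSL\<^esub> (PSL_class B \<otimes>\<^bsub>PSL\<^esub> PSL_class A)"
    using assms B by (simp add: m_assoc[symmetric])
  also have "\<dots> \<in> generate PSL S"
    by (rule generate.eng[OF generate_m_inv_closed[OF S B(1)] BA])
  finally show ?thesis
    using assms by (simp add: PSL_lift_def)
qed

text \<open>Since the group is finite, an invariant only has to survive right multiplication by the
  generators, not by their inverses.\<close>

lemma PSL_lift_invariant:
  fixes Q :: "'a::{field,finite}^'n^'n \<Rightarrow> bool"
  assumes S: "S \<subseteq> {PSL_class g | g. det g = 1 \<and> (\<forall>A. Q A \<longrightarrow> Q (A ** g))}"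
    and scalar: "\<And>c A. det (mat c :: 'a^'n^'n) = 1 \<Longrightarrow> Q A \<Longrightarrow> Q (mat c ** A)"
    and one: "Q (mat 1)" and A: "A \<in> PSL_lift S"
  shows "Q A"
proof -
  interpret group "PSL :: ('a^'n^'n) set monoid" by (rule group_PSL)
  let ?H = "{PSL_class A | A. det A = 1 \<and> Q A}"
  have "generate PSL S \<subseteq> ?H"
  proof (rule generate_subset_finite)
    show "\<one>\<^bsub>PSL\<^esub> \<in> ?H"
      using one by (auto simp: PSL_class_one[symmetric] intro!: exI[of _ "mat 1"])
    show "h \<otimes>\<^bsub>PSL\<^esub> s \<in> ?H" if hs: "h \<in> ?H" "s \<in> S" for h s
    proof -
      from hs(1) obtain A where A: "h = PSL_class A" "det A = 1" "Q A" by auto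
      from hs(2) S obtain g where g: "s = PSL_class g" "det g = 1" "Q A \<longrightarrow> Q (A ** g)" by blast
      show ?thesis
        using A g by (auto simp: PSL_class_mult det_mul intro!: exI[of _ "A ** g"])
    qed
    show "finite (carrier (PSL :: ('a^'n^'n) set monoid))"
      by (rule finite_subset[OF subset_UNIV]) simp
    show "S \<subseteq> carrier PSL" "?H \<subseteq> carrier PSL"
      using S by auto
  qed
  then obtain B where "PSL_class A = PSL_class B" "det B = 1" "Q B" "det A = 1"
    using A by (auto simp: PSL_lift_def)
  then show ?thesis
    using scalar by (auto simp: PSL_class_eq_iff)
qed

section \<open>Matrices of size three\<close>

definition M3 :: "'a::zero \<Rightarrow> 'a \<Rightarrow> 'a \<Rightarrow> 'a \<Rightarrow> 'a \<Rightarrow> 'a \<Rightarrow> 'a \<Rightarrow> 'a \<Rightarrow> 'a \<Rightarrow> 'a^3^3" where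
  "M3 a b c d e f g h j = vector [vector [a, b, c], vector [d, e, f], vector [g, h, j]]"

lemma M3_nth [simp]:
  "M3 a b c d e f g h j $ 1 $ 1 = a" "M3 a b c d e f g h j $ 1 $ 2 = b" "M3 a b c d e f g h j $ 1 $ 3 = c"
  "M3 a b c d e f g h j $ 2 $ 1 = d" "M3 a b c d e f g h j $ 2 $ 2 = e" "M3 a b c d e f g h j $ 2 $ 3 = f"
  "M3 a b c d e f g h j $ 3 $ 1 = g" "M3 a b c d e f g h j $ 3 $ 2 = h" "M3 a b c d e f g h j $ 3 $ 3 = j"
  by (simp_all add: M3_def)

lemma M3_eta: "A = M3 (A$1$1) (A$1$2) (A$1$3) (A$2$1) (A$2$2) (A$2$3) (A$3$1) (A$3$2) (A$3$3)"
  by (simp add: vec_eq_iff forall_3)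

lemma M3_cases:
  obtains a b c d e f g h j where "A = M3 a b c d e f g h j"
  using M3_eta by blast

lemma M3_eq_iff [simp]:
  "M3 a b c d e f g h j = M3 a' b' c' d' e' f' g' h' j' \<longleftrightarrow>
     a = a' \<and> b = b' \<and> c = c' \<and> d = d' \<and> e = e' \<and> f = f' \<and> g = g' \<and> h = h' \<and> j = j'"
  by (auto simp: vec_eq_iff forall_3)

lemma M3_mult [simp]:
  "M3 a b c d e f g h j ** M3 a' b' c' d' e' f' g' h' j' =
     M3 (a * a' + b * d' + c * g') (a * b' + b * e' + c * h') (a * c' + b * f' + c * j')
        (d * a' + e * d' + f * g') (d * b' + e * e' + f * h') (d * c' + e * f' + f * j')
        (g * a' + h * d' + j * g') (g * b' + h * e' + j * h') (g * c' + h * f' + j * j')"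
  by (simp add: vec_eq_iff forall_3 matrix_matrix_mult_def sum_3)

lemma det_M3:
  "det (M3 a b c d e f g h j) = a * (e * j - f * h) - b * (d * j - f * g) + c * (d * h - e * g)"
  by (simp add: det_3 algebra_simps)

lemma mat_M3: "mat c = M3 c 0 0 0 c 0 0 0 c"
  by (simp add: vec_eq_iff forall_3 mat_def)

lemma det_mat_3: "det (mat c :: 'a::field^3^3) = c ^ 3"
  by (simp add: mat_M3 det_M3 power3_eq_cube)

lemma transpose_M3 [simp]: "transpose (M3 a b c d e f g h j) = M3 a d g b e h c f j"
  by (simp add: vec_eq_iff forall_3 transpose_def)

lemma vector_3_eq_iff: "(vector [a, b, c] :: 'a::zero^3) = vector [a', b', c'] \<longleftrightarrow> a = a' \<and> b = b' \<and> c = c'"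
  by (auto simp: vec_eq_iff forall_3)

lemma M3_mult_vector [simp]:
  "M3 a b c d e f g h j *v vector [x, y, w] =
     vector [a * x + b * y + c * w, d * x + e * y + f * w, g * x + h * y + j * w]"
  by (simp add: vec_eq_iff forall_3 matrix_vector_mult_def sum_3)

lemma smult_vector_3 [simp]: "r *s (vector [x, y, w] :: 'a::semiring_1^3) = vector [r * x, r * y, r * w]"
  by (simp add: vec_eq_iff forall_3)

text \<open>Gaussian elimination, phrased as cancellation of elementary factors on either side.
  Facts 1 to 3 treat the lower right block of determinant 1, fact 4 clears the first column, fact 5
  the first row, and facts 6 and 7 produce the entry 1 in the corner.\<close>

lemma SL3_elementary_induct:
  fixes C :: "'a::field^3^3 \<Rightarrow> bool"
  assumes right: "\<And>A B. det A = 1 \<Longrightarrow> C B \<Longrightarrow> C (A ** B) \<Longrightarrow> C A"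
    and left: "\<And>A B. det A = 1 \<Longrightarrow> C B \<Longrightarrow> C (B ** A) \<Longrightarrow> C A"
    and E12: "\<And>x. C (M3 1 x 0 0 1 0 0 0 1)" and E13: "\<And>x. C (M3 1 0 x 0 1 0 0 0 1)"
    and E21: "\<And>x. C (M3 1 0 0 x 1 0 0 0 1)" and E23: "\<And>x. C (M3 1 0 0 0 1 x 0 0 1)"
    and E31: "\<And>x. C (M3 1 0 0 0 1 0 x 0 1)" and E32: "\<And>x. C (M3 1 0 0 0 1 0 0 x 1)"
    and det: "det A = 1"
  shows "C A"
proof -
  have 1: "C (M3 1 0 0 0 1 f 0 h j)" if "j - f * h = 1" for f h j
  proof (rule right[OF _ E23[of "- f"]])
    have "M3 1 0 0 0 1 f 0 h j ** M3 1 0 0 0 1 (- f) 0 0 1 = M3 1 0 0 0 1 0 0 h 1"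
      using that by (simp add: algebra_simps)
    then show "C (M3 1 0 0 0 1 f 0 h j ** M3 1 0 0 0 1 (- f) 0 0 1)"
      using E32 by simp
  qed (use that in \<open>simp add: det_M3\<close>)
  have 2: "C (M3 1 0 0 0 e f 0 h j)" if "e * j - f * h = 1" "f \<noteq> 0" for e f h j
  proof (rule right[OF _ E32[of "(1 - e) / f"]])
    \<comment> \<open>Adding \<open>t\<close> times the third column to the second turns the entry
      \<open>e\<close> into \<open>e + f * t = 1\<close>.\<close>
    define t where "t = (1 - e) / f"
    have t: "f * t = 1 - e" using that by (simp add: t_def)
    then have "j - f * (h + j * t) = 1" using that(1) by Groebner_Basis.algebra
    then have "C (M3 1 0 0 0 1 f 0 (h + j * t) j)" by (rule 1)
    then show "C (M3 1 0 0 0 e f 0 h j ** M3 1 0 0 0 1 0 0 ((1 - e) / f) 1)"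
      using t by (simp flip: t_def)
  qed (use that in \<open>simp add: det_M3\<close>)
  have 3: "C (M3 1 0 0 0 e f 0 h j)" if d: "e * j - f * h = 1" for e f h j
  proof (cases "f = 0")
    case True
    \<comment> \<open>With \<open>f = 0\<close> the entry \<open>e\<close> is nonzero, and adding
      the second column to the third puts it in the place of \<open>f\<close>.\<close>
    then have "e * (h + j) - e * h = 1" "e \<noteq> 0" using d by (auto simp: distrib_left)
    then have "C (M3 1 0 0 0 e e 0 h (h + j))" by (rule 2)
    then show ?thesis
      using True d by - (rule right[OF _ E23[of 1]], simp_all add: det_M3)
  qed (use d 2 in auto)
  have 4: "C (M3 1 0 0 d e f g h j)" if ej: "e * j - f * h = 1" for d e f g h j
  proof (rule left[OF _ E21[of "- d"]])
    have "C (M3 1 0 0 0 e f 0 h j)" using ej by (rule 3)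
    then have "C (M3 1 0 0 0 e f g h j)"
      using ej by - (rule left[OF _ E31[of "- g"]], simp_all add: det_M3)
    then show "C (M3 1 0 0 (- d) 1 0 0 0 1 ** M3 1 0 0 d e f g h j)"
      by simp
  qed (use ej in \<open>simp add: det_M3\<close>)
  have 5: "C (M3 1 b c d e f g h j)" if d: "det (M3 1 b c d e f g h j) = 1" for b c d e f g h j
  proof (rule right[OF d E12[of "- b"]])
    have "(e - d * b) * (j - g * c) - (f - d * c) * (h - g * b) = 1"
      using d unfolding det_M3 by Groebner_Basis.algebra
    then have "C (M3 1 0 0 d (e - d * b) (f - d * c) g (h - g * b) (j - g * c))"
      by (rule 4)
    moreover have "det (M3 1 0 c d (e - d * b) f g (h - g * b) j) = 1"
      using d unfolding det_M3 by Groebner_Basis.algebra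
    ultimately have "C (M3 1 0 c d (e - d * b) f g (h - g * b) j)"
      by - (rule right[OF _ E13[of "- c"]], simp_all add: algebra_simps)
    then show "C (M3 1 b c d e f g h j ** M3 1 (- b) 0 0 1 0 0 0 1)"
      by (simp add: algebra_simps)
  qed
  have 6: "C (M3 a b c d e f g h j)" if d: "det (M3 a b c d e f g h j) = 1" and "b \<noteq> 0"
    for a b c d e f g h j
  proof (rule right[OF d E21[of "(1 - a) / b"]])
    have "det (M3 a b c d e f g h j ** M3 1 0 0 ((1 - a) / b) 1 0 0 0 1) = 1"
      using d by (simp add: det_mul det_M3 del: M3_mult)
    then show "C (M3 a b c d e f g h j ** M3 1 0 0 ((1 - a) / b) 1 0 0 0 1)"
      using \<open>b \<noteq> 0\<close> by (simp add: 5)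
  qed
  have 7: "C (M3 a b c d e f g h j)" if d: "det (M3 a b c d e f g h j) = 1" for a b c d e f g h j
  proof -
    have "\<not> (a = 0 \<and> b = 0 \<and> c = 0)"
      using d by (auto simp: det_M3)
    then consider "b \<noteq> 0" | "b = 0" "a \<noteq> 0" | "b = 0" "c \<noteq> 0"
      by blast
    then show ?thesis
    proof cases
      case 1
      then show ?thesis using d by (rule 6[rotated])
    next
      case 2
      have "det (M3 a b c d e f g h j ** M3 1 1 0 0 1 0 0 0 1) = 1"
        using d by (simp add: det_mul det_M3 del: M3_mult)
      then have "C (M3 a b c d e f g h j ** M3 1 1 0 0 1 0 0 0 1)"
        using 2 by (simp add: 6)
      then show ?thesis by (rule right[OF d E12])
    next
      case 3
      have "det (M3 a b c d e f g h j ** M3 1 0 0 0 1 0 0 1 1) = 1"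
        using d by (simp add: det_mul det_M3 del: M3_mult)
      then have "C (M3 a b c d e f g h j ** M3 1 0 0 0 1 0 0 1 1)"
        using 3 by (simp add: 6)
      then show ?thesis by (rule right[OF d E32])
    qed
  qed
  from det show ?thesis
    by (cases A rule: M3_cases) (auto intro!: 7)
qed

section \<open>Fields of prime order and roots of unity\<close>

lemma CHAR_eq_CARD:
  assumes "prime CARD('a::{field,finite})"
  shows "CHAR('a) = CARD('a)"
  using assms CHAR_dvd_CARD[where 'a = 'a] CHAR_not_1'[where 'a = 'a] by (auto simp: prime_nat_iff)

text \<open>Turns multiplication by a scalar into repeated addition, so that additive subgroups
  become subspaces.\<close>

lemma prime_field_of_nat_surj:
  fixes x :: "'a::{field,finite}"
  assumes "prime CARD('a)"
  obtains n where "x = of_nat n"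
proof -
  let ?p = "CARD('a)"
  note char = CHAR_eq_CARD[OF assms]
  have "inj_on (of_nat :: nat \<Rightarrow> 'a) {..<?p}"
    by (simp add: inj_on_def of_nat_eq_iff_cong_CHAR char cong_def)
  then have "card ((of_nat :: nat \<Rightarrow> 'a) ` {..<?p}) = CARD('a)"
    by (simp add: card_image)
  then have "(of_nat :: nat \<Rightarrow> 'a) ` {..<?p} = UNIV"
    by (intro card_subset_eq) auto
  then show ?thesis
    using that by (blast intro: UNIV_I)
qed

text \<open>An additive subgroup of the plane over a prime field is a subspace; if it is invariant
  under a diagonal map with distinct eigenvalues then it is spanned by coordinate vectors.\<close>

lemma prime_field_plane_induct:
  fixes P :: "'a::{field,finite} \<Rightarrow> 'a \<Rightarrow> bool"
  assumes prime: "prime CARD('a)"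
    and zero: "P 0 0" and add: "\<And>x y x' y'. P x y \<Longrightarrow> P x' y' \<Longrightarrow> P (x + x') (y + y')"
    and eigen: "\<And>x y. P x y \<Longrightarrow> P (l * x) (m * y)" and "l \<noteq> m"
    and start: "P x0 y0" "x0 \<noteq> 0" "y0 \<noteq> 0"
  shows "P x y"
proof -
  have scale: "P (c * x) (c * y)" if "P x y" for c x y
  proof -
    obtain n where c: "c = of_nat n" using prime_field_of_nat_surj[OF prime] .
    have "P (of_nat n * x) (of_nat n * y)"
    proof (induction n)
      case (Suc n)
      from add[OF that this] show ?case by (simp add: distrib_right)
    qed (simp add: zero)
    then show ?thesis by (simp add: c)
  qed
  \<comment> \<open>Subtracting \<open>m\<close> times or \<open>l\<close> times the starting vector
    from its image kills one coordinate; the other one survives because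
    \<open>l \<noteq> m\<close>.\<close>
  have "P (l * x0 + - m * x0) (m * y0 + - m * y0)" "P (l * x0 + - l * x0) (m * y0 + - l * y0)"
    by (intro add eigen scale start)+
  then have "P ((l - m) * x0) 0" "P 0 ((m - l) * y0)"
    by (simp_all add: algebra_simps)
  from scale[OF this(1), of "x / ((l - m) * x0)"] scale[OF this(2), of "y / ((m - l) * y0)"]
  have "P x 0" "P 0 y"
    using \<open>l \<noteq> m\<close> start by simp_all
  from add[OF this] show ?thesis by simp
qed

text \<open>The one-dimensional counterpart, for the case \<open>k = - 1\<close> in which the
  unipotent part is a one-parameter group.\<close>

lemma prime_field_line_induct:
  fixes P :: "'a::{field,finite} \<Rightarrow> bool"
  assumes prime: "prime CARD('a)"
    and zero: "P 0" and add: "\<And>x x'. P x \<Longrightarrow> P x' \<Longrightarrow> P (x + x')"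
    and start: "P x0" "x0 \<noteq> 0"
  shows "P x"
proof -
  obtain n where c: "x / x0 = of_nat n" using prime_field_of_nat_surj[OF prime] .
  have "P (of_nat n * x0)"
  proof (induction n)
    case (Suc n)
    from add[OF start(1) this] show ?case by (simp add: distrib_right)
  qed (simp add: zero)
  then show ?thesis using start by (simp flip: c)
qed

section \<open>Cube and sixth roots of unity\<close>

locale cube_root =
  fixes z :: "'a::field"
  assumes z: "z^2 + z + 1 = 0"
begin

lemma z_sq: "z * z = - 1 - z"
  using z by Groebner_Basis.algebra

lemma z_sq': "z * (z * x) = - x - z * x"
  by (simp add: mult.assoc[symmetric] z_sq left_diff_distrib)

text \<open>Reduces polynomials in \<open>z\<close> to expressions linear in \<open>z\<close>, so
  that matrix identities are checked by simplification.\<close>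

lemmas z_simps = algebra_simps power2_eq_square power3_eq_cube z_sq z_sq'

lemma z_cube [simp]: "z ^ 3 = 1"
  using z by Groebner_Basis.algebra

lemma z_nonzero [simp]: "z \<noteq> 0"
  using z by auto

lemma cube_eq_1:
  assumes "x ^ 3 = 1"
  shows "x = 1 \<or> x = z \<or> x = z^2"
proof -
  have "(x - 1) * ((x - z) * (x - z^2)) = 0"
    using assms z by Groebner_Basis.algebra
  then show ?thesis by auto
qed

lemma sixth_root_cases:
  fixes a :: 'a
  assumes "a ^ 6 = 1"
  shows "a ^ 3 = 1 \<or> a ^ 3 = - 1"
proof -
  have "(a ^ 3 - 1) * (a ^ 3 + 1) = 0" using assms by Groebner_Basis.algebra
  then show ?thesis by (simp add: eq_neg_iff_add_eq_0)
qed

text \<open>The pairs \<open>(z, z)\<close> and \<open>(- 1, - (z^2))\<close> generate all pairs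
  \<open>(a, b)\<close> with \<open>a ^ 3 = b ^ 3\<close> and \<open>a ^ 6 = 1\<close>. The
  hypotheses run from a multiple back to the pair itself, because a matrix is recognised after it
  has been multiplied by group elements.\<close>

lemma orbit_diagonal:
  assumes one: "R 1 1" and scalar: "\<And>a b. R (z * a) (z * b) \<Longrightarrow> R a b"
    and step: "\<And>a b. R (- a) (- (z^2 * b)) \<Longrightarrow> R a b"
    and ab: "a ^ 3 = b ^ 3" "a ^ 6 = 1"
  shows "R a b"
proof -
  \<comment> \<open>Two uses of \<open>step\<close> leave the first entry alone and multiply the
    second by \<open>z ^ 4 = z\<close>.\<close>
  have twist: "R a b" if "R a (z * b)" for a b
  proof (rule step, rule step)
    have "- (z^2 * - (z^2 * b)) = z * b" by (simp add: z_simps)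
    then show "R (- (- a)) (- (z^2 * - (z^2 * b)))" using that by (simp only: minus_minus)
  qed
  have b: "R 1 b" if "b ^ 3 = 1" for b
    using cube_eq_1[OF that]
  proof (elim disjE)
    assume "b = z"
    then have "z * (z * b) = 1" by (simp add: z_simps)
    then show ?thesis by (intro twist[of 1 b] twist[of 1 "z * b"]) (simp add: one)
  next
    assume "b = z^2"
    then have "z * b = 1" using z by Groebner_Basis.algebra
    then show ?thesis by (intro twist[of 1 b]) (simp add: one)
  qed (simp add: one)
  have cubes: "R a b" if "a ^ 3 = 1" "b ^ 3 = 1" for a b
    using cube_eq_1[OF that(1)]
  proof (elim disjE)
    assume "a = z"
    then have "z * (z * a) = 1" by (simp add: z_simps)
    moreover have "(z * (z * b)) ^ 3 = 1" using z that by Groebner_Basis.algebra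
    ultimately show ?thesis by (intro scalar[of a b] scalar[of "z * a" "z * b"]) (simp add: b)
  next
    assume "a = z^2"
    then have "z * a = 1" "(z * b) ^ 3 = 1" using z that by Groebner_Basis.algebra+
    then show ?thesis by (intro scalar[of a b]) (simp add: b)
  qed (simp add: b that)
  from sixth_root_cases[OF ab(2)] consider "a ^ 3 = 1" | "a ^ 3 = - 1"
    by blast
  then show ?thesis
  proof cases
    case 1
    then show ?thesis using ab cubes by simp
  next
    case 2
    moreover have "(- (z^2 * b)) ^ 3 = - (b ^ 3)" using z by Groebner_Basis.algebra
    ultimately show ?thesis using ab by (intro step[OF cubes]) simp_all
  qed
qed

text \<open>The multiplicative group generated by the pairs \<open>(z, z)\<close>, \<open>(1, - z\<^sup>2)\<close> and \<open>(- 1, z)\<close>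
  consists of all pairs of sixth roots of unity.\<close>

lemma orbit_sixth_roots:
  assumes one: "R 1 1" and scalar: "\<And>a b. R (z * a) (z * b) \<Longrightarrow> R a b"
    and step1: "\<And>a b. R a (- (z^2 * b)) \<Longrightarrow> R a b"
    and step2: "\<And>a b. R (- a) (z * b) \<Longrightarrow> R a b"
    and ab: "a ^ 6 = 1" "b ^ 6 = 1"
  shows "R a b"
proof -
  \<comment> \<open>The cube of \<open>- (z^2)\<close> is \<open>- 1\<close>, hence three uses of
    \<open>step1\<close> change a sign.\<close>
  have minus: "R a b" if "R a (- b)" for a b
  proof (rule step1, rule step1, rule step1)
    have "- (z^2 * - (z^2 * - (z^2 * b))) = - b" using z by Groebner_Basis.algebra
    then show "R a (- (z^2 * - (z^2 * - (z^2 * b))))" using that by (simp only:)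
  qed
  have R: "R a b" if "a ^ 3 = b ^ 3" "a ^ 6 = 1" for a b
  proof (rule orbit_diagonal[where R = R, OF one scalar _ that])
    fix a b
    assume "R (- a) (- (z^2 * b))"
    from minus[OF this] have "R (- a) (z * (z * b))"
      by (simp add: power2_eq_square mult.assoc)
    then have "R a (z * b)" by (rule step2)
    moreover have "- (z^2 * - (z^2 * b)) = z * b" using z by Groebner_Basis.algebra
    ultimately have "R a (- (z^2 * - (z^2 * b)))" by (simp only:)
    then show "R a b" by (intro step1[of a b] step1[of a "- (z^2 * b)"])
  qed
  \<comment> \<open>Both cubes are 1 or \<open>- 1\<close>; if they differ, negating
    \<open>b\<close> makes them agree.\<close>
  from sixth_root_cases[OF ab(1)] sixth_root_cases[OF ab(2)]
  have "a ^ 3 = b ^ 3 \<or> a ^ 3 = (- b) ^ 3" by auto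
  then show ?thesis
    using R[of a b] minus[OF R[of a "- b"]] ab by auto
qed

text \<open>Likewise for the group generated by \<open>(z, z\<^sup>2)\<close>, \<open>(- 1, z\<^sup>2)\<close> and \<open>(1, z)\<close>.\<close>

lemma orbit_similitude:
  assumes one: "R 1 1" and scalar: "\<And>c t. R (z * c) (z^2 * t) \<Longrightarrow> R c t"
    and step1: "\<And>c t. R (- c) (z^2 * t) \<Longrightarrow> R c t"
    and step2: "\<And>c t. R c (z * t) \<Longrightarrow> R c t"
    and ct: "c ^ 6 = 1" "t ^ 3 = 1"
  shows "R c t"
proof -
  have t: "R c t" if "R c 1" "t ^ 3 = 1" for c t
    using cube_eq_1[OF that(2)]
  proof (elim disjE)
    assume "t = z"
    then have "z * (z * t) = 1" by (simp add: z_simps)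
    then show ?thesis using that by (intro step2[of c t] step2[of c "z * t"]) simp
  next
    assume "t = z^2"
    then have "z * t = 1" using z by Groebner_Basis.algebra
    then show ?thesis using that by (intro step2[of c t]) simp
  qed (use that in simp)
  have z2: "(z^2 * t) ^ 3 = 1" if "t ^ 3 = 1" for t
    using that z by Groebner_Basis.algebra
  have cubes: "R c t" if "c ^ 3 = 1" "t ^ 3 = 1" for c t
    using cube_eq_1[OF that(1)]
  proof (elim disjE)
    assume "c = z"
    then have c: "z * (z * c) = 1" by (simp add: z_simps)
    have "R (z * (z * c)) (z^2 * (z^2 * t))"
      unfolding c by (rule t[OF one z2[OF z2[OF that(2)]]])
    then show ?thesis by (intro scalar[of c t] scalar[of "z * c" "z^2 * t"])
  next
    assume "c = z^2"
    then have c: "z * c = 1" using z by Groebner_Basis.algebra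
    have "R (z * c) (z^2 * t)"
      unfolding c by (rule t[OF one z2[OF that(2)]])
    then show ?thesis by (rule scalar)
  qed (use that one t in simp)
  from sixth_root_cases[OF ct(1)] show ?thesis
  proof
    assume "c ^ 3 = - 1"
    then show ?thesis using ct z2 by (intro step1[OF cubes]) simp_all
  qed (use ct cubes in simp)
qed

end

section \<open>Matrices permuting a set of lines\<close>

text \<open>The vectors in \<open>V\<close> represent lines. Requiring one common value
  \<open>s\<close> for the \<open>n\<close>-th powers of all multipliers makes the condition
  multiplicative: \<open>n = 3\<close>, \<open>m = 2\<close> says that all multipliers have the same
  cube, and that this cube squares to 1. That independent lines have different images comes from
  invertibility, see \<open>separated_images\<close>.\<close>

definition monomial_on :: "('a::field^'n) set \<Rightarrow> nat \<Rightarrow> nat \<Rightarrow> 'a^'n^'n \<Rightarrow> bool" where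
  "monomial_on V n m A \<longleftrightarrow>
     (\<exists>s. s ^ m = 1 \<and> (\<forall>v\<in>V. \<exists>w\<in>V. \<exists>a. a ^ n = s \<and> A *v v = a *s w))"

lemma monomial_on_mult:
  assumes "monomial_on V n m A" "monomial_on V n m B"
  shows "monomial_on V n m (A ** B)"
proof -
  obtain s where s: "s ^ m = 1" "\<And>v. v \<in> V \<Longrightarrow> \<exists>w\<in>V. \<exists>a. a ^ n = s \<and> A *v v = a *s w"
    using assms(1) unfolding monomial_on_def by blast
  obtain t where t: "t ^ m = 1" "\<And>v. v \<in> V \<Longrightarrow> \<exists>w\<in>V. \<exists>b. b ^ n = t \<and> B *v v = b *s w"
    using assms(2) unfolding monomial_on_def by blast
  have "\<exists>w\<in>V. \<exists>c. c ^ n = s * t \<and> (A ** B) *v v = c *s w" if "v \<in> V" for v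
  proof -
    obtain w b where w: "w \<in> V" "b ^ n = t" "B *v v = b *s w" using t(2)[OF \<open>v \<in> V\<close>] by blast
    obtain u a where u: "u \<in> V" "a ^ n = s" "A *v w = a *s u" using s(2)[OF w(1)] by blast
    have "(a * b) ^ n = s * t" "(A ** B) *v v = (a * b) *s u"
      using w u by (simp_all add: power_mult_distrib matrix_vector_mul_assoc[symmetric] vector_scalar_commute mult.commute)
    then show ?thesis using u(1) by blast
  qed
  moreover have "(s * t) ^ m = 1" using s(1) t(1) by (simp add: power_mult_distrib)
  ultimately show ?thesis unfolding monomial_on_def by blast
qed

lemma mat_mult_vector: "mat c *v v = c *s (v :: 'a::field^'n)"
  by (simp add: vec_eq_iff matrix_vector_mult_def mat_def if_distrib[of "\<lambda>x. x * y" for y] cong: if_cong)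

lemma monomial_on_scalar: "(c ^ n) ^ m = 1 \<Longrightarrow> monomial_on V n m (mat c)"
  unfolding monomial_on_def by (intro exI[of _ "c ^ n"]) (auto simp: mat_mult_vector)

lemma monomial_on_singletonI:
  "A *v v = a *s v \<Longrightarrow> (a ^ n) ^ m = 1 \<Longrightarrow> monomial_on {v} n m A"
  unfolding monomial_on_def by auto

lemma monomial_on_pairI:
  "A *v v = a *s v' \<Longrightarrow> A *v w = b *s w' \<Longrightarrow> v' \<in> {v, w} \<Longrightarrow> w' \<in> {v, w} \<Longrightarrow>
   a ^ n = b ^ n \<Longrightarrow> (a ^ n) ^ m = 1 \<Longrightarrow> monomial_on {v, w} n m A"
  unfolding monomial_on_def
  by (intro exI[of _ "a ^ n"] conjI ballI) (auto intro: exI[of _ a] exI[of _ b])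

lemma monomial_on_tripleI:
  assumes "A *v u = a *s u'" "A *v v = b *s v'" "A *v w = c *s w'"
    "u' \<in> {u, v, w}" "v' \<in> {u, v, w}" "w' \<in> {u, v, w}"
    "a ^ n = b ^ n" "a ^ n = c ^ n" "(a ^ n) ^ m = 1"
  shows "monomial_on {u, v, w} n m A"
proof -
  have "\<exists>y\<in>{u, v, w}. \<exists>d. d ^ n = a ^ n \<and> A *v x = d *s y" if "x \<in> {u, v, w}" for x
    using that assms by (metis insert_iff singletonD)
  then show ?thesis
    unfolding monomial_on_def using assms(9) by blast
qed

lemma monomial_on_singletonE:
  assumes "monomial_on {v} n m A"
  obtains a where "A *v v = a *s v" "(a ^ n) ^ m = 1"
  using assms unfolding monomial_on_def by auto

definition separated :: "'a::field^'n \<Rightarrow> 'a^'n \<Rightarrow> bool" where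
  "separated v w \<longleftrightarrow> (\<forall>a b. a *s v = b *s w \<longrightarrow> a = 0 \<and> b = 0)"

text \<open>Both \<open>b *s v\<close> and \<open>a *s w\<close> are sent to
  \<open>(a * b) *s u\<close>, so invertibility makes them equal.\<close>

lemma separated_images:
  assumes "det A = 1" "separated v w" "A *v v = a *s u" "A *v w = b *s u"
  shows "a = 0"
proof -
  have "invertible A" using assms(1) by (simp add: invertible_det_nz)
  then obtain B where B: "B ** A = mat 1" by (auto simp: invertible_def)
  have "A *v (b *s v) = A *v (a *s w)"
    using assms by (simp add: vector_scalar_commute mult.commute)
  then have "(B ** A) *v (b *s v) = (B ** A) *v (a *s w)"
    by (simp only: matrix_vector_mul_assoc[symmetric])
  then show ?thesis
    using assms(2) by (simp add: B separated_def)
qed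

lemma monomial_on_pairE:
  assumes mono: "monomial_on {v, w} n m A" and "det A = 1" "separated v w" and nm: "n > 0" "m > 0"
  obtains a b where "a ^ n = b ^ n" "(a ^ n) ^ m = 1" "A *v v = a *s v" "A *v w = b *s w"
    | a b where "a ^ n = b ^ n" "(a ^ n) ^ m = 1" "A *v v = a *s w" "A *v w = b *s v"
proof -
  obtain s v' a w' b where s: "s ^ m = 1" "v' \<in> {v, w}" "w' \<in> {v, w}" "a ^ n = s" "b ^ n = s"
    "A *v v = a *s v'" "A *v w = b *s w'"
    using mono unfolding monomial_on_def by blast
  have "a \<noteq> 0" using s(1,4) nm by (auto simp: power_0_left)
  then have "v' \<noteq> w'" using separated_images[OF assms(2,3)] s by blast
  then consider "v' = v" "w' = w" | "v' = w" "w' = v" using s(2,3) by blast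
  then show ?thesis
  proof cases
    case 1
    show ?thesis by (rule that(1)[of a b]) (use s 1 in simp_all)
  next
    case 2
    show ?thesis by (rule that(2)[of a b]) (use s 2 in simp_all)
  qed
qed

lemma monomial_on_tripleE:
  assumes mono: "monomial_on {u, v, w} n m A" and det: "det A = 1"
    and sep: "separated u v" "separated u w" "separated v w" and nm: "n > 0" "m > 0"
  obtains u' v' w' a b c where "a ^ n = b ^ n" "a ^ n = c ^ n" "(a ^ n) ^ m = 1"
    "A *v u = a *s u'" "A *v v = b *s v'" "A *v w = c *s w'"
    "(u', v', w') \<in> {(u, v, w), (u, w, v), (v, u, w), (v, w, u), (w, u, v), (w, v, u)}"
proof -
  obtain s where sm: "s ^ m = 1"
    and s: "\<And>x. x \<in> {u, v, w} \<Longrightarrow> \<exists>y\<in>{u, v, w}. \<exists>a. a ^ n = s \<and> A *v x = a *s y"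
    using mono unfolding monomial_on_def by blast
  obtain u' a where u: "u' \<in> {u, v, w}" "a ^ n = s" "A *v u = a *s u'" using s[of u] by blast
  obtain v' b where v: "v' \<in> {u, v, w}" "b ^ n = s" "A *v v = b *s v'" using s[of v] by blast
  obtain w' c where w: "w' \<in> {u, v, w}" "c ^ n = s" "A *v w = c *s w'" using s[of w] by blast
  have nz: "a \<noteq> 0" "b \<noteq> 0" using sm u(2) v(2) nm by (auto simp: power_0_left)
  have "u' \<noteq> v'" using separated_images[OF det sep(1) u(3)] v(3) nz by blast
  moreover have "u' \<noteq> w'" using separated_images[OF det sep(2) u(3)] w(3) nz by blast
  moreover have "v' \<noteq> w'" using separated_images[OF det sep(3) v(3)] w(3) nz by blast
  ultimately have "(u', v', w') \<in> {(u, v, w), (u, w, v), (v, u, w), (v, w, u), (w, u, v), (w, v, u)}"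
    using u(1) v(1) w(1) by blast
  with u v w sm show ?thesis by (intro that[of a b c u' v' w']) simp_all
qed

lemma basis_eqI:
  assumes "det (M3 u1 v1 w1 u2 v2 w2 u3 v3 w3) \<noteq> 0"
    "A *v vector [u1, u2, u3] = B *v vector [u1, u2, u3]"
    "A *v vector [v1, v2, v3] = B *v vector [v1, v2, v3]"
    "A *v vector [w1, w2, w3] = B *v vector [w1, w2, w3]"
  shows "A = (B :: 'a::field^3^3)"
proof -
  let ?F = "M3 u1 v1 w1 u2 v2 w2 u3 v3 w3"
  obtain a b c d e f g h j where A: "A = M3 a b c d e f g h j" by (rule M3_cases)
  obtain a' b' c' d' e' f' g' h' j' where B: "B = M3 a' b' c' d' e' f' g' h' j'" by (rule M3_cases)
  have AB: "A ** ?F = B ** ?F"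
    using assms(2-4) unfolding A B M3_mult M3_mult_vector M3_eq_iff vector_3_eq_iff by blast
  obtain G where G: "?F ** G = mat 1"
    using assms(1) invertible_det_nz invertible_def by blast
  have "A ** (?F ** G) = B ** (?F ** G)"
    unfolding matrix_mul_assoc AB ..
  then show ?thesis
    by (simp only: G matrix_mul_rid)
qed

section \<open>The generators\<close>

text \<open>Here \<open>z\<close> is the cube root of unity \<open>\<omega>\<^sup>i\<close> of the statement.\<close>

locale five_polytope = cube_root z for z :: "'a::{field,finite}" +
  fixes k :: 'a
  assumes k: "k = 1 \<or> k = - 1" and prime_card: "prime CARD('a)"
    and two_nonzero: "(2 :: 'a) \<noteq> 0" and z_neq_1: "z \<noteq> 1"
begin

lemma z_sq_neq: "z^2 \<noteq> 1" "z^2 \<noteq> z" "z * z \<noteq> 1" "z * z \<noteq> z"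
  using z_neq_1 z_cube by (auto simp: power2_eq_square power3_eq_cube)

lemma k_sq: "k * k = 1" "k * (k * x) = x" and k_nonzero [simp]: "k \<noteq> 0"
  using k by auto

definition s1 :: "'a^3^3" where "s1 = M3 1 0 0 0 z 0 0 0 (z^2)"
definition s2 :: "'a^3^3" where "s2 = M3 (-1) 0 (-k) 0 (- (z^2)) (- k * z^2) 0 0 z"
definition s3 :: "'a^3^3" where "s3 = M3 1 k 0 0 k 1 0 (-1) 0"
definition s4 :: "'a^3^3" where "s4 = M3 0 1 0 0 0 1 1 0 0"
text \<open>From here on the matrices are products of consecutive generators, evaluated in advance
  by means of \<open>z ^ 3 = 1\<close>; \<open>t_products\<close> confirms them.\<close>

definition t12 :: "'a^3^3" where "t12 = M3 (-1) 0 (-k) 0 (-1) (-k) 0 0 1"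
definition t23 :: "'a^3^3" where "t23 = M3 (-1) 0 0 0 0 (- (z^2)) 0 (- z) 0"
definition t34 :: "'a^3^3" where "t34 = M3 0 1 k 1 0 k 0 0 (-1)"
definition t13 :: "'a^3^3" where "t13 = M3 (-1) 0 0 0 0 (-1) 0 (-1) 0"
definition t24 :: "'a^3^3" where "t24 = M3 0 (-1) 0 (- (z^2)) 0 0 0 0 (- z)"
definition t14 :: "'a^3^3" where "t14 = M3 0 (-1) 0 (-1) 0 0 0 0 (-1)"

lemmas t_defs = s1_def s2_def s3_def s4_def t12_def t23_def t34_def t13_def t24_def t14_def

lemma det_t [simp]:
  "det s1 = 1" "det s2 = 1" "det s3 = 1" "det s4 = 1" "det t12 = 1" "det t23 = 1" "det t34 = 1"
  "det t13 = 1" "det t24 = 1" "det t14 = 1"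
  using k by (auto simp: t_defs det_M3 z_simps)

lemma t_products:
  "s1 ** s2 = t12" "s2 ** s3 = t23" "s3 ** s4 = t34" "s1 ** t23 = t13" "s2 ** t34 = t24"
  "t23 ** s4 = t24" "s1 ** t24 = t14" "t12 ** s3 = t13" "t12 ** t34 = t14" "t13 ** s4 = t14"
  using k by (auto simp: t_defs z_simps)

section \<open>The tuple and the subgroups attached to sets of vertices\<close>

definition sigma :: "('a^3^3) set list" where
  "sigma = [PSL_class s1, PSL_class s2, PSL_class s3, PSL_class s4]"

lemma tau_eq:
  "chiral_tau PSL sigma (Suc 0) (Suc 0) = PSL_class s1" "chiral_tau PSL sigma 2 2 = PSL_class s2"
  "chiral_tau PSL sigma 3 3 = PSL_class s3" "chiral_tau PSL sigma 4 4 = PSL_class s4"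
  "chiral_tau PSL sigma (Suc 0) 2 = PSL_class t12" "chiral_tau PSL sigma 2 3 = PSL_class t23"
  "chiral_tau PSL sigma 3 4 = PSL_class t34" "chiral_tau PSL sigma (Suc 0) 3 = PSL_class t13"
  "chiral_tau PSL sigma 2 4 = PSL_class t24" "chiral_tau PSL sigma (Suc 0) 4 = PSL_class t14"
  by (simp_all add: chiral_tau_def sigma_def upt_conv_Cons PSL_class_one[symmetric]
      PSL_class_mult t_products)

text \<open>An entry \<open>(a, b, t)\<close> belongs to the \<tau> with first index
  \<open>a + 1\<close> and last index \<open>b\<close>. The shift makes \<open>a\<close> and
  \<open>b\<close> the two vertices that have to avoid \<open>I\<close> in the intersection
  property.\<close>

definition tau_table :: "(nat \<times> nat \<times> ('a^3^3)) set" where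
  "tau_table = {(0, 1, s1), (1, 2, s2), (2, 3, s3), (3, 4, s4), (0, 2, t12), (1, 3, t23), (2, 4, t34),
     (0, 3, t13), (1, 4, t24), (0, 4, t14)}"

definition L :: "nat set \<Rightarrow> ('a^3^3) set" where
  "L I = PSL_lift {PSL_class t | a b t. (a, b, t) \<in> tau_table \<and> a \<notin> I \<and> b \<notin> I}"

lemma tau_table_entry:
  assumes "1 \<le> i" "i \<le> j" "j \<le> (4::nat)"
  shows "\<exists>t. (i - 1, j, t) \<in> tau_table \<and> chiral_tau PSL sigma i j = PSL_class t"
proof -
  have "i = 1 \<and> j = 1 \<or> i = 2 \<and> j = 2 \<or> i = 3 \<and> j = 3 \<or> i = 4 \<and> j = 4 \<or> i = 1 \<and> j = 2 \<or>
      i = 2 \<and> j = 3 \<or> i = 3 \<and> j = 4 \<or> i = 1 \<and> j = 3 \<or> i = 2 \<and> j = 4 \<or> i = 1 \<and> j = 4"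
    using assms by arith
  then show ?thesis
    by (elim disjE conjE) (simp_all add: tau_table_def tau_eq exI)
qed

lemma tau_table_tau:
  assumes "(a, b, t) \<in> tau_table"
  shows "PSL_class t = chiral_tau PSL sigma (Suc a) b \<and> Suc a \<le> b \<and> b \<le> 4"
  using assms unfolding tau_table_def by (elim insertE emptyE Pair_inject) (simp_all add: tau_eq flip: numeral_2_eq_2)

lemma chiral_subgroup_sigma:
  "chiral_subgroup PSL 5 sigma I =
     generate PSL {PSL_class t | a b t. (a, b, t) \<in> tau_table \<and> a \<notin> I \<and> b \<notin> I}"
proof -
  have "{chiral_tau PSL sigma i j | i j. 1 \<le> i \<and> i \<le> j \<and> j \<le> 5 - 1 \<and> i - 1 \<notin> I \<and> j \<notin> I}
      = {PSL_class t | a b t. (a, b, t) \<in> tau_table \<and> a \<notin> I \<and> b \<notin> I}" (is "?S = ?T")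
  proof
    show "?S \<subseteq> ?T"
    proof clarify
      fix i j :: nat
      assume ij: "1 \<le> i" "i \<le> j" "j \<le> 5 - 1" "i - 1 \<notin> I" "j \<notin> I"
      then have "\<exists>t. (i - 1, j, t) \<in> tau_table \<and> chiral_tau PSL sigma i j = PSL_class t"
        by (intro tau_table_entry) simp_all
      then show "\<exists>a b t. chiral_tau PSL sigma i j = PSL_class t \<and> (a, b, t) \<in> tau_table \<and> a \<notin> I \<and> b \<notin> I"
        using ij by blast
    qed
    show "?T \<subseteq> ?S"
    proof clarify
      fix a b t
      assume t: "(a, b, t) \<in> tau_table" "a \<notin> I" "b \<notin> I"
      show "\<exists>i j. PSL_class t = chiral_tau PSL sigma i j \<and> 1 \<le> i \<and> i \<le> j \<and> j \<le> 5 - 1 \<and> i - 1 \<notin> I \<and> j \<notin> I"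
        using tau_table_tau[OF t(1)] t(2,3) by (intro exI[of _ "Suc a"] exI[of _ b]) simp
    qed
  qed
  then show ?thesis
    by (simp add: chiral_subgroup_def)
qed

lemma tau_table_det: "(a, b, t) \<in> tau_table \<Longrightarrow> det t = 1"
  unfolding tau_table_def by (elim insertE emptyE Pair_inject) simp_all

lemma tau_table_carrier:
  "{PSL_class t | a b t. (a, b, t) \<in> tau_table \<and> a \<notin> I \<and> b \<notin> I} \<subseteq> carrier PSL"
  by (auto simp: tau_table_det)

lemma PSL_class_in_chiral_subgroup:
  "det A = 1 \<Longrightarrow> PSL_class A \<in> chiral_subgroup PSL 5 sigma I \<longleftrightarrow> A \<in> L I"
  by (simp add: chiral_subgroup_sigma L_def PSL_lift_def)

lemma chiral_subgroup_carrier: "chiral_subgroup PSL 5 sigma I \<subseteq> carrier PSL"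
  unfolding chiral_subgroup_sigma
  using group.generate_in_carrier[OF group_PSL tau_table_carrier] by blast

lemma L_det: "A \<in> L I \<Longrightarrow> det A = 1"
  by (auto simp: L_def PSL_lift_def)

lemma L_incl: "(a, b, t) \<in> tau_table \<Longrightarrow> a \<notin> I \<Longrightarrow> b \<notin> I \<Longrightarrow> det t = 1 \<Longrightarrow> t \<in> L I"
  unfolding L_def by (intro PSL_lift_incl) blast+

lemma L_gen:
  "0 \<notin> I \<Longrightarrow> 1 \<notin> I \<Longrightarrow> s1 \<in> L I" "1 \<notin> I \<Longrightarrow> 2 \<notin> I \<Longrightarrow> s2 \<in> L I"
  "2 \<notin> I \<Longrightarrow> 3 \<notin> I \<Longrightarrow> s3 \<in> L I" "3 \<notin> I \<Longrightarrow> 4 \<notin> I \<Longrightarrow> s4 \<in> L I"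
  "0 \<notin> I \<Longrightarrow> 2 \<notin> I \<Longrightarrow> t12 \<in> L I" "1 \<notin> I \<Longrightarrow> 3 \<notin> I \<Longrightarrow> t23 \<in> L I"
  "2 \<notin> I \<Longrightarrow> 4 \<notin> I \<Longrightarrow> t34 \<in> L I" "0 \<notin> I \<Longrightarrow> 3 \<notin> I \<Longrightarrow> t13 \<in> L I"
  "1 \<notin> I \<Longrightarrow> 4 \<notin> I \<Longrightarrow> t24 \<in> L I" "0 \<notin> I \<Longrightarrow> 4 \<notin> I \<Longrightarrow> t14 \<in> L I"
  by (simp_all add: L_incl[of 0 1] L_incl[of 1 2] L_incl[of 2 3] L_incl[of 3 4] L_incl[of 0 2]
      L_incl[of 1 3] L_incl[of 2 4] L_incl[of 0 3] L_incl[of 1 4] L_incl[of 0 4] tau_table_def)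

lemma L_mult: "A \<in> L I \<Longrightarrow> B \<in> L I \<Longrightarrow> A ** B \<in> L I"
  unfolding L_def by (rule PSL_lift_mult)

lemma L_scalar: "c ^ 3 = 1 \<Longrightarrow> mat c \<in> L I"
  unfolding L_def by (rule PSL_lift_scalar) (simp add: det_mat_3)

lemma L_cancel: "B \<in> L I \<Longrightarrow> A ** B \<in> L I \<Longrightarrow> det A = 1 \<Longrightarrow> A \<in> L I"
  unfolding L_def using PSL_lift_cancel_right[OF tau_table_carrier] by blast

lemma L_cancel_z: "A ** mat z \<in> L I \<Longrightarrow> det A = 1 \<Longrightarrow> A \<in> L I"
  by (rule L_cancel[OF L_scalar]) auto

text \<open>Checking the generators suffices by \<open>PSL_lift_invariant\<close>. A scalar
  \<open>d\<close> with \<open>d ^ 3 = 1\<close> satisfies the condition because 3 divides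
  \<open>n * m\<close>.\<close>

lemma L_monomial_on:
  assumes A: "A \<in> L I" and c: "c \<in> I" and nm: "(n * m) mod 3 = 0"
    and gens: "\<And>a b t. (a, b, t) \<in> tau_table \<Longrightarrow> a \<noteq> c \<Longrightarrow> b \<noteq> c \<Longrightarrow> monomial_on V n m t"
  shows "monomial_on V n m A"
proof (rule PSL_lift_invariant[where Q = "monomial_on V n m", OF _ _ _ A[unfolded L_def]])
  show "{PSL_class t | a b t. (a, b, t) \<in> tau_table \<and> a \<notin> I \<and> b \<notin> I} \<subseteq>
    {PSL_class g |g. det g = 1 \<and> (\<forall>A. monomial_on V n m A \<longrightarrow> monomial_on V n m (A ** g))}"
  proof clarify
    fix a b t
    assume t: "(a, b, t) \<in> tau_table" "a \<notin> I" "b \<notin> I"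
    then have "monomial_on V n m t" using c by (intro gens) auto
    moreover have "det t = 1" using t(1) by (rule tau_table_det)
    ultimately show "\<exists>g. PSL_class t = PSL_class g \<and> det g = 1 \<and>
        (\<forall>A. monomial_on V n m A \<longrightarrow> monomial_on V n m (A ** g))"
      using monomial_on_mult by blast
  qed
  show "monomial_on V n m (mat d ** A)" if d: "det (mat d :: 'a^3^3) = 1" and "monomial_on V n m A" for d A
  proof -
    obtain j where j: "n * m = 3 * j" using nm by (metis mod_0_imp_dvd dvdE)
    have "(d ^ n) ^ m = (d ^ 3) ^ j" using j by (simp flip: power_mult)
    then have "(d ^ n) ^ m = 1" using d by (simp add: det_mat_3)
    then show ?thesis using that by (intro monomial_on_mult monomial_on_scalar)
  qed
qed (simp add: monomial_on_scalar)

end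

section \<open>Invariants of the five vertex subgroups\<close>

abbreviation (input) e1 :: "'a::field^3" where "e1 \<equiv> vector [1, 0, 0]"
abbreviation (input) e2 :: "'a::field^3" where "e2 \<equiv> vector [0, 1, 0]"
abbreviation (input) e3 :: "'a::field^3" where "e3 \<equiv> vector [0, 0, 1]"
abbreviation (input) f1 :: "'a::field^3" where "f1 \<equiv> vector [1, 1, 0]"
abbreviation (input) f2 :: "'a::field^3" where "f2 \<equiv> vector [1, 0, 1]"
abbreviation (input) f3 :: "'a::field^3" where "f3 \<equiv> vector [0, 1, 1]"

lemma separated_e: "separated e1 e2" "separated e1 e3" "separated e2 e3"
  by (auto simp: separated_def vector_3_eq_iff)

lemma separated_f: "separated f1 f2" "separated f1 f3" "separated f2 f3"
  by (auto simp: separated_def vector_3_eq_iff)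

lemma eigen_mult:
  fixes A :: "'a::field^'n^'n"
  assumes "A *v v = a *s v" "B *v v = b *s v"
  shows "(A ** B) *v v = (a * b) *s v"
  by (simp add: matrix_vector_mul_assoc[symmetric] assms vector_scalar_commute mult.commute)

lemma image_mult:
  fixes A :: "'a::field^'n^'n"
  assumes "B *v v = b *s w" "A *v w = a *s u"
  shows "(A ** B) *v v = (a * b) *s u"
  by (simp add: matrix_vector_mul_assoc[symmetric] assms vector_scalar_commute mult.commute)

context five_polytope
begin

abbreviation (input) v1 :: "'a^3" where "v1 \<equiv> vector [1, z, z^2]"
abbreviation (input) v2 :: "'a^3" where "v2 \<equiv> vector [1, z^2, z]"

text \<open>The predicate \<open>Qc\<close> describes the geometry preserved by the elements \<open>\<tau>\<close> avoiding the vertex \<open>c\<close>: a point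
  (\<open>Q4\<close>, and \<open>Q0\<close> for \<open>k = 1\<close>), a pair of points (\<open>Q3\<close>, and \<open>Q1\<close> for \<open>k = 1\<close>), a triangle (\<open>Q2\<close>, and \<open>Q1\<close> for
  \<open>k = - 1\<close>), or a quadratic form up to scalars with Gram matrix \<open>N\<close> (\<open>Q0\<close> for \<open>k = - 1\<close>). The exponents bound the
  admissible eigenvalues; conditions relating them to the parity of the permutation of the points
  need not be imposed, because they follow from the determinant being 1.\<close>

definition N :: "'a^3^3" where "N = M3 0 1 (z^2) 1 0 z (z^2) z 0"

definition similitude :: "'a^3^3 \<Rightarrow> bool" where
  "similitude A \<longleftrightarrow> (\<exists>t. t ^ 3 = 1 \<and> transpose A ** N ** A = mat t ** N)"

definition Q0 :: "'a^3^3 \<Rightarrow> bool" where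
  "Q0 A = (if k = 1 then monomial_on {v1} 6 1 A else similitude A)"
definition Q1 :: "'a^3^3 \<Rightarrow> bool" where
  "Q1 A = (if k = 1 then monomial_on {v1, v2} 3 2 A else monomial_on {f1, f2, f3} 2 3 A)"
definition Q2 :: "'a^3^3 \<Rightarrow> bool" where "Q2 = monomial_on {e1, e2, e3} 3 2"
definition Q3 :: "'a^3^3 \<Rightarrow> bool" where "Q3 = monomial_on {e1, e2} 3 2"
definition Q4 :: "'a^3^3 \<Rightarrow> bool" where "Q4 = monomial_on {e1} 6 1"

lemma z_sixth: "z ^ 6 = 1"
  using z by Groebner_Basis.algebra

lemma z_square_cube: "(z^2) ^ 3 = 1"
  using z by Groebner_Basis.algebra

lemma one_plus_z_sixth: "(1 + z) ^ 6 = 1"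
  using z by Groebner_Basis.algebra

lemma separated_v: "separated v1 v2"
  unfolding separated_def
proof (intro allI impI)
  fix a b
  assume "a *s v1 = b *s v2"
  then have ab: "a * 1 = b * 1" "a * z = b * z^2" unfolding smult_vector_3 vector_3_eq_iff by blast+
  then have "b * (z - z^2) = 0" by (simp add: right_diff_distrib)
  then show "a = 0 \<and> b = 0" using z_sq_neq(2)[symmetric] ab(1) by simp
qed

lemma similitude_mult_factor:
  assumes "transpose A ** N ** A = mat t ** N" "transpose B ** N ** B = mat u ** N"
  shows "transpose (A ** B) ** N ** (A ** B) = mat (t * u) ** N"
proof -
  have "transpose (A ** B) ** N ** (A ** B) = transpose B ** (transpose A ** N ** A) ** B"
    by (simp add: matrix_transpose_mul matrix_mul_assoc)
  also have "\<dots> = mat t ** (transpose B ** N ** B)"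
    by (simp add: assms(1) matrix_mul_assoc flip: mat_mult_commute)
  also have "\<dots> = mat (t * u) ** N"
    by (simp add: assms(2) matrix_mul_assoc mat_mult_mat)
  finally show ?thesis .
qed

lemma similitude_mult: "similitude A \<Longrightarrow> similitude B \<Longrightarrow> similitude (A ** B)"
proof -
  assume "similitude A" "similitude B"
  then obtain t u where "t ^ 3 = 1" "u ^ 3 = 1" "transpose A ** N ** A = mat t ** N"
    "transpose B ** N ** B = mat u ** N"
    unfolding similitude_def by blast
  then show "similitude (A ** B)"
    unfolding similitude_def
    by (intro exI[of _ "t * u"] conjI similitude_mult_factor) (simp_all add: power_mult_distrib)
qed

lemma similitude_scalar_factor: "transpose (mat c) ** N ** mat c = mat (c^2) ** N"
  by (simp add: mat_M3 N_def power2_eq_square algebra_simps)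

lemma similitude_scalar: "c ^ 3 = 1 \<Longrightarrow> similitude (mat c)"
  unfolding similitude_def
  by (rule exI[of _ "c^2"], rule conjI[OF _ similitude_scalar_factor]) Groebner_Basis.algebra

lemma Q0_mult: "Q0 A \<Longrightarrow> Q0 B \<Longrightarrow> Q0 (A ** B)"
  by (simp add: Q0_def monomial_on_mult similitude_mult split: if_splits)

lemma Q1_mult: "Q1 A \<Longrightarrow> Q1 B \<Longrightarrow> Q1 (A ** B)"
  by (simp add: Q1_def monomial_on_mult split: if_splits)

lemma Q2_mult: "Q2 A \<Longrightarrow> Q2 B \<Longrightarrow> Q2 (A ** B)"
  by (simp add: Q2_def monomial_on_mult)

lemma Q0_scalar: "c ^ 3 = 1 \<Longrightarrow> Q0 (mat c)"
  using power_mult[of c 3 2] by (simp add: Q0_def monomial_on_scalar similitude_scalar)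

text \<open>Once a vertex is deleted, the three \<tau>s between consecutive remaining vertices
  generate the other three, so only they are computed: here \<open>s1\<close>, \<open>s2\<close>,
  \<open>s3\<close>. The lemmas for the other vertices follow the same pattern.\<close>

lemma L_Q4:
  assumes "A \<in> L I" "4 \<in> I"
  shows "Q4 A"
  unfolding Q4_def
proof (rule L_monomial_on[OF assms])
  have g: "monomial_on {e1} 6 1 s1" "monomial_on {e1} 6 1 s2" "monomial_on {e1} 6 1 s3"
    using monomial_on_singletonI[of s1 e1 1 6 1] monomial_on_singletonI[of s2 e1 "-1" 6 1]
      monomial_on_singletonI[of s3 e1 1 6 1]
    by (simp_all add: t_defs)
  note gs = g monomial_on_mult[OF g(1,2)] monomial_on_mult[OF g(2,3)]
    monomial_on_mult[OF g(1) monomial_on_mult[OF g(2,3)]]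
  show "monomial_on {e1} 6 1 t" if "(a, b, t) \<in> tau_table" "a \<noteq> 4" "b \<noteq> 4" for a b t
    using that gs unfolding tau_table_def t_products
    by (elim insertE emptyE Pair_inject) simp_all
qed simp

lemma L_Q3:
  assumes "A \<in> L I" "3 \<in> I"
  shows "Q3 A"
  unfolding Q3_def
proof (rule L_monomial_on[OF assms])
  have g1: "monomial_on {e1, e2} 3 2 s1"
    by (rule monomial_on_pairI[of _ _ 1 e1 _ z e2]) (simp_all add: t_defs)
  have g2: "monomial_on {e1, e2} 3 2 s2"
    by (rule monomial_on_pairI[of _ _ "- 1" e1 _ "- (z^2)" e2])
      (use power_mult[of z 3 2] in \<open>simp_all add: t_defs z_sixth\<close>)
  have g3: "monomial_on {e1, e2} 3 2 t34"
    by (rule monomial_on_pairI[of _ _ 1 e2 _ 1 e1]) (simp_all add: t_defs)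
  note gs = g1 g2 g3 monomial_on_mult[OF g1 g2] monomial_on_mult[OF g2 g3]
    monomial_on_mult[OF g1 monomial_on_mult[OF g2 g3]]
  show "monomial_on {e1, e2} 3 2 t" if "(a, b, t) \<in> tau_table" "a \<noteq> 3" "b \<noteq> 3" for a b t
    using that gs unfolding tau_table_def t_products
    by (elim insertE emptyE Pair_inject) simp_all
qed simp

lemma L_Q2:
  assumes "A \<in> L I" "2 \<in> I"
  shows "Q2 A"
  unfolding Q2_def
proof (rule L_monomial_on[OF assms])
  have g1: "monomial_on {e1, e2, e3} 3 2 s1"
    by (rule monomial_on_tripleI[of _ _ 1 e1 _ z e2 _ "z^2" e3])
      (use power_mult[of z 3 2] in \<open>simp_all add: t_defs z_sixth\<close>)
  have g2: "monomial_on {e1, e2, e3} 3 2 t23"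
    by (rule monomial_on_tripleI[of _ _ "- 1" e1 _ "- z" e3 _ "- (z^2)" e2])
      (use power_mult[of z 3 2] in \<open>simp_all add: t_defs z_sixth\<close>)
  have g3: "monomial_on {e1, e2, e3} 3 2 s4"
    by (rule monomial_on_tripleI[of _ _ 1 e3 _ 1 e1 _ 1 e2]) (simp_all add: t_defs)
  note gs = g1 g2 g3 monomial_on_mult[OF g1 g2] monomial_on_mult[OF g2 g3]
    monomial_on_mult[OF g1 monomial_on_mult[OF g2 g3]]
  show "monomial_on {e1, e2, e3} 3 2 t" if "(a, b, t) \<in> tau_table" "a \<noteq> 2" "b \<noteq> 2" for a b t
    using that gs unfolding tau_table_def t_products
    by (elim insertE emptyE Pair_inject) simp_all
qed simp

lemma L_Q1:
  assumes "A \<in> L I" "1 \<in> I"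
  shows "Q1 A"
proof (cases "k = 1")
  case True
  have "monomial_on {v1, v2} 3 2 A"
  proof (rule L_monomial_on[OF assms])
    have g1: "monomial_on {v1, v2} 3 2 t12"
      unfolding t_defs by (rule monomial_on_pairI[of _ _ z v2 _ "z^2" v1])
        (use power_mult[of z 3 2] True in \<open>simp_all add: t_defs z_sixth vector_3_eq_iff z_simps\<close>)
    have g2: "monomial_on {v1, v2} 3 2 s3"
      unfolding t_defs by (rule monomial_on_pairI[of _ _ "- (z^2)" v1 _ "- z" v2])
        (use power_mult[of z 3 2] True in \<open>simp_all add: t_defs z_sixth vector_3_eq_iff z_simps\<close>)
    have g3: "monomial_on {v1, v2} 3 2 s4"
      unfolding t_defs by (rule monomial_on_pairI[of _ _ z v1 _ "z^2" v2])
        (use power_mult[of z 3 2] True in \<open>simp_all add: t_defs z_sixth vector_3_eq_iff z_simps\<close>)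
    note gs = g1 g2 g3 monomial_on_mult[OF g1 g2] monomial_on_mult[OF g2 g3]
      monomial_on_mult[OF g1 monomial_on_mult[OF g2 g3]]
    show "monomial_on {v1, v2} 3 2 t" if "(a, b, t) \<in> tau_table" "a \<noteq> 1" "b \<noteq> 1" for a b t
      using that gs unfolding tau_table_def t_products
      by (elim insertE emptyE Pair_inject) simp_all
  qed simp
  then show ?thesis unfolding Q1_def using True by simp
next
  case False
  then have k': "k = - 1" using k by blast
  have "monomial_on {f1, f2, f3} 2 3 A"
  proof (rule L_monomial_on[OF assms])
    have g1: "monomial_on {f1, f2, f3} 2 3 t12"
      unfolding t_defs by (rule monomial_on_tripleI[of _ _ "- 1" f1 _ 1 f3 _ 1 f2])
        (use k' in \<open>simp_all add: t_defs vector_3_eq_iff\<close>)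
    have g2: "monomial_on {f1, f2, f3} 2 3 s3"
      unfolding t_defs by (rule monomial_on_tripleI[of _ _ "- 1" f3 _ 1 f1 _ "- 1" f2])
        (use k' in \<open>simp_all add: t_defs vector_3_eq_iff\<close>)
    have g3: "monomial_on {f1, f2, f3} 2 3 s4"
      unfolding t_defs by (rule monomial_on_tripleI[of _ _ 1 f2 _ 1 f3 _ 1 f1])
        (use k' in \<open>simp_all add: t_defs vector_3_eq_iff\<close>)
    note gs = g1 g2 g3 monomial_on_mult[OF g1 g2] monomial_on_mult[OF g2 g3]
      monomial_on_mult[OF g1 monomial_on_mult[OF g2 g3]]
    show "monomial_on {f1, f2, f3} 2 3 t" if "(a, b, t) \<in> tau_table" "a \<noteq> 1" "b \<noteq> 1" for a b t
      using that gs unfolding tau_table_def t_products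
      by (elim insertE emptyE Pair_inject) simp_all
  qed simp
  then show ?thesis by (simp add: Q1_def False)
qed

lemma similitude_factors:
  assumes "k = - 1"
  shows "transpose s2 ** N ** s2 = mat (z^2) ** N" "transpose s3 ** N ** s3 = mat z ** N"
    "transpose s4 ** N ** s4 = mat (z^2) ** N"
  unfolding t_defs using assms by (simp_all add: N_def mat_M3 z_simps)

lemma L_Q0:
  assumes "A \<in> L I" "0 \<in> I"
  shows "Q0 A"
proof (cases "k = 1")
  case True
  have "monomial_on {v1} 6 1 A"
  proof (rule L_monomial_on[OF assms])
    have g1: "monomial_on {v1} 6 1 s2"
      unfolding t_defs by (rule monomial_on_singletonI[of _ _ z])
        (use True in \<open>simp_all add: t_defs z_sixth vector_3_eq_iff z_simps\<close>)
    have g2: "monomial_on {v1} 6 1 s3"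
      unfolding t_defs by (rule monomial_on_singletonI[of _ _ "- (z^2)"])
        (use True in \<open>simp_all add: t_defs z_sixth one_plus_z_sixth vector_3_eq_iff z_simps\<close>)
    have g3: "monomial_on {v1} 6 1 s4"
      unfolding t_defs by (rule monomial_on_singletonI[of _ _ z])
        (use True in \<open>simp_all add: t_defs z_sixth vector_3_eq_iff z_simps\<close>)
    note gs = g1 g2 g3 monomial_on_mult[OF g1 g2] monomial_on_mult[OF g2 g3]
      monomial_on_mult[OF g1 monomial_on_mult[OF g2 g3]]
    show "monomial_on {v1} 6 1 t" if "(a, b, t) \<in> tau_table" "a \<noteq> 0" "b \<noteq> 0" for a b t
      using that gs unfolding tau_table_def t_products
      by (elim insertE emptyE Pair_inject) simp_all
  qed simp
  then show ?thesis unfolding Q0_def using True by simp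
next
  case False
  then have k': "k = - 1" using k by blast
  have g1: "similitude s2" "similitude s3" "similitude s4"
    unfolding similitude_def using similitude_factors[OF k'] z_cube z_square_cube by blast+
  note gs = g1 similitude_mult[OF g1(1,2)] similitude_mult[OF g1(2,3)]
      similitude_mult[OF g1(1) similitude_mult[OF g1(2,3)]]
  have "similitude A"
  proof (rule PSL_lift_invariant[where Q = similitude, OF _ _ _ assms(1)[unfolded L_def]])
    show "{PSL_class t | a b t. (a, b, t) \<in> tau_table \<and> a \<notin> I \<and> b \<notin> I} \<subseteq>
      {PSL_class g |g. det g = 1 \<and> (\<forall>A. similitude A \<longrightarrow> similitude (A ** g))}"
    proof clarify
      fix a b t
      assume t: "(a, b, t) \<in> tau_table" "a \<notin> I" "b \<notin> I"
      then have "a \<noteq> 0" "b \<noteq> 0" using assms(2) by metis+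
      with t(1) gs have "similitude t"
        unfolding tau_table_def t_products by (elim insertE emptyE Pair_inject) simp_all
      moreover have "det t = 1" using t(1) by (rule tau_table_det)
      ultimately show "\<exists>g. PSL_class t = PSL_class g \<and> det g = 1 \<and>
          (\<forall>A. similitude A \<longrightarrow> similitude (A ** g))"
        using similitude_mult by blast
    qed
  qed (auto simp: det_mat_3 intro: similitude_mult similitude_scalar)
  then show ?thesis by (simp add: Q0_def False)
qed

section \<open>Recognising elements of the subgroups\<close>

lemma scalar_in_L: "det (mat c :: 'a^3^3) = 1 \<Longrightarrow> (mat c :: 'a^3^3) \<in> L I"
  by (simp add: L_scalar det_mat_3)

lemma sixth_root_nonzero: "(a ^ n) ^ m = 1 \<Longrightarrow> n > 0 \<Longrightarrow> m > 0 \<Longrightarrow> a \<noteq> (0 :: 'a)"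
  by (auto simp: power_0_left)

lemma z_diff_nonzero: "z - z^2 \<noteq> 0"
  using z_sq_neq by simp

lemma one_plus_two_z: "1 + 2 * z = z - z^2" "1 + 2 * z \<noteq> 0"
proof -
  show eq: "1 + 2 * z = z - z^2" using z by Groebner_Basis.algebra
  show "1 + 2 * z \<noteq> 0" unfolding eq by (rule z_diff_nonzero)
qed

section \<open>Shapes of matrices with prescribed invariants\<close>

lemma Q4_cases:
  assumes "Q4 A"
  obtains a b c e f h j where "A = M3 a b c 0 e f 0 h j" "a ^ 6 = 1"
proof -
  obtain a where a: "A *v e1 = a *s e1" "(a ^ 6) ^ 1 = 1"
    using assms unfolding Q4_def by (rule monomial_on_singletonE)
  obtain a' b c d e f g h j where A: "A = M3 a' b c d e f g h j" by (rule M3_cases)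
  have "a' = a" "d = 0" "g = 0"
    using a(1) unfolding A by (simp_all add: vector_3_eq_iff)
  then show ?thesis using that[of a b c e f h j] a(2) A by simp
qed

lemma Q3_cases:
  assumes "Q3 A" "det A = 1"
  obtains (diag) a b c x y where "A = M3 a 0 x 0 b y 0 0 c" "a ^ 3 = b ^ 3" "a ^ 6 = 1"
    | (swap) a b c x y where "A = M3 0 b x a 0 y 0 0 c" "a \<noteq> 0"
proof -
  obtain a' b' c d e f g h j where A: "A = M3 a' b' c d e f g h j" by (rule M3_cases)
  show ?thesis
  proof (rule monomial_on_pairE[OF assms(1)[unfolded Q3_def] assms(2) separated_e(1)])
    fix a b
    assume ab: "a ^ 3 = b ^ 3" "(a ^ 3) ^ 2 = 1" and im: "A *v e1 = a *s e1" "A *v e2 = b *s e2"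
    have "a ^ 6 = 1" using ab(2) by (simp flip: power_mult)
    moreover have "a' = a" "d = 0" "g = 0" "b' = 0" "e = b" "h = 0"
      using im unfolding A by (simp_all add: vector_3_eq_iff)
    ultimately show ?thesis using diag[of a c b f j] ab A by simp
  next
    fix a b
    assume ab: "(a ^ 3) ^ 2 = 1" and im: "A *v e1 = a *s e2" "A *v e2 = b *s e1"
    have "a \<noteq> 0" using ab by (rule sixth_root_nonzero) simp_all
    moreover have "a' = 0" "d = a" "g = 0" "b' = b" "e = 0" "h = 0"
      using im unfolding A by (simp_all add: vector_3_eq_iff)
    ultimately show ?thesis using swap[of b c a f j] A by simp
  qed simp_all
qed

lemma Q34_cases:
  assumes "Q3 A" "Q4 A" "det A = 1"
  obtains a b c x y where "A = M3 a 0 x 0 b y 0 0 c" "a ^ 3 = b ^ 3" "a ^ 6 = 1"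
  using assms(1,3)
proof (cases rule: Q3_cases)
  case (swap a b c x y)
  from assms(2) show ?thesis
    by (rule Q4_cases) (use swap in auto)
qed (use that in blast)

lemma Q2_images:
  assumes "Q2 A" "det A = 1"
  obtains u v w a b c where "a ^ 3 = b ^ 3" "a ^ 3 = c ^ 3" "(a ^ 3) ^ 2 = 1"
    "A *v e1 = a *s u" "A *v e2 = b *s v" "A *v e3 = c *s w"
    "(u, v, w) \<in> {(e1, e2, e3), (e1, e3, e2), (e2, e1, e3), (e2, e3, e1), (e3, e1, e2), (e3, e2, e1)}"
  by (rule monomial_on_tripleE[OF assms(1)[unfolded Q2_def] assms(2) separated_e zero_less_numeral zero_less_numeral])
    (rule that; assumption)

text \<open>The last alternative collects the three permutations that preserve neither the line of
  \<open>e1\<close> nor the plane of \<open>e1\<close> and \<open>e2\<close>. It is stated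
  negatively since \<open>Q4\<close> or \<open>Q3\<close> is going to refute it.\<close>

lemma Q2_cases:
  assumes "Q2 A" "det A = 1"
  obtains (id) a b c where "A = M3 a 0 0 0 b 0 0 0 c" "a ^ 3 = 1" "b ^ 3 = 1" "c ^ 3 = 1"
    | (swap23) a b c where "A = M3 a 0 0 0 0 c 0 b 0"
    | (swap12) a b c where "A = M3 0 b 0 a 0 0 0 0 c"
    | (other) "\<And>a b c e f h j. A \<noteq> M3 a b c 0 e f 0 h j" "\<And>a b c d e f j. A \<noteq> M3 a b c d e f 0 0 j"
proof -
  obtain u v w a b c where abc: "a ^ 3 = b ^ 3" "a ^ 3 = c ^ 3" "(a ^ 3) ^ 2 = 1"
    and im: "A *v e1 = a *s u" "A *v e2 = b *s v" "A *v e3 = c *s w"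
    and perm: "(u, v, w) \<in> {(e1, e2, e3), (e1, e3, e2), (e2, e1, e3), (e2, e3, e1), (e3, e1, e2), (e3, e2, e1)}"
    by (rule Q2_images[OF assms])
  have nz: "a \<noteq> 0" "b \<noteq> 0"
    using sixth_root_nonzero[OF abc(3)] sixth_root_nonzero[OF abc(3)[unfolded abc(1)]] by simp_all
  obtain a' b' c' d e f g h j where A: "A = M3 a' b' c' d e f g h j" by (rule M3_cases)
  have A': "vector [a', d, g] = a *s u" "vector [b', e, h] = b *s v" "vector [c', f, j] = c *s w"
    using im unfolding A by simp_all
  from perm consider "u = e1" "v = e2" "w = e3" | "u = e1" "v = e3" "w = e2"
    | "u = e2" "v = e1" "w = e3" | "u = e2" "v = e3" "w = e1" | "u = e3" "v = e1" "w = e2"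
    | "u = e3" "v = e2" "w = e1"
    by blast
  then show ?thesis
  proof cases
    case 1
    then have A'': "A = M3 a 0 0 0 b 0 0 0 c" using A' A by (simp add: vector_3_eq_iff)
    then have "a * b * c = 1" using assms(2) by (simp add: det_M3 mult.assoc)
    \<comment> \<open>The three cubes coincide; their product and the square of each are 1, so each
      cube is 1.\<close>
    then have "(a ^ 3) * (b ^ 3) * (c ^ 3) = 1" by (simp flip: power_mult_distrib)
    then have "a ^ 3 = 1" using abc by (simp add: power2_eq_square)
    then show ?thesis using id A'' abc by simp
  next
    case 2
    then have "A = M3 a 0 0 0 0 c 0 b 0" using A' A by (simp add: vector_3_eq_iff)
    then show ?thesis by (rule swap23)
  next
    case 3
    then have "A = M3 0 b 0 a 0 0 0 0 c" using A' A by (simp add: vector_3_eq_iff)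
    then show ?thesis by (rule swap12)
  next
    case 4
    then have "A = M3 0 0 c a 0 0 0 b 0" using A' A by (simp add: vector_3_eq_iff)
    then show ?thesis using nz by (intro other) auto
  next
    case 5
    then have "A = M3 0 b 0 0 0 c a 0 0" using A' A by (simp add: vector_3_eq_iff)
    then show ?thesis using nz by (intro other) auto
  next
    case 6
    then have "A = M3 0 0 c 0 b 0 a 0 0" using A' A by (simp add: vector_3_eq_iff)
    then show ?thesis using nz by (intro other) auto
  qed
qed

lemma Q24_cases:
  assumes "Q2 A" "Q4 A" "det A = 1"
  obtains (id) a b c where "A = M3 a 0 0 0 b 0 0 0 c" "a ^ 3 = 1" "b ^ 3 = 1" "c ^ 3 = 1"
    | (swap) a b c where "A = M3 a 0 0 0 0 c 0 b 0"
proof -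
  obtain a b c e f h j where A: "A = M3 a b c 0 e f 0 h j" "a ^ 6 = 1" using assms(2) by (rule Q4_cases)
  from assms(1,3) show ?thesis
  proof (cases rule: Q2_cases)
    case (swap12 a' b' c')
    then show ?thesis using A by simp
  qed (use A that in blast)+
qed

lemma Q23_cases:
  assumes "Q2 A" "Q3 A" "det A = 1"
  obtains (id) a b c where "A = M3 a 0 0 0 b 0 0 0 c" "a ^ 3 = 1" "b ^ 3 = 1" "c ^ 3 = 1"
    | (swap) a b c where "A = M3 0 b 0 a 0 0 0 0 c"
proof -
  obtain a b c d e f j where A: "A = M3 a b c d e f 0 0 j"
    using assms(2,3) by (cases rule: Q3_cases) blast+
  from assms(1,3) show ?thesis
  proof (cases rule: Q2_cases)
    case (swap23 a' b' c')
    then have "b' = 0" using A by simp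
    then show ?thesis using swap23 assms(3) by (simp add: det_M3)
  qed (use A that in blast)+
qed

text \<open>An orbit argument: one of the lines of \<open>e1\<close>, \<open>e2\<close>,
  \<open>e3\<close> is mapped by \<open>A\<close> to that of \<open>e1\<close>, and some power of
  the cyclic permutation \<open>s4\<close> moves \<open>e1\<close> there first. This gains
  \<open>Q4\<close> at the price of a factor from the group.\<close>

lemma Q2_rotate:
  assumes "Q2 A" "det A = 1"
  obtains B where "B \<in> {A, A ** s4, A ** (s4 ** s4)}" "Q2 B" "Q4 B" "det B = 1"
proof -
  obtain u v w a b c where abc: "a ^ 3 = b ^ 3" "a ^ 3 = c ^ 3" "(a ^ 3) ^ 2 = 1"
    and im: "A *v e1 = a *s u" "A *v e2 = b *s v" "A *v e3 = c *s w"
    and perm: "(u, v, w) \<in> {(e1, e2, e3), (e1, e3, e2), (e2, e1, e3), (e2, e3, e1), (e3, e1, e2), (e3, e2, e1)}"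
    by (rule Q2_images[OF assms])
  have sq: "(x ^ 6) ^ 1 = (x ^ 3)^2" for x :: 'a by (simp flip: power_mult)
  have six: "(a ^ 6) ^ 1 = 1" "(b ^ 6) ^ 1 = 1" "(c ^ 6) ^ 1 = 1"
    by (simp_all only: sq abc(1,2)[symmetric] abc(3))
  have "Q2 s4" using L_Q2[OF L_gen(4), of "{2}"] by simp
  then have Q2: "Q2 (A ** s4)" "Q2 (A ** (s4 ** s4))"
    using assms(1) by (blast intro: Q2_mult)+
  have det: "det (A ** s4) = 1" "det (A ** (s4 ** s4)) = 1"
    by (simp_all add: det_mul assms(2))
  have "s4 *v e1 = 1 *s e3" "(s4 ** s4) *v e1 = 1 *s e2" by (simp_all add: s4_def)
  note cyc = image_mult[OF this(1) im(3)] image_mult[OF this(2) im(2)]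
  from perm consider "u = e1" | "v = e1" | "w = e1" by blast
  then show ?thesis
  proof cases
    case 1
    then have "Q4 A" unfolding Q4_def using im six by (intro monomial_on_singletonI) auto
    then show ?thesis using that[of A] assms by simp
  next
    case 2
    then have "Q4 (A ** (s4 ** s4))" unfolding Q4_def
      using cyc six by (intro monomial_on_singletonI[of _ _ b]) auto
    then show ?thesis using that[of "A ** (s4 ** s4)"] Q2 det by simp
  next
    case 3
    then have "Q4 (A ** s4)" unfolding Q4_def
      using cyc six by (intro monomial_on_singletonI[of _ _ c]) auto
    then show ?thesis using that[of "A ** s4"] Q2 det by simp
  qed
qed

lemma rotate_back:
  assumes "B \<in> {A, A ** g, A ** (g ** g)}" "g \<in> L I" "B \<in> L I" "det A = 1"
  shows "A \<in> L I"
  using assms L_cancel[OF assms(2), of A] L_cancel[OF L_mult[OF assms(2,2)], of A] by auto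

text \<open>Multiplication by \<open>g\<close> and by the scalar \<open>z\<close> moves the pair of
  eigenvalues on \<open>u\<close> and \<open>w\<close> within one orbit of
  \<open>orbit_diagonal\<close>, hence to \<open>(1, 1)\<close>. The predicate \<open>P\<close>
  carries along whatever else is known about the matrix.\<close>

lemma eigen_descent:
  assumes g: "g \<in> L I" "g *v u = (- 1) *s u" "g *v w = (- (z^2)) *s w"
    and P: "\<And>A. P A \<Longrightarrow> P (A ** g)" "\<And>A. P A \<Longrightarrow> P (A ** mat z)"
    and one: "\<And>A. det A = 1 \<Longrightarrow> A *v u = u \<Longrightarrow> A *v w = w \<Longrightarrow> P A \<Longrightarrow> A \<in> L I"
    and A: "det A = 1" "A *v u = a *s u" "A *v w = b *s w" "P A"
    and ab: "a ^ 3 = b ^ 3" "a ^ 6 = 1"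
  shows "A \<in> L I"
proof -
  let ?R = "\<lambda>a b. \<forall>A. det A = 1 \<longrightarrow> A *v u = a *s u \<longrightarrow> A *v w = b *s w \<longrightarrow> P A \<longrightarrow> A \<in> L I"
  have "?R a b"
  proof (rule orbit_diagonal[where R = ?R, OF _ _ _ ab])
    show "?R 1 1" using one by simp
  next
    fix a b
    assume R: "?R (z * a) (z * b)"
    show "?R a b"
    proof (intro allI impI)
      fix A
      assume A: "det A = 1" "A *v u = a *s u" "A *v w = b *s w" "P A"
      have "det (A ** mat z) = 1" by (simp add: det_mul A(1) det_mat_3)
      moreover have "(A ** mat z) *v u = (z * a) *s u" "(A ** mat z) *v w = (z * b) *s w"
        using eigen_mult[OF A(2) mat_mult_vector, of z] eigen_mult[OF A(3) mat_mult_vector, of z]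
        by (simp_all add: mult.commute)
      ultimately have "A ** mat z \<in> L I" using R P(2)[OF A(4)] by blast
      then show "A \<in> L I" using A(1) by (rule L_cancel_z)
    qed
  next
    fix a b
    assume R: "?R (- a) (- (z^2 * b))"
    show "?R a b"
    proof (intro allI impI)
      fix A
      assume A: "det A = 1" "A *v u = a *s u" "A *v w = b *s w" "P A"
      have "det (A ** g) = 1" by (simp add: det_mul A(1) L_det[OF g(1)])
      moreover have "(A ** g) *v u = (- a) *s u" "(A ** g) *v w = (- (z^2 * b)) *s w"
        using eigen_mult[OF A(2) g(2)] eigen_mult[OF A(3) g(3)] by (simp_all add: mult.commute)
      ultimately have "A ** g \<in> L I" using R P(1)[OF A(4)] by blast
      then show "A \<in> L I" using g(1) A(1) by (blast intro: L_cancel)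
    qed
  qed
  then show ?thesis using A by blast
qed

text \<open>Conjugation by \<open>s1\<close> scales the two entries of the last column by the
  distinct factors \<open>z\<close> and \<open>z^2\<close>, so one matrix with both entries nonzero
  generates all of these.\<close>

lemma translation_in_L:
  assumes "s1 \<in> L I" "s2 \<in> L I"
  shows "M3 1 0 x 0 1 y 0 0 1 \<in> L I"
proof (rule prime_field_plane_induct[where P = "\<lambda>x y. M3 1 0 x 0 1 y 0 0 1 \<in> L I" and
      l = z and m = "z^2" and ?x0.0 = "k * (1 + 2 * z)" and ?y0.0 = "- (k * (1 + 2 * z))", OF prime_card])
  show "M3 1 0 0 0 1 0 0 0 1 \<in> L I" using L_scalar[of 1 I] by (simp add: mat_M3)
  show "M3 1 0 (x + x') 0 1 (y + y') 0 0 1 \<in> L I"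
    if "M3 1 0 x 0 1 y 0 0 1 \<in> L I" "M3 1 0 x' 0 1 y' 0 0 1 \<in> L I" for x y x' y'
    using L_mult[OF that] by (simp add: add.commute)
  show "M3 1 0 (z * x) 0 1 (z^2 * y) 0 0 1 \<in> L I" if "M3 1 0 x 0 1 y 0 0 1 \<in> L I" for x y
  proof (rule L_cancel[OF assms(1)])
    have "M3 1 0 (z * x) 0 1 (z^2 * y) 0 0 1 ** s1 = s1 ** M3 1 0 x 0 1 y 0 0 1"
      by (simp add: s1_def z_simps)
    then show "M3 1 0 (z * x) 0 1 (z^2 * y) 0 0 1 ** s1 \<in> L I"
      using L_mult[OF assms(1) that] by simp
  qed (simp add: det_M3)
  \<comment> \<open>The diagonals of the two squares are inverse to each other, which leaves a
    unipotent product; its entries are nonzero since \<open>1 + 2 * z = z - z^2\<close>.\<close>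
  have "(s2 ** s2) ** (s1 ** s1) = M3 1 0 (k * (1 + 2 * z)) 0 1 (- (k * (1 + 2 * z))) 0 0 1"
    by (simp add: s1_def s2_def z_simps)
  then show "M3 1 0 (k * (1 + 2 * z)) 0 1 (- (k * (1 + 2 * z))) 0 0 1 \<in> L I"
    using L_mult[OF L_mult[OF assms(2,2)] L_mult[OF assms(1,1)]] by simp
  show "z \<noteq> z^2" using z_sq_neq by metis
qed (use one_plus_two_z in simp_all)

text \<open>In the names \<open>in_L_\<dots>\<close> the digits are the vertices that do not belong to \<open>I\<close>: elements satisfying
  the invariants of all other vertices lie in the subgroup generated by the \<open>\<tau>\<close>s between the listed ones.
  A suffix \<open>_1\<close> or \<open>_m1\<close> stands for the value of \<open>k\<close>.\<close>

lemma in_L_012: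
  assumes "0 \<notin> I" "1 \<notin> I" "2 \<notin> I" "det A = 1" "Q3 A" "Q4 A"
  shows "A \<in> L I"
proof -
  have s: "s1 \<in> L I" "s2 \<in> L I" using assms by (simp_all add: L_gen)
  obtain a b c x y where A: "A = M3 a 0 x 0 b y 0 0 c" "a ^ 3 = b ^ 3" "a ^ 6 = 1"
    by (rule Q34_cases[OF assms(5,6,4)])
  show ?thesis
  proof (rule eigen_descent[where P = "\<lambda>_. True" and u = e1 and w = e2, OF s(2) _ _ _ _ _ assms(4) _ _ _ A(2,3)])
    fix B :: "'a^3^3"
    assume B: "det B = 1" "B *v e1 = e1" "B *v e2 = e2"
    obtain a b c d e f g h j where M: "B = M3 a b c d e f g h j" by (rule M3_cases)
    have "B = M3 1 0 c 0 1 f 0 0 j" using B(2,3) M by (simp add: vector_3_eq_iff)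
    moreover from this have "j = 1" using B(1) by (simp add: det_M3)
    ultimately show "B \<in> L I" using translation_in_L[OF s] by simp
  qed (simp_all add: A(1) s2_def)
qed

lemma inverse_z: "x * z = 1 \<Longrightarrow> x = z^2" "x * z^2 = 1 \<Longrightarrow> x = z"
proof -
  have z3: "z * z^2 = 1" using z by Groebner_Basis.algebra
  show "x = z^2" if "x * z = 1"
  proof -
    have "x * z * z^2 = x" by (simp only: mult.assoc z3 mult_1_right)
    then show ?thesis using that by simp
  qed
  show "x = z" if "x * z^2 = 1"
  proof -
    have "x * z^2 * z = x" by (simp only: mult.assoc mult.commute[of "z^2" z] z3 mult_1_right)
    then show ?thesis using that by simp
  qed
qed

text \<open>Multiplying by the scalar \<open>a^2\<close>, the inverse of \<open>a\<close>, makes the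
  first entry 1. The middle entry is then a power of \<open>z\<close> and the determinant fixes the
  last one, so a power of \<open>s1\<close> is left.\<close>

lemma diag_in_L:
  assumes "s1 \<in> L I" "a ^ 3 = 1" "b ^ 3 = 1" and det: "det (M3 a 0 0 0 b 0 0 0 c) = 1"
  shows "M3 a 0 0 0 b 0 0 0 c \<in> L I"
proof -
  have a: "a * a^2 = 1" "(a^2) ^ 3 = 1" "(a^2 * b) ^ 3 = 1"
    using assms(2,3) by Groebner_Basis.algebra+
  have "(a^2 * c) * (a^2 * b) = a ^ 3 * (a * (b * c))" by Groebner_Basis.algebra
  moreover have "a * (b * c) = 1" using det by (simp add: det_M3)
  ultimately have c: "(a^2 * c) * (a^2 * b) = 1" by (simp only: assms(2) mult_1)
  have "M3 a 0 0 0 b 0 0 0 c ** mat (a^2) = M3 1 0 0 0 (a^2 * b) 0 0 0 (a^2 * c)"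
    using a(1) by (simp add: mat_M3 mult.commute)
  moreover have "M3 1 0 0 0 (a^2 * b) 0 0 0 (a^2 * c) \<in> L I"
    using cube_eq_1[OF a(3)]
  proof (elim disjE)
    assume b: "a^2 * b = 1"
    then have "a^2 * c = 1" using c by simp
    with b show ?thesis using L_scalar[of 1 I] by (simp add: mat_M3)
  next
    assume b: "a^2 * b = z"
    then have "a^2 * c = z^2" using c by (simp add: inverse_z)
    with b show ?thesis using assms(1) by (simp add: s1_def)
  next
    assume b: "a^2 * b = z^2"
    then have "a^2 * c = z" using c by (simp add: inverse_z)
    moreover have "s1 ** s1 = M3 1 0 0 0 (z^2) 0 0 0 z" by (simp add: s1_def z_simps)
    ultimately show ?thesis using b L_mult[OF assms(1,1)] by simp
  qed
  ultimately show ?thesis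
    using L_cancel[OF L_scalar[OF a(2)] _ det] by simp
qed

lemma Q2_diag:
  assumes "Q2 A" "det A = 1" and A: "A = M3 a 0 0 0 b 0 0 0 c"
  shows "a ^ 3 = 1 \<and> b ^ 3 = 1"
proof -
  have nz: "a \<noteq> 0" "b \<noteq> 0" using assms(2) by (auto simp: A det_M3)
  from assms(1,2) show ?thesis
  proof (cases rule: Q2_cases)
    case (id a' b' c')
    then show ?thesis using A by simp
  next
    case (swap23 a' b' c')
    then show ?thesis using A nz by simp
  next
    case (swap12 a' b' c')
    then show ?thesis using A nz by simp
  next
    case other
    then show ?thesis using A by blast
  qed
qed

lemma in_L_013:
  assumes I: "0 \<notin> I" "1 \<notin> I" "3 \<notin> I" and det: "det A = 1" and Q: "Q2 A" "Q4 A"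
  shows "A \<in> L I"
proof -
  have s: "s1 \<in> L I" "t23 \<in> L I" using I by (simp_all add: L_gen)
  from Q det show ?thesis
  proof (cases rule: Q24_cases)
    case (id a b c)
    then show ?thesis using diag_in_L[OF s(1)] det by blast
  next
    case (swap a b c)
    have "Q2 t23" using L_Q2[OF L_gen(6), of "{2}"] by simp
    then have Q2: "Q2 (A ** t23)" by (rule Q2_mult[OF Q(1)])
    have det': "det (A ** t23) = 1" by (simp add: det_mul det)
    have eq: "A ** t23 = M3 (- a) 0 0 0 (- (c * z)) 0 0 0 (- (b * z^2))"
      by (simp add: swap t23_def)
    have "A ** t23 \<in> L I"
      using Q2_diag[OF Q2 det' eq] diag_in_L[OF s(1)] det' unfolding eq by blast
    then show ?thesis using L_cancel[OF s(2)] det by blast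
  qed
qed

lemma in_L_014:
  assumes I: "0 \<notin> I" "1 \<notin> I" "4 \<notin> I" and det: "det A = 1" and Q: "Q2 A" "Q3 A"
  shows "A \<in> L I"
proof -
  have s: "s1 \<in> L I" "t24 \<in> L I" using I by (simp_all add: L_gen)
  from Q det show ?thesis
  proof (cases rule: Q23_cases)
    case (id a b c)
    then show ?thesis using diag_in_L[OF s(1)] det by blast
  next
    case (swap a b c)
    have "Q2 t24" using L_Q2[OF L_gen(9), of "{2}"] by simp
    then have Q2: "Q2 (A ** t24)" by (rule Q2_mult[OF Q(1)])
    have det': "det (A ** t24) = 1" by (simp add: det_mul det)
    have eq: "A ** t24 = M3 (- (b * z^2)) 0 0 0 (- a) 0 0 0 (- (c * z))"
      by (simp add: swap t24_def)
    have "A ** t24 \<in> L I"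
      using Q2_diag[OF Q2 det' eq] diag_in_L[OF s(1)] det' unfolding eq by blast
    then show ?thesis using L_cancel[OF s(2)] det by blast
  qed
qed

lemma in_L_01:
  assumes I: "0 \<notin> I" "1 \<notin> I" and det: "det A = 1" and Q: "Q2 A" "Q3 A" "Q4 A"
  shows "A \<in> L I"
proof -
  have s: "s1 \<in> L I" using I by (simp add: L_gen)
  from Q(1,3) det show ?thesis
  proof (cases rule: Q24_cases)
    case (id a b c)
    then show ?thesis using diag_in_L[OF s] det by blast
  next
    case (swap a b c)
    from Q(2) det have "c = 0 \<or> a = 0"
      by (cases rule: Q3_cases) (simp_all add: swap)
    then show ?thesis using swap det by (auto simp: det_M3)
  qed
qed

section \<open>Combining the coordinate triangle with the invariants at 0 and 1\<close>

lemma Q_t: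
  "Q1 t12" "Q1 s3" "Q1 s4" "Q1 t13" "Q1 t34" "Q1 t14"
  "Q0 s2" "Q0 s3" "Q0 s4" "Q0 t23" "Q0 t34" "Q0 t24"
  using L_Q1[OF L_gen(5), of "{1}"] L_Q1[OF L_gen(3), of "{1}"] L_Q1[OF L_gen(4), of "{1}"]
    L_Q1[OF L_gen(8), of "{1}"] L_Q1[OF L_gen(7), of "{1}"] L_Q1[OF L_gen(10), of "{1}"]
    L_Q0[OF L_gen(2), of "{0}"] L_Q0[OF L_gen(3), of "{0}"] L_Q0[OF L_gen(4), of "{0}"]
    L_Q0[OF L_gen(6), of "{0}"] L_Q0[OF L_gen(7), of "{0}"] L_Q0[OF L_gen(9), of "{0}"]
  by simp_all

lemma Q1_cases_1:
  assumes "k = 1" "Q1 A" "det A = 1"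
  obtains (diag) a b where "A *v v1 = a *s v1" "A *v v2 = b *s v2" "a ^ 3 = b ^ 3" "a ^ 6 = 1"
    | (swap) a b where "A *v v1 = a *s v2" "A *v v2 = b *s v1" "a ^ 3 = b ^ 3" "a ^ 6 = 1"
proof -
  have m: "monomial_on {v1, v2} 3 2 A" using assms(2) unfolding Q1_def if_P[OF assms(1)] .
  have six: "(a ^ 3) ^ 2 = 1 \<Longrightarrow> a ^ 6 = 1" for a :: 'a by (simp flip: power_mult)
  show ?thesis
    by (rule monomial_on_pairE[OF m assms(3) separated_v zero_less_numeral zero_less_numeral]) (use diag swap six in blast)+
qed

lemma Q0_cases_1:
  assumes "k = 1" "Q0 A"
  obtains a where "A *v v1 = a *s v1" "a ^ 6 = 1"
proof -
  have "monomial_on {v1} 6 1 A" using assms(2) unfolding Q0_def if_P[OF assms(1)] .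
  then show ?thesis by (rule monomial_on_singletonE) (use that in simp)
qed

lemma minus_one_neq_1: "(- 1 :: 'a) \<noteq> 1"
proof
  assume "(- 1 :: 'a) = 1"
  then have "(2 :: 'a) = 1 + - 1" by simp
  then show False using two_nonzero by simp
qed

lemma Q0_cases_m1:
  assumes "k = - 1" "Q0 A"
  obtains t where "t ^ 3 = 1" "transpose A ** N ** A = mat t ** N"
proof -
  have k1: "k \<noteq> 1" using assms(1) minus_one_neq_1 by simp
  have "similitude A" using assms(2) unfolding Q0_def if_not_P[OF k1] .
  then show ?thesis using that unfolding similitude_def by blast
qed

lemma Q1_cases_m1:
  assumes "k = - 1" "Q1 A" "det A = 1"
  obtains u v w a b c where "a ^ 2 = b ^ 2" "a ^ 2 = c ^ 2" "a \<noteq> 0"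
    "A *v f1 = a *s u" "A *v f2 = b *s v" "A *v f3 = c *s w"
    "(u, v, w) \<in> {(f1, f2, f3), (f1, f3, f2), (f2, f1, f3), (f2, f3, f1), (f3, f1, f2), (f3, f2, f1)}"
proof -
  have k1: "k \<noteq> 1" using assms(1) minus_one_neq_1 by simp
  have m: "monomial_on {f1, f2, f3} 2 3 A" using assms(2) unfolding Q1_def if_not_P[OF k1] .
  show ?thesis
  proof (rule monomial_on_tripleE[OF m assms(3) separated_f])
    fix u' v' w' a b c
    assume "a\<^sup>2 = b\<^sup>2" "a\<^sup>2 = c\<^sup>2" "(a\<^sup>2) ^ 3 = 1"
     "A *v f1 = a *s u'" "A *v f2 = b *s v'" "A *v f3 = c *s w'"
     "(u', v', w') \<in> {(f1, f2, f3), (f1, f3, f2), (f2, f1, f3), (f2, f3, f1), (f3, f1, f2), (f3, f2, f1)}"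
    moreover from this have "a \<noteq> 0" using sixth_root_nonzero[of a 2 3] by simp
    ultimately show ?thesis using that by blast
  qed simp_all
qed

text \<open>All coordinates of \<open>v1\<close> and all off-diagonal entries of \<open>N\<close>
  are nonzero, so a diagonal matrix can only preserve them up to a factor by being scalar.\<close>

lemma diag_Q0:
  assumes "Q0 A" "A = M3 a 0 0 0 b 0 0 0 c" "det A = 1"
  shows "b = a \<and> c = a"
proof (cases "k = 1")
  case True
  obtain r where "A *v v1 = r *s v1" using Q0_cases_1[OF True assms(1)] by blast
  then show ?thesis unfolding assms(2) by (simp add: vector_3_eq_iff)
next
  case False
  then obtain t where "transpose A ** N ** A = mat t ** N"
    using Q0_cases_m1[OF _ assms(1)] k by blast
  then have "a * b = t" "a * z^2 * c = t * z^2" "b * z * c = t * z"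
    unfolding assms(2) N_def mat_M3 by simp_all
  then have "a * b = t" "a * c = t" "b * c = t" by simp_all
  moreover have "a \<noteq> 0" "b \<noteq> 0" "c \<noteq> 0" using assms(3) by (auto simp: assms(2) det_M3)
  ultimately show ?thesis by (metis mult.commute mult_cancel_left)
qed

text \<open>For \<open>k = 1\<close> a diagonal matrix exchanging the lines of \<open>v1\<close> and
  \<open>v2\<close> would force \<open>z ^ 3 = z\<close>. For \<open>k = - 1\<close> it keeps the
  zero coordinates of each \<open>f\<close>, so it fixes all three lines.\<close>

lemma diag_Q1:
  assumes "Q1 A" "A = M3 a 0 0 0 b 0 0 0 c" "det A = 1"
  shows "b = a \<and> c = a"
proof (cases "k = 1")
  case True
  from this assms(1,3) show ?thesis
  proof (cases rule: Q1_cases_1)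
    case (diag r s)
    then show ?thesis unfolding assms(2) by (simp add: vector_3_eq_iff)
  next
    case (swap r s)
    from swap(1,2) have e: "a = r" "b * z = r * z^2" "a = s" "b * z^2 = s * z"
      unfolding assms(2) by (simp_all add: vector_3_eq_iff)
    then have "b = r * z" by (simp add: power2_eq_square)
    with e have "r * z^3 = r * z" by (simp add: power2_eq_square power3_eq_cube mult.assoc)
    then have "r = 0" using z_neq_1 by simp
    then show ?thesis using swap(4) by simp
  qed
next
  case False
  then have k': "k = - 1" using k by blast
  obtain u v w p q r where nz: "p \<noteq> 0"
    and im: "A *v f1 = p *s u" "A *v f2 = q *s v" "A *v f3 = r *s w"
    and perm: "(u, v, w) \<in> {(f1, f2, f3), (f1, f3, f2), (f2, f1, f3), (f2, f3, f1), (f3, f1, f2), (f3, f2, f1)}"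
    using Q1_cases_m1[OF k' assms(1,3)] by metis
  have nz': "a \<noteq> 0" "b \<noteq> 0" "c \<noteq> 0" using assms(3) by (auto simp: assms(2) det_M3)
  have im': "vector [a, b, 0] = p *s u" "vector [a, 0, c] = q *s v" "vector [0, b, c] = r *s w"
    using im unfolding assms(2) by simp_all
  from perm show ?thesis
    by (elim insertE emptyE Pair_inject) (use im' nz nz' in \<open>simp_all add: vector_3_eq_iff\<close>)
qed

lemma scalar_M3_in_L: "det (M3 a 0 0 0 b 0 0 0 c) = 1 \<Longrightarrow> b = a \<and> c = a \<Longrightarrow> M3 a 0 0 0 b 0 0 0 c \<in> L I"
  using scalar_in_L[of a I] by (simp add: mat_M3)

lemma in_L_03':
  assumes t: "t13 \<in> L I" and det: "det A = 1" and Q: "Q1 A" "Q2 A" "Q4 A"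
  shows "A \<in> L I"
  using Q(2,3) det
proof (cases rule: Q24_cases)
  case (id a b c)
  then show ?thesis using diag_Q1[OF Q(1)] det scalar_M3_in_L by blast
next
  case (swap a b c)
  have det': "det (A ** t13) = 1" by (simp add: det_mul det)
  have eq: "A ** t13 = M3 (- a) 0 0 0 (- c) 0 0 0 (- b)" by (simp add: swap t13_def)
  have "A ** t13 \<in> L I"
    using diag_Q1[OF Q1_mult[OF Q(1) Q_t(4)] eq det'] det' scalar_M3_in_L unfolding eq by blast
  then show ?thesis using L_cancel[OF t] det by blast
qed

lemma in_L_13':
  assumes t: "t23 \<in> L I" and det: "det A = 1" and Q: "Q0 A" "Q2 A" "Q4 A"
  shows "A \<in> L I"
  using Q(2,3) det
proof (cases rule: Q24_cases)
  case (id a b c)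
  then show ?thesis using diag_Q0[OF Q(1)] det scalar_M3_in_L by blast
next
  case (swap a b c)
  have det': "det (A ** t23) = 1" by (simp add: det_mul det)
  have eq: "A ** t23 = M3 (- a) 0 0 0 (- (c * z)) 0 0 0 (- (b * z^2))" by (simp add: swap t23_def)
  have "A ** t23 \<in> L I"
    using diag_Q0[OF Q0_mult[OF Q(1) Q_t(10)] eq det'] det' scalar_M3_in_L unfolding eq by blast
  then show ?thesis using L_cancel[OF t] det by blast
qed

lemma in_L_04:
  assumes I: "0 \<notin> I" "4 \<notin> I" and det: "det A = 1" and Q: "Q1 A" "Q2 A" "Q3 A"
  shows "A \<in> L I"
  using Q(2,3) det
proof (cases rule: Q23_cases)
  case (id a b c)
  then show ?thesis using diag_Q1[OF Q(1)] det scalar_M3_in_L by blast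
next
  case (swap a b c)
  have det': "det (A ** t14) = 1" by (simp add: det_mul det)
  have eq: "A ** t14 = M3 (- b) 0 0 0 (- a) 0 0 0 (- c)" by (simp add: swap t14_def)
  have "A ** t14 \<in> L I"
    using diag_Q1[OF Q1_mult[OF Q(1) Q_t(6)] eq det'] det' scalar_M3_in_L unfolding eq by blast
  then show ?thesis using L_cancel[OF L_gen(10)] I det by blast
qed

lemma in_L_14:
  assumes I: "1 \<notin> I" "4 \<notin> I" and det: "det A = 1" and Q: "Q0 A" "Q2 A" "Q3 A"
  shows "A \<in> L I"
  using Q(2,3) det
proof (cases rule: Q23_cases)
  case (id a b c)
  then show ?thesis using diag_Q0[OF Q(1)] det scalar_M3_in_L by blast
next
  case (swap a b c)
  have det': "det (A ** t24) = 1" by (simp add: det_mul det)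
  have eq: "A ** t24 = M3 (- (b * z^2)) 0 0 0 (- a) 0 0 0 (- (c * z))" by (simp add: swap t24_def)
  have "A ** t24 \<in> L I"
    using diag_Q0[OF Q0_mult[OF Q(1) Q_t(12)] eq det'] det' scalar_M3_in_L unfolding eq by blast
  then show ?thesis using L_cancel[OF L_gen(9)] I det by blast
qed

lemma in_L_0:
  assumes "det A = 1" "Q1 A" "Q2 A" "Q3 A" "Q4 A"
  shows "A \<in> L I"
  using assms(3,5,1)
proof (cases rule: Q24_cases)
  case (id a b c)
  then show ?thesis using diag_Q1[OF assms(2)] assms(1) scalar_M3_in_L by blast
next
  case (swap a b c)
  from assms(4,1) show ?thesis
    by (cases rule: Q3_cases) (use swap assms(1) in \<open>auto simp: det_M3\<close>)
qed

lemma in_L_1: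
  assumes "det A = 1" "Q0 A" "Q2 A" "Q3 A" "Q4 A"
  shows "A \<in> L I"
  using assms(3,5,1)
proof (cases rule: Q24_cases)
  case (id a b c)
  then show ?thesis using diag_Q0[OF assms(2)] assms(1) scalar_M3_in_L by blast
next
  case (swap a b c)
  from assms(4,1) show ?thesis
    by (cases rule: Q3_cases) (use swap assms(1) in \<open>auto simp: det_M3\<close>)
qed

text \<open>With \<open>Q0\<close> and \<open>Q1\<close> together no swap of \<open>e2\<close> and
  \<open>e3\<close> is left: correcting it by \<open>t13\<close> gives \<open>c = a\<close>,
  correcting it by \<open>t23\<close> gives \<open>c * z = a\<close>, against
  \<open>z \<noteq> 1\<close>. The case of \<open>in_L_4\<close> is analogous, with
  \<open>t14\<close> and \<open>t24\<close>.\<close>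

lemma in_L_3:
  assumes "det A = 1" "Q0 A" "Q1 A" "Q2 A" "Q4 A"
  shows "A \<in> L I"
  using assms(4,5,1)
proof (cases rule: Q24_cases)
  case (id a b c)
  then show ?thesis using diag_Q0[OF assms(2)] assms(1) scalar_M3_in_L by blast
next
  case (swap a b c)
  have det: "det (A ** t13) = 1" "det (A ** t23) = 1" by (simp_all add: det_mul assms(1))
  have "A ** t13 = M3 (- a) 0 0 0 (- c) 0 0 0 (- b)" by (simp add: swap t13_def)
  from diag_Q1[OF Q1_mult[OF assms(3) Q_t(4)] this det(1)] have "c = a" by simp
  have "A ** t23 = M3 (- a) 0 0 0 (- (c * z)) 0 0 0 (- (b * z^2))" by (simp add: swap t23_def)
  from diag_Q0[OF Q0_mult[OF assms(2) Q_t(10)] this det(2)] have "a * z = a" using \<open>c = a\<close> by simp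
  then have "a = 0" using z_neq_1 by simp
  then show ?thesis using assms(1) by (simp add: swap det_M3)
qed

lemma in_L_4:
  assumes "det A = 1" "Q0 A" "Q1 A" "Q2 A" "Q3 A"
  shows "A \<in> L I"
  using assms(4,5,1)
proof (cases rule: Q23_cases)
  case (id a b c)
  then show ?thesis using diag_Q0[OF assms(2)] assms(1) scalar_M3_in_L by blast
next
  case (swap a b c)
  have det: "det (A ** t14) = 1" "det (A ** t24) = 1" by (simp_all add: det_mul assms(1))
  have "A ** t14 = M3 (- b) 0 0 0 (- a) 0 0 0 (- c)" by (simp add: swap t14_def)
  from diag_Q1[OF Q1_mult[OF assms(3) Q_t(6)] this det(1)] have bac: "a = b" "c = b" by simp_all
  have "A ** t24 = M3 (- (b * z^2)) 0 0 0 (- a) 0 0 0 (- (c * z))" by (simp add: swap t24_def)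
  from diag_Q0[OF Q0_mult[OF assms(2) Q_t(12)] this det(2)] have "a = c * z" by simp
  then have "b * z = b" using bac by simp
  then have "b = 0" using z_neq_1 by simp
  then show ?thesis using assms(1) by (simp add: swap det_M3)
qed

lemma Q01_rotate: "B \<in> {A, A ** s4, A ** (s4 ** s4)} \<Longrightarrow> Q0 A \<Longrightarrow> Q0 B"
  "B \<in> {A, A ** s4, A ** (s4 ** s4)} \<Longrightarrow> Q1 A \<Longrightarrow> Q1 B"
  using Q0_mult[of A s4] Q0_mult[of A "s4 ** s4"] Q0_mult[of s4 s4]
    Q1_mult[of A s4] Q1_mult[of A "s4 ** s4"] Q1_mult[of s4 s4] Q_t by auto

lemma in_L_03: "0 \<notin> I \<Longrightarrow> 3 \<notin> I \<Longrightarrow> det A = 1 \<Longrightarrow> Q1 A \<Longrightarrow> Q2 A \<Longrightarrow> Q4 A \<Longrightarrow> A \<in> L I"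
  using in_L_03' L_gen(8) by blast

lemma in_L_13: "1 \<notin> I \<Longrightarrow> 3 \<notin> I \<Longrightarrow> det A = 1 \<Longrightarrow> Q0 A \<Longrightarrow> Q2 A \<Longrightarrow> Q4 A \<Longrightarrow> A \<in> L I"
  using in_L_13' L_gen(6) by blast

text \<open>The rotation by \<open>s4\<close> gains \<open>Q4\<close>, which reduces the claim to
  the vertices 0 and 3.\<close>

lemma in_L_034:
  assumes I: "0 \<notin> I" "3 \<notin> I" "4 \<notin> I" and det: "det A = 1" and Q: "Q1 A" "Q2 A"
  shows "A \<in> L I"
proof -
  obtain B where B: "B \<in> {A, A ** s4, A ** (s4 ** s4)}" "Q2 B" "Q4 B" "det B = 1"
    using Q2_rotate[OF Q(2) det] by blast
  then have "B \<in> L I" using in_L_03 I Q01_rotate(2)[OF B(1) Q(1)] by blast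
  then show ?thesis using rotate_back[OF B(1)] L_gen(4) I det by blast
qed

lemma in_L_134:
  assumes I: "1 \<notin> I" "3 \<notin> I" "4 \<notin> I" and det: "det A = 1" and Q: "Q0 A" "Q2 A"
  shows "A \<in> L I"
proof -
  obtain B where B: "B \<in> {A, A ** s4, A ** (s4 ** s4)}" "Q2 B" "Q4 B" "det B = 1"
    using Q2_rotate[OF Q(2) det] by blast
  then have "B \<in> L I" using in_L_13 I Q01_rotate(1)[OF B(1) Q(1)] by blast
  then show ?thesis using rotate_back[OF B(1)] L_gen(4) I det by blast
qed

lemma in_L_34:
  assumes I: "3 \<notin> I" "4 \<notin> I" and det: "det A = 1" and Q: "Q0 A" "Q1 A" "Q2 A"
  shows "A \<in> L I"
proof -
  obtain B where B: "B \<in> {A, A ** s4, A ** (s4 ** s4)}" "Q2 B" "Q4 B" "det B = 1"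
    using Q2_rotate[OF Q(3) det] by blast
  then have "B \<in> L I" using in_L_3 Q01_rotate(1)[OF B(1) Q(1)] Q01_rotate(2)[OF B(1) Q(2)] by blast
  then show ?thesis using rotate_back[OF B(1)] L_gen(4) I det by blast
qed

section \<open>Combining the pair \<open>e1\<close>, \<open>e2\<close> with the invariants at 0 and
  1\<close>

lemma Q3_align:
  assumes "Q3 A" "det A = 1"
  obtains B where "B \<in> {A, A ** t34}" "Q3 B" "Q4 B" "det B = 1"
proof -
  have m: "monomial_on {e1, e2} 3 2 A" using assms(1) unfolding Q3_def .
  have Q3t: "Q3 t34" using L_Q3[OF L_gen(7), of "{3}"] by simp
  have sq: "(x ^ 6) ^ 1 = (x ^ 3)^2" for x :: 'a by (simp flip: power_mult)
  show ?thesis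
  proof (rule monomial_on_pairE[OF m assms(2) separated_e(1) zero_less_numeral zero_less_numeral])
    fix a b
    assume "(a ^ 3)\<^sup>2 = 1" "A *v e1 = a *s e1"
    then have "Q4 A" unfolding Q4_def by (intro monomial_on_singletonI[of _ _ a]) (simp_all only: sq)
    then show ?thesis using that[of A] assms by simp
  next
    fix a b
    assume ab: "a ^ 3 = b ^ 3" "(a ^ 3)\<^sup>2 = 1" "A *v e2 = b *s e1"
    \<comment> \<open>Since \<open>t34\<close> interchanges the lines of \<open>e1\<close> and
      \<open>e2\<close>, it undoes the swap, just as powers of \<open>s4\<close> do for the
      triangle.\<close>
    have "t34 *v e1 = 1 *s e2" by (simp add: t34_def)
    from image_mult[OF this ab(3)] have "(A ** t34) *v e1 = b *s e1" by simp
    then have "Q4 (A ** t34)"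
      unfolding Q4_def using ab(2)[unfolded ab(1)]
      by (intro monomial_on_singletonI[of _ _ b]) (simp_all only: sq)
    moreover have "Q3 (A ** t34)"
      using assms(1) Q3t unfolding Q3_def by (rule monomial_on_mult)
    moreover have "det (A ** t34) = 1" by (simp add: det_mul assms(2))
    ultimately show ?thesis using that[of "A ** t34"] by simp
  qed
qed

lemma align_back:
  assumes "B \<in> {A, A ** g}" "g \<in> L I" "B \<in> L I" "det A = 1"
  shows "A \<in> L I"
  using assms L_cancel[OF assms(2), of A] by auto

lemma align_Q:
  "B \<in> {A, A ** t34} \<Longrightarrow> Q0 A \<Longrightarrow> Q0 B" "B \<in> {A, A ** t34} \<Longrightarrow> Q1 A \<Longrightarrow> Q1 B"
  using Q0_mult[OF _ Q_t(11), of A] Q1_mult[OF _ Q_t(5), of A] by auto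

lemma in_L_12:
  assumes I: "1 \<notin> I" "2 \<notin> I" and det: "det A = 1" and Q: "Q0 A" "Q3 A" "Q4 A"
  shows "A \<in> L I"
proof -
  have s: "s2 \<in> L I" using I by (simp add: L_gen)
  obtain a b c x y where A: "A = M3 a 0 x 0 b y 0 0 c" "a ^ 3 = b ^ 3" "a ^ 6 = 1"
    by (rule Q34_cases[OF Q(2,3) det])
  show ?thesis
  proof (rule eigen_descent[where P = Q0 and u = e1 and w = e2, OF s _ _ _ _ _ det _ _ Q(1) A(2,3)])
    fix B :: "'a^3^3"
    assume B: "det B = 1" "B *v e1 = e1" "B *v e2 = e2" "Q0 B"
    obtain a b c d e f g h j where M: "B = M3 a b c d e f g h j" by (rule M3_cases)
    have "B = M3 1 0 c 0 1 f 0 0 j" using B(2,3) M by (simp add: vector_3_eq_iff)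
    moreover from this have "j = 1" using B(1) by (simp add: det_M3)
    ultimately have B': "B = M3 1 0 c 0 1 f 0 0 1" by simp
    \<comment> \<open>What the descent leaves is trivial: a matrix of this shape other than the
      identity moves the line of \<open>v1\<close>, and it does not scale the form
      \<open>N\<close>.\<close>
    have "c = 0 \<and> f = 0"
    proof (cases "k = 1")
      case True
      obtain r where "B *v v1 = r *s v1" using Q0_cases_1[OF True B(4)] by blast
      then have "1 + c * z^2 = r" "z + f * z^2 = r * z" "z^2 = r * z^2"
        unfolding B' by (simp_all add: vector_3_eq_iff)
      then have "r = 1" "1 + c * z^2 = r" "z + f * z^2 = r * z" by simp_all
      then show ?thesis by simp
    next
      case False
      then obtain t where "transpose B ** N ** B = mat t ** N"
        using Q0_cases_m1[OF _ B(4)] k by blast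
      then have "t = 1" "f + z^2 = t * z^2" "c + z = t * z"
        unfolding B' N_def mat_M3 by simp_all
      then show ?thesis by simp
    qed
    then show "B \<in> L I" using B' L_scalar[of 1 I] by (simp add: mat_M3)
  qed (simp_all add: A(1) s2_def[symmetric] Q0_mult Q_t Q0_scalar, simp_all add: s2_def)
qed

lemma in_L_124:
  assumes I: "1 \<notin> I" "2 \<notin> I" "4 \<notin> I" and det: "det A = 1" and Q: "Q0 A" "Q3 A"
  shows "A \<in> L I"
proof -
  obtain B where B: "B \<in> {A, A ** t34}" "Q3 B" "Q4 B" "det B = 1" using Q3_align[OF Q(2) det] by blast
  have "B \<in> L I" by (rule in_L_12[OF I(1,2) B(4) align_Q(1)[OF B(1) Q(1)] B(2,3)])
  then show ?thesis using align_back[OF B(1) L_gen(7)] I det by blast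
qed

text \<open>Serves the vertices 2 and 02, and after alignment 24 and 024: the coset of
  \<open>t12\<close> lies in the group if 0 and 2 are kept, and \<open>Q0\<close> excludes it
  otherwise.\<close>

lemma Q134_form:
  assumes det: "det A = 1" and Q: "Q1 A" "Q3 A" "Q4 A"
  shows "\<exists>d. A = mat d \<or> A = mat d ** t12"
proof -
  obtain a b c x y where A: "A = M3 a 0 x 0 b y 0 0 c"
    by (rule Q34_cases[OF Q(2,3) det])
  have nz: "a \<noteq> 0" "b \<noteq> 0" "c \<noteq> 0" using det by (auto simp: A det_M3)
  have "b = a \<and> x = 0 \<and> y = 0 \<and> c = a \<or> a = - c \<and> b = - c \<and> x = - k * c \<and> y = - k * c"
  proof (cases "k = 1")
    case True
    from this Q(1) det show ?thesis
    proof (cases rule: Q1_cases_1)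
      case (diag r s)
      from diag(1,2) have e: "a + x * z^2 = r" "b * z + y * z^2 = r * z" "c * z^2 = r * z^2"
        "a + x * z = s" "b * z^2 + y * z = s * z^2" "c * z = s * z"
        unfolding A by (simp_all add: vector_3_eq_iff)
      then have rs: "r = c" "s = c" by simp_all
      \<comment> \<open>Subtracting the equation for \<open>v1\<close> from that for
        \<open>v2\<close> isolates one unknown times \<open>z - z^2\<close>, which is nonzero. The
        later entries are found in the same manner.\<close>
      have "x * (z - z^2) = (a + x * z) - (a + x * z^2)" by (simp add: algebra_simps)
      then have "x * (z - z^2) = 0" unfolding e(1,4) rs by simp
      then have x: "x = 0" using z_diff_nonzero by simp
      have "y * (1 - z) = z * (b * z + y * z^2) - (b * z^2 + y * z)" by (simp add: z_simps)
      then have "y * (1 - z) = 0" unfolding e(2,5) rs by (simp add: power2_eq_square algebra_simps)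
      then have y: "y = 0" using z_neq_1 by simp
      show ?thesis using e(1,2) unfolding rs x y by simp
    next
      case (swap r s)
      from swap(1,2) have e: "a + x * z^2 = r" "b * z + y * z^2 = r * z^2" "c * z^2 = r * z"
        "a + x * z = s" "b * z^2 + y * z = s * z" "c * z = s * z^2"
        unfolding A by (simp_all add: vector_3_eq_iff)
      have "r = (r * z) * z^2" by (simp add: z_simps)
      also have "\<dots> = c * z" unfolding e(3)[symmetric] by (simp add: z_simps)
      finally have r: "r = c * z" .
      have "s = (s * z^2) * z" by (simp add: z_simps)
      also have "\<dots> = c * z^2" unfolding e(6)[symmetric] by (simp add: z_simps)
      finally have s: "s = c * z^2" .
      have "(x + c) * (z - z^2) = (a + x * z) - (a + x * z^2) + c * z - c * z^2"
        by (simp add: algebra_simps)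
      then have "(x + c) * (z - z^2) = 0" unfolding e(1,4) r s by simp
      then have x: "x = - c" using z_diff_nonzero by (simp add: eq_neg_iff_add_eq_0)
      have "(b - y) * (z - z^2) = (b * z + y * z^2) - (b * z^2 + y * z)" by (simp add: algebra_simps)
      then have "(b - y) * (z - z^2) = 0" unfolding e(2,5) r s by (simp add: power2_eq_square)
      then have y: "y = b" using z_diff_nonzero by simp
      have "b = - (b * z + b * z^2)" by (simp add: z_simps)
      also have "\<dots> = - c" unfolding e(2)[unfolded y] r by (simp add: z_simps)
      finally have "b = - c" .
      moreover have a: "a = r - x * z^2" using e(1) by (simp add: eq_diff_eq)
      have "a = - c" unfolding a r x by (simp add: z_simps)
      ultimately show ?thesis using x y True by simp
    qed
  next
    case False
    then have k': "k = - 1" using k by blast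
    obtain u v w p q r where
      im: "A *v f1 = p *s u" "A *v f2 = q *s v" "A *v f3 = r *s w"
      and perm: "(u, v, w) \<in> {(f1, f2, f3), (f1, f3, f2), (f2, f1, f3), (f2, f3, f1), (f3, f1, f2), (f3, f2, f1)}"
      using Q1_cases_m1[OF k' Q(1) det] by metis
    have im': "vector [a, b, 0] = p *s u" "vector [a + x, y, c] = q *s v" "vector [x, b + y, c] = r *s w"
      using im unfolding A by simp_all
    from perm consider "u = f2" | "u = f3" | "u = f1" "v = f2" "w = f3" | "u = f1" "v = f3" "w = f2"
      by blast
    then show ?thesis
    proof cases
      case 3
      then have "x = 0" "y = 0" "b = a" "a + x = c" using im' by (simp_all add: vector_3_eq_iff)
      then show ?thesis by simp
    next
      case 4
      then have e: "x = c" "y = c" "b = a" "a + x = 0" using im' by (simp_all add: vector_3_eq_iff)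
      then have "a = - c" by (simp add: eq_neg_iff_add_eq_0)
      then show ?thesis using e k' by simp
    qed (use im' nz in \<open>simp_all add: vector_3_eq_iff\<close>)
  qed
  then show ?thesis
  proof
    assume "b = a \<and> x = 0 \<and> y = 0 \<and> c = a"
    then have "A = mat a" by (simp add: A mat_M3)
    then show ?thesis by blast
  next
    assume "a = - c \<and> b = - c \<and> x = - k * c \<and> y = - k * c"
    then have "A = mat c ** t12" by (simp add: A mat_M3 t12_def)
    then show ?thesis by blast
  qed
qed

text \<open>For \<open>k = 1\<close> the matrix \<open>t12\<close> maps \<open>v1\<close> to the
  line of \<open>v2\<close>; for \<open>k = - 1\<close> the entries of the similitude equation give
  incompatible factors.\<close>

lemma not_Q0_t12:
  assumes "Q0 (mat d ** t12)"
  shows "d = 0"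
proof (cases "k = 1")
  case True
  obtain r where "(mat d ** t12) *v v1 = r *s v1" using Q0_cases_1[OF True assms] by blast
  moreover have "(mat d ** t12) *v v1 = vector [d * z, d, d * z^2]"
    unfolding t12_def mat_M3 using True by (simp add: vector_3_eq_iff z_simps)
  ultimately have "d * z = r * 1" "d * z^2 = r * z^2"
    unfolding smult_vector_3 by (metis vector_3_eq_iff)+
  then have "d * (z - 1) = 0" by (simp add: algebra_simps)
  then show ?thesis using z_neq_1 by simp
next
  case False
  then have k': "k = - 1" using k by blast
  obtain t where "transpose (mat d ** t12) ** N ** (mat d ** t12) = mat t ** N"
    using Q0_cases_m1[OF k' assms] by blast
  then have t: "d * d = t" and e: "- t = t * z^2 + d * (d * z^2)"
    unfolding t12_def mat_M3 N_def using k' by (auto simp: algebra_simps)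
  have "d * d * (z - z^2) = - (d * d) - (d * d * z^2 + d * (d * z^2))"
    by (simp add: z_simps)
  then have "d * d * (z - z^2) = 0" using e unfolding t[symmetric] by simp
  then show ?thesis using z_diff_nonzero by simp
qed

lemma scalar_or_t12_in_L:
  assumes "det A = 1" "A = mat d \<or> A = mat d ** t12" "Q0 A \<or> t12 \<in> L I"
  shows "A \<in> L I"
proof -
  have d: "det (mat d :: 'a^3^3) = 1" using assms(1,2) by (auto simp: det_mul)
  then have "d \<noteq> 0" by (auto simp: det_mat_3)
  then have "A = mat d \<or> A = mat d ** t12 \<and> t12 \<in> L I"
    using assms(2,3) not_Q0_t12 by blast
  then show ?thesis using scalar_in_L[OF d, of I] L_mult by blast
qed

lemma in_L_2: "det A = 1 \<Longrightarrow> Q0 A \<Longrightarrow> Q1 A \<Longrightarrow> Q3 A \<Longrightarrow> Q4 A \<Longrightarrow> A \<in> L I"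
  using Q134_form scalar_or_t12_in_L by blast

lemma in_L_02: "0 \<notin> I \<Longrightarrow> 2 \<notin> I \<Longrightarrow> det A = 1 \<Longrightarrow> Q1 A \<Longrightarrow> Q3 A \<Longrightarrow> Q4 A \<Longrightarrow> A \<in> L I"
  using Q134_form scalar_or_t12_in_L L_gen(5) by blast

lemma in_L_24:
  assumes I: "2 \<notin> I" "4 \<notin> I" and det: "det A = 1" and Q: "Q0 A" "Q1 A" "Q3 A"
  shows "A \<in> L I"
proof -
  obtain B where B: "B \<in> {A, A ** t34}" "Q3 B" "Q4 B" "det B = 1" using Q3_align[OF Q(3) det] by blast
  have "B \<in> L I" by (rule in_L_2[OF B(4) align_Q(1)[OF B(1) Q(1)] align_Q(2)[OF B(1) Q(2)] B(2,3)])
  then show ?thesis using align_back[OF B(1) L_gen(7)] I det by blast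
qed

lemma in_L_024:
  assumes I: "0 \<notin> I" "2 \<notin> I" "4 \<notin> I" and det: "det A = 1" and Q: "Q1 A" "Q3 A"
  shows "A \<in> L I"
proof -
  obtain B where B: "B \<in> {A, A ** t34}" "Q3 B" "Q4 B" "det B = 1" using Q3_align[OF Q(2) det] by blast
  have "B \<in> L I" by (rule in_L_02[OF I(1,2) B(4) align_Q(2)[OF B(1) Q(1)] B(2,3)])
  then show ?thesis using align_back[OF B(1) L_gen(7)] I det by blast
qed

section \<open>The vertices 023, 23 and 234\<close>

lemma s3_eigen_1:
  assumes "k = 1"
  shows "(s3 ** mat z) *v v1 = (- 1) *s v1" "(s3 ** mat z) *v v2 = (- (z^2)) *s v2"
  unfolding s3_def mat_M3 using assms by (simp_all add: vector_3_eq_iff z_simps)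

text \<open>The vectors \<open>v1\<close>, \<open>v2\<close>, \<open>e1\<close> form a basis, so
  after the descent the determinant makes the eigenvalue on \<open>e1\<close> equal to 1 as well.
  The scalar \<open>z\<close> turns the eigenvalues of \<open>s3\<close> into the pair that
  \<open>eigen_descent\<close> expects.\<close>

lemma diag_e1_in_L:
  assumes k1: "k = 1" and s3: "s3 \<in> L I" and det: "det A = 1" and Q4: "Q4 A"
    and A: "A *v v1 = a *s v1" "A *v v2 = b *s v2" "a ^ 3 = b ^ 3" "a ^ 6 = 1"
  shows "A \<in> L I"
proof (rule eigen_descent[where P = "\<lambda>A. \<exists>c. A *v e1 = c *s e1", OF _ s3_eigen_1[OF k1] _ _ _ det A(1,2) _ A(3,4)])
  show "s3 ** mat z \<in> L I" using s3 by (intro L_mult L_scalar) simp_all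
  show "\<exists>c. A *v e1 = c *s e1" using Q4 unfolding Q4_def by (rule monomial_on_singletonE) blast
  have "(s3 ** mat z) *v e1 = z *s e1" unfolding s3_def mat_M3 by simp
  then show "\<exists>c. (B ** (s3 ** mat z)) *v e1 = c *s e1" if "\<exists>c. B *v e1 = c *s e1" for B
    using that eigen_mult by blast
  show "\<exists>c. (B ** mat z) *v e1 = c *s e1" if "\<exists>c. B *v e1 = c *s e1" for B
    using that eigen_mult mat_mult_vector by blast
  fix B :: "'a^3^3"
  assume B: "det B = 1" "B *v v1 = v1" "B *v v2 = v2" "\<exists>c. B *v e1 = c *s e1"
  then obtain q where q: "B *v e1 = q *s e1" by blast
  obtain a b c d e f g h j where M: "B = M3 a b c d e f g h j" by (rule M3_cases)
  have M': "B = M3 q b c 0 e f 0 h j" using q M by (simp add: vector_3_eq_iff)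
  have "vector [q + b * z + c * z^2, e * z + f * z^2, h * z + j * z^2] = v1"
    "vector [q + b * z^2 + c * z, e * z^2 + f * z, h * z^2 + j * z] = v2"
    using B(2,3) unfolding M' by simp_all
  then have e: "q + b * z + c * z^2 = 1" "e * z + f * z^2 = z" "h * z + j * z^2 = z^2"
    "q + b * z^2 + c * z = 1" "e * z^2 + f * z = z^2" "h * z^2 + j * z = z"
    unfolding vector_3_eq_iff by blast+
  have "(b - c) * (z - z^2) = (q + b * z + c * z^2) - (q + b * z^2 + c * z)" by (simp add: algebra_simps)
  then have "(b - c) * (z - z^2) = 0" unfolding e by simp
  then have c: "c = b" using z_diff_nonzero by simp
  have "f * (1 - z) = z * (e * z + f * z^2) - (e * z^2 + f * z)" by (simp add: z_simps)
  then have "f * (1 - z) = 0" unfolding e by (simp add: power2_eq_square)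
  then have f: "f = 0" using z_neq_1 by simp
  have "(j - 1) * (1 - z) = z * (h * z + j * z^2) - (h * z^2 + j * z) - (1 - z)" by (simp add: z_simps)
  then have "(j - 1) * (1 - z) = 0" unfolding e by (simp add: z_simps)
  then have j: "j = 1" using z_neq_1 by simp
  have eh: "e = 1" "h = 0" using e(2,3) unfolding f j by simp_all
  have q1: "q = 1" using B(1) unfolding M' f j eh by (simp add: det_M3)
  have "b = - (b * z + b * z^2)" by (simp add: z_simps)
  also have "b * z + b * z^2 = 0" using e(1) unfolding c q1 by simp
  finally have "b = 0" by simp
  then have "B = mat 1" unfolding M' c f j eh q1 mat_M3 by simp
  then show "B \<in> L I" using L_scalar[of 1 I] by simp
qed

lemma Q4_t12: "Q4 t12"
  using L_Q4[OF L_gen(5), of "{4}"] by simp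

lemma Q4_mult: "Q4 A \<Longrightarrow> Q4 B \<Longrightarrow> Q4 (A ** B)"
  unfolding Q4_def by (rule monomial_on_mult)

text \<open>Covers 023 and 23 at once: an exchange of \<open>v1\<close> and \<open>v2\<close> is
  undone by \<open>t12\<close> if that lies in the group, and contradicts \<open>Q0\<close>
  otherwise.\<close>

lemma in_L_023_1:
  assumes k1: "k = 1" and s: "s3 \<in> L I" "Q0 A \<or> t12 \<in> L I" and det: "det A = 1" and Q: "Q1 A" "Q4 A"
  shows "A \<in> L I"
  using k1 Q(1) det
proof (cases rule: Q1_cases_1)
  case (diag a b)
  then show ?thesis by (rule diag_e1_in_L[OF k1 s(1) det Q(2)])
next
  case (swap a b)
  have "\<not> Q0 A"
  proof
    assume "Q0 A"
    then obtain r where "A *v v1 = r *s v1" using Q0_cases_1[OF k1] by blast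
    then have "r *s v1 = a *s v2" using swap by simp
    then have "a = 0" using separated_v unfolding separated_def by blast
    then show False using swap(4) by simp
  qed
  then have t: "t12 \<in> L I" using s(2) by blast
  have "t12 *v v1 = z *s v2" "t12 *v v2 = z^2 *s v1"
    unfolding t12_def using k1 by (simp_all add: vector_3_eq_iff z_simps)
  note im = image_mult[OF this(1) swap(2)] image_mult[OF this(2) swap(1)]
  have cubes: "(b * z) ^ 3 = (a * z^2) ^ 3" "(b * z) ^ 6 = 1"
  proof -
    show "(b * z) ^ 3 = (a * z^2) ^ 3"
      using swap(3) by (simp only: power_mult_distrib z_cube z_square_cube)
    have "b ^ 6 = (b ^ 3)^2" "a ^ 6 = (a ^ 3)^2" by (simp_all flip: power_mult)
    then have "b ^ 6 = 1" using swap(3,4) by simp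
    then show "(b * z) ^ 6 = 1" by (simp add: power_mult_distrib z_sixth)
  qed
  have "A ** t12 \<in> L I"
    by (rule diag_e1_in_L[OF k1 s(1) _ Q4_mult[OF Q(2) Q4_t12] im cubes]) (simp add: det_mul det)
  then show ?thesis using L_cancel[OF t] det by blast
qed

text \<open>The analogue of \<open>Q2_rotate\<close> for the triangle of the \<open>f\<close>s. The
  disjunction admits both directions, because \<open>s3\<close> and \<open>s4\<close> turn this
  triangle in opposite ways.\<close>

lemma f_rotate:
  assumes k': "k = - 1" and A: "Q1 A" "det A = 1" and g: "Q1 g" "det g = 1"
    and im: "g *v f1 = x *s f3 \<and> (g ** g) *v f1 = y *s f2 \<or> g *v f1 = x *s f2 \<and> (g ** g) *v f1 = y *s f3"
  obtains B b where "B \<in> {A, A ** g, A ** (g ** g)}" "Q1 B" "det B = 1" "B *v f1 = b *s f1"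
proof -
  obtain u v w p q r where
    Af: "A *v f1 = p *s u" "A *v f2 = q *s v" "A *v f3 = r *s w"
    and perm: "(u, v, w) \<in> {(f1, f2, f3), (f1, f3, f2), (f2, f1, f3), (f2, f3, f1), (f3, f1, f2), (f3, f2, f1)}"
    using Q1_cases_m1[OF k' A] by metis
  have B: "Q1 (A ** g)" "Q1 (A ** (g ** g))" "det (A ** g) = 1" "det (A ** (g ** g)) = 1"
    using A g by (simp_all add: Q1_mult det_mul)
  from perm consider "u = f1" | "v = f1" | "w = f1" by blast
  then show ?thesis
  proof cases
    case 1
    then show ?thesis using that[of A p] A Af by simp
  next
    case 2
    then have v: "A *v f2 = q *s f1" using Af by simp
    from im show ?thesis
    proof
      assume "g *v f1 = x *s f3 \<and> (g ** g) *v f1 = y *s f2"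
      then show ?thesis using that[OF _ B(2,4) image_mult[OF _ v]] by blast
    next
      assume "g *v f1 = x *s f2 \<and> (g ** g) *v f1 = y *s f3"
      then show ?thesis using that[OF _ B(1,3) image_mult[OF _ v]] by blast
    qed
  next
    case 3
    then have w: "A *v f3 = r *s f1" using Af by simp
    from im show ?thesis
    proof
      assume "g *v f1 = x *s f3 \<and> (g ** g) *v f1 = y *s f2"
      then show ?thesis using that[OF _ B(1,3) image_mult[OF _ w]] by blast
    next
      assume "g *v f1 = x *s f2 \<and> (g ** g) *v f1 = y *s f3"
      then show ?thesis using that[OF _ B(2,4) image_mult[OF _ w]] by blast
    qed
  qed
qed

lemma f1_fixed_cases:
  assumes k': "k = - 1" and A: "Q1 A" "det A = 1" "A *v f1 = p *s f1"
  obtains (diag) q r where "p^2 = q^2" "p^2 = r^2" "p \<noteq> 0" "A *v f2 = q *s f2" "A *v f3 = r *s f3"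
    | (swap) q r where "p^2 = q^2" "p^2 = r^2" "p \<noteq> 0" "A *v f2 = q *s f3" "A *v f3 = r *s f2"
proof -
  obtain u v w p' q r where sq: "p'^2 = q^2" "p'^2 = r^2" "p' \<noteq> 0"
    and Af: "A *v f1 = p' *s u" "A *v f2 = q *s v" "A *v f3 = r *s w"
    and perm: "(u, v, w) \<in> {(f1, f2, f3), (f1, f3, f2), (f2, f1, f3), (f2, f3, f1), (f3, f1, f2), (f3, f2, f1)}"
    by (rule Q1_cases_m1[OF k' A(1,2)])
  have pu: "p' *s u = p *s f1" using Af A(3) by simp
  from perm consider "u = f2" | "u = f3" | "u = f1" "v = f2" "w = f3" | "u = f1" "v = f3" "w = f2"
    by blast
  then show ?thesis
  proof cases
    case 1
    then show ?thesis using pu sq by (simp add: vector_3_eq_iff)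
  next
    case 2
    then show ?thesis using pu sq by (simp add: vector_3_eq_iff)
  next
    case 3
    then have "p' = p" using pu by (simp add: vector_3_eq_iff)
    then show ?thesis using diag[of q r] sq Af 3 by simp
  next
    case 4
    then have "p' = p" using pu by (simp add: vector_3_eq_iff)
    then show ?thesis using swap[of q r] sq Af 4 by simp
  qed
qed

lemma two_x_eq: "x + x = y + y \<Longrightarrow> x = (y :: 'a)"
proof -
  assume "x + x = y + y"
  then have "2 * (x - y) = 0" by (simp add: algebra_simps)
  then show "x = y" using two_nonzero by simp
qed

lemma f1_fixed_Q4_form:
  assumes k': "k = - 1" and A: "Q1 A" "Q4 A" "det A = 1" "A *v f1 = p *s f1"
  shows "\<exists>d. A = mat d \<or> A = mat d ** t12"
proof -
  obtain a b c e f h j where M: "A = M3 a b c 0 e f 0 h j" using A(2) by (rule Q4_cases)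
  have M1: "a + b = p" "e = p" "h = 0"
    using A(4) unfolding M by (simp_all add: vector_3_eq_iff)
  from k' A(1,3,4) show ?thesis
  proof (cases rule: f1_fixed_cases)
    case (diag q r)
    have "a + c = q" "f = 0" "j = q" "b + c = 0" "e + f = r" "h + j = r"
      using diag(4,5) M1(3) unfolding M by (simp_all add: vector_3_eq_iff)
    then have e: "f = 0" "j = p" "a + c = p" "b + c = 0" using M1 by simp_all
    \<comment> \<open>The first coordinate of \<open>A\<close> applied to
      \<open>f1 + f2 - f3\<close>, which is twice \<open>e1\<close>.\<close>
    have "a + a = (a + b) + (a + c) - (b + c)" by (simp add: algebra_simps)
    also have "\<dots> = p + p" unfolding M1(1) e(3,4) by simp
    finally have "a = p" by (rule two_x_eq)
    moreover from this have "b = 0" "c = 0" using M1(1) e(3) by simp_all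
    ultimately have "A = mat p" using e M1 unfolding M mat_M3 by simp
    then show ?thesis by blast
  next
    case (swap q r)
    have "a + c = 0" "f = q" "j = q" "b + c = r" "e + f = 0" "j = r"
      using swap(4,5) M1 unfolding M by (auto simp: vector_3_eq_iff)
    then have e: "f = q" "j = q" "r = q" "b + c = q" "a + c = 0" "p = - q" "e = - q"
      using M1 by (auto simp: eq_neg_iff_add_eq_0)
    have "a + a = (a + b) + (a + c) - (b + c)" by (simp add: algebra_simps)
    also have "\<dots> = (- q) + (- q)" unfolding M1(1) e(4,5,6) by simp
    finally have "a = - q" by (rule two_x_eq)
    moreover from this have "b = 0" "c = q" using M1(1) e by simp_all
    ultimately have "A = mat q ** t12" using e M1 k' unfolding M mat_M3 t12_def by simp
    then show ?thesis by blast
  qed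
qed

lemma in_L_023_m1:
  assumes k': "k = - 1" and s: "s3 \<in> L I" "Q0 A \<or> t12 \<in> L I" and det: "det A = 1" and Q: "Q1 A" "Q4 A"
  shows "A \<in> L I"
proof -
  have im: "s3 *v f1 = (- 1) *s f3 \<and> (s3 ** s3) *v f1 = 1 *s f2"
    unfolding s3_def unfolding k' by (simp add: vector_3_eq_iff)
  obtain B b where B: "B \<in> {A, A ** s3, A ** (s3 ** s3)}" "Q1 B" "det B = 1" "B *v f1 = b *s f1"
    by (rule f_rotate[OF k' Q(1) det Q_t(2) det_t(3) disjI1[OF im]])
  have Q4s: "Q4 s3" using L_Q4[OF L_gen(3), of "{4}"] by simp
  have Q4: "Q4 B" using B(1) Q(2) Q4_mult[OF Q(2) Q4s] Q4_mult[OF Q(2) Q4_mult[OF Q4s Q4s]] by blast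
  have "Q0 A \<Longrightarrow> Q0 B" using B(1) Q0_mult[OF _ Q_t(8), of A] Q0_mult[OF _ Q0_mult[OF Q_t(8) Q_t(8)], of A] by blast
  then have "Q0 B \<or> t12 \<in> L I" using s(2) by blast
  moreover obtain d where "B = mat d \<or> B = mat d ** t12"
    using f1_fixed_Q4_form[OF k' B(2) Q4 B(3,4)] by blast
  ultimately have "B \<in> L I" using B(3) scalar_or_t12_in_L by blast
  then show ?thesis using rotate_back[OF B(1) s(1)] det by blast
qed

lemma in_L_023:
  assumes I: "0 \<notin> I" "2 \<notin> I" "3 \<notin> I" and A: "det A = 1" "Q1 A" "Q4 A"
  shows "A \<in> L I"
  using k in_L_023_1[OF _ L_gen(3) disjI2[OF L_gen(5)] A] in_L_023_m1[OF _ L_gen(3) disjI2[OF L_gen(5)] A] I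
  by blast

lemma in_L_23:
  assumes I: "2 \<notin> I" "3 \<notin> I" and A: "det A = 1" "Q0 A" "Q1 A" "Q4 A"
  shows "A \<in> L I"
  using k in_L_023_1[OF _ L_gen(3) disjI1[OF A(2)] A(1,3,4)] in_L_023_m1[OF _ L_gen(3) disjI1[OF A(2)] A(1,3,4)] I
  by blast

text \<open>The matrix is the identity plus the column \<open>x *s v1 + y *s v2\<close> times the
  row (1, 1, 1). This row kills \<open>v1\<close> and \<open>v2\<close>, so products add the
  columns, and conjugation by \<open>s4\<close> multiplies \<open>x\<close> and \<open>y\<close> by
  the eigenvalues \<open>z\<close> and \<open>z^2\<close>.\<close>

lemma radical_234_in_L:
  assumes k1: "k = 1" and s: "s3 \<in> L I" "s4 \<in> L I"
  shows "M3 (1 + x + y) (x + y) (x + y) (x * z + y * z^2) (1 + x * z + y * z^2) (x * z + y * z^2)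
    (x * z^2 + y * z) (x * z^2 + y * z) (1 + x * z^2 + y * z) \<in> L I" (is "?T x y \<in> L I")
proof (rule prime_field_plane_induct[where P = "\<lambda>x y. ?T x y \<in> L I" and
      l = z and m = "z^2" and ?x0.0 = "- z / (1 - z)" and ?y0.0 = "1 / (1 - z)", OF prime_card])
  show "?T 0 0 \<in> L I" using L_scalar[of 1 I] by (simp add: mat_M3)
  show "?T (x + x') (y + y') \<in> L I" if "?T x y \<in> L I" "?T x' y' \<in> L I" for x y x' y'
  proof -
    have "?T x y ** ?T x' y' = ?T (x + x') (y + y')" by (simp add: z_simps)
    then show ?thesis using L_mult[OF that] by simp
  qed
  show "?T (z * x) (z^2 * y) \<in> L I" if "?T x y \<in> L I" for x y
  proof (rule L_cancel[OF s(2)])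
    have "?T (z * x) (z^2 * y) ** s4 = s4 ** ?T x y" by (simp add: s4_def z_simps)
    then show "?T (z * x) (z^2 * y) ** s4 \<in> L I" using L_mult[OF s(2) that] by simp
    show "det (?T (z * x) (z^2 * y)) = 1" by (simp add: det_M3 z_simps)
  qed
  \<comment> \<open>The coordinates of the vector (1, 0, -1) with respect to \<open>v1\<close> and
    \<open>v2\<close>; this is the column that occurs in
    \<open>(s3 ** s3) ** (s4 ** s4)\<close>.\<close>
  define x0 y0 where "x0 = - z / (1 - z)" and "y0 = 1 / (1 - z)"
  have "1 - z \<noteq> 0" using z_neq_1 by simp
  then have y0: "y0 * (1 - z) = 1" and x0: "x0 = - z * y0" by (simp_all add: x0_def y0_def)
  have e: "x0 + y0 = 1" using y0 unfolding x0 by (simp add: algebra_simps)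
  have e2: "x0 * z + y0 * z^2 = 0" unfolding x0 by (simp add: power2_eq_square)
  have e3: "x0 * z^2 + y0 * z = - 1"
  proof -
    have "x0 * z^2 + y0 * z = - (y0 * (1 - z))" unfolding x0 by (simp add: z_simps)
    then show ?thesis using y0 by simp
  qed
  have "?T x0 y0 = (s3 ** s3) ** (s4 ** s4)"
    using e e2 e3 unfolding s3_def s4_def unfolding k1 by (simp add: add.assoc)
  then have "?T x0 y0 \<in> L I" using L_mult[OF L_mult[OF s(1,1)] L_mult[OF s(2,2)]] by simp
  then show "?T (- z / (1 - z)) (1 / (1 - z)) \<in> L I" by (simp only: x0_def y0_def)
  show "z \<noteq> z^2" using z_sq_neq by metis
  show "- z / (1 - z) \<noteq> 0" "1 / (1 - z) \<noteq> 0" using \<open>1 - z \<noteq> 0\<close> by simp_all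
qed

lemma in_L_234_1:
  assumes k1: "k = 1" and s: "s3 \<in> L I" "s4 \<in> L I" and det: "det A = 1" and Q: "Q0 A" "Q1 A"
  shows "A \<in> L I"
  using k1 Q(2) det
proof (cases rule: Q1_cases_1)
  case (diag a b)
  show ?thesis
  proof (rule eigen_descent[where P = "\<lambda>_. True", OF _ s3_eigen_1[OF k1] _ _ _ det diag(1,2) _ diag(3,4)])
    show "s3 ** mat z \<in> L I" using s by (intro L_mult L_scalar) simp_all
    fix B :: "'a^3^3"
    assume B: "det B = 1" "B *v v1 = v1" "B *v v2 = v2"
    obtain a b c d e f g h j where M: "B = M3 a b c d e f g h j" by (rule M3_cases)
    have "vector [a + b * z + c * z^2, d + e * z + f * z^2, g + h * z + j * z^2] = v1"
      "vector [a + b * z^2 + c * z, d + e * z^2 + f * z, g + h * z^2 + j * z] = v2"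
      using B(2,3) unfolding M by simp_all
    then have e: "a + b * z + c * z^2 = 1" "d + e * z + f * z^2 = z" "g + h * z + j * z^2 = z^2"
      "a + b * z^2 + c * z = 1" "d + e * z^2 + f * z = z^2" "g + h * z^2 + j * z = z"
      unfolding vector_3_eq_iff by blast+
    have cancel: "q = 0" if "q * (z - z^2) = 0" for q :: 'a using that z_diff_nonzero by simp
    have "(b - c) * (z - z^2) = (a + b * z + c * z^2) - (a + b * z^2 + c * z)" by (simp add: algebra_simps)
    then have c: "c = b" using cancel[of "b - c"] unfolding e by simp
    have "(e - f - 1) * (z - z^2) = (d + e * z + f * z^2) - (d + e * z^2 + f * z) - (z - z^2)"
      by (simp add: algebra_simps)
    then have f: "e = f + 1" using cancel[of "e - f - 1"] unfolding e by (simp add: algebra_simps)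
    have "(h - j + 1) * (z - z^2) = (g + h * z + j * z^2) - (g + h * z^2 + j * z) + (z - z^2)"
      by (simp add: algebra_simps)
    then have h: "j = h + 1" using cancel[of "h - j + 1"] unfolding e by (simp add: algebra_simps)
    have "a = (a + b * z + b * z^2) + b" by (simp add: z_simps)
    then have a: "a = 1 + b" using e(1) unfolding c by simp
    have "d = (d + (f + 1) * z + f * z^2) + f - z" by (simp add: z_simps)
    then have d: "d = f" using e(2) unfolding f by simp
    have "g = (g + h * z + (h + 1) * z^2) + h - z^2" by (simp add: z_simps)
    then have g: "g = h" using e(3) unfolding h by simp
    have B': "B = M3 (1 + b) b b f (1 + f) f h h (1 + h)" unfolding M a c d f g h by (simp add: add.commute)
    \<comment> \<open>The determinant places the column \<open>(b, f, h)\<close> in the plane of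
      coordinate sum 0, which \<open>v1\<close> and \<open>v2\<close> span; \<open>x\<close> and
      \<open>y\<close> below are its coordinates there.\<close>
    have "1 + b + f + h = 1" using B(1) unfolding B' by (simp add: det_M3 algebra_simps)
    then have bfh: "b + f + h = 0" by (simp add: add.assoc)
    define y where "y = (b * z - f) / (z - z^2)"
    define x where "x = b - y"
    have y: "y * (z - z^2) = b * z - f" using z_diff_nonzero by (simp add: y_def)
    have xy1: "x + y = b" by (simp add: x_def)
    have "x * z + y * z^2 = b * z - y * (z - z^2)" by (simp add: x_def algebra_simps)
    then have xy2: "x * z + y * z^2 = f" unfolding y by simp
    have "x * z^2 + y * z = - ((x + y) + (x * z + y * z^2))" by (simp add: z_simps)
    also have "\<dots> = h" unfolding xy1 xy2 using bfh by (simp add: algebra_simps neg_eq_iff_add_eq_0)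
    finally have xy3: "x * z^2 + y * z = h" .
    show "B \<in> L I"
      using radical_234_in_L[OF k1 s, of x y] unfolding B' add.assoc[of 1] xy1 xy2 xy3 by simp
  qed simp_all
next
  case (swap a b)
  obtain r where "A *v v1 = r *s v1" using Q0_cases_1[OF k1 Q(1)] by blast
  then have "r *s v1 = a *s v2" using swap by simp
  then have "a = 0" using separated_v unfolding separated_def by blast
  then show ?thesis using swap(4) by simp
qed

lemma f_scalar_in_L:
  assumes "det A = 1" "A *v f1 = a *s f1" "A *v f2 = a *s f2" "A *v f3 = a *s f3"
  shows "A \<in> L I"
proof -
  have "A = mat a"
    by (rule basis_eqI[of 1 1 0 1 0 1 0 1 1])
      (use assms two_nonzero in \<open>simp_all add: mat_mult_vector det_M3\<close>)
  then show ?thesis using assms(1) scalar_in_L by blast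
qed

text \<open>Equal squares leave only signs open. Up to a common sign, the three nontrivial patterns
  are those of \<open>t34\<close> and its two conjugates by powers of \<open>s4\<close>.\<close>

lemma f_diag_in_L:
  assumes k': "k = - 1" and s: "s4 \<in> L I" "t34 \<in> L I" and det: "det A = 1"
    and A: "A *v f1 = a *s f1" "A *v f2 = b *s f2" "A *v f3 = c *s f3" "a^2 = b^2" "a^2 = c^2"
  shows "A \<in> L I"
proof -
  let ?g = "s4 ** t34 ** (s4 ** s4)" and ?h = "(s4 ** s4) ** t34 ** s4"
  have g: "?g \<in> L I" "?h \<in> L I" "det ?g = 1" "det ?h = 1"
    using s by (simp_all add: L_mult det_mul)
  have t: "t34 *v f1 = 1 *s f1" "t34 *v f2 = (- 1) *s f2" "t34 *v f3 = (- 1) *s f3"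
    "?g *v f1 = (- 1) *s f1" "?g *v f2 = 1 *s f2" "?g *v f3 = (- 1) *s f3"
    "?h *v f1 = (- 1) *s f1" "?h *v f2 = (- 1) *s f2" "?h *v f3 = 1 *s f3"
    unfolding t34_def s4_def unfolding k' by (simp_all add: vector_3_eq_iff)
  have dets: "det (A ** t34) = 1" "det (A ** ?g) = 1" "det (A ** ?h) = 1"
    using det g by (simp_all add: det_mul)
  have sq: "x = y \<or> x = - y" if "x^2 = y^2" for x y :: 'a
    using that by (simp add: power2_eq_iff)
  have "b = a \<or> b = - a" "c = a \<or> c = - a"
    by (rule sq[OF A(4)[symmetric]], rule sq[OF A(5)[symmetric]])
  then show ?thesis
  proof (elim disjE)
    assume "b = a" "c = a"
    then show ?thesis using f_scalar_in_L[OF det, of a] A(1-3) by simp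
  next
    assume bc: "b = - a" "c = - a"
    have "A ** t34 \<in> L I"
      by (rule f_scalar_in_L[OF dets(1), of a])
        (use eigen_mult[OF A(1) t(1)] eigen_mult[OF A(2) t(2)] eigen_mult[OF A(3) t(3)] bc in simp_all)
    then show ?thesis using L_cancel[OF s(2)] det by blast
  next
    assume bc: "b = a" "c = - a"
    have "A ** ?h \<in> L I"
      by (rule f_scalar_in_L[OF dets(3), of "- a"])
        (use eigen_mult[OF A(1) t(7)] eigen_mult[OF A(2) t(8)] eigen_mult[OF A(3) t(9)] bc in simp_all)
    then show ?thesis using L_cancel[OF g(2)] det by blast
  next
    assume bc: "b = - a" "c = a"
    have "A ** ?g \<in> L I"
      by (rule f_scalar_in_L[OF dets(2), of "- a"])
        (use eigen_mult[OF A(1) t(4)] eigen_mult[OF A(2) t(5)] eigen_mult[OF A(3) t(6)] bc in simp_all)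
    then show ?thesis using L_cancel[OF g(1)] det by blast
  qed
qed

lemma in_L_234_m1:
  assumes k': "k = - 1" and s: "s4 \<in> L I" "t34 \<in> L I" and det: "det A = 1" and Q: "Q0 A" "Q1 A"
  shows "A \<in> L I"
proof -
  have im: "s4 *v f1 = 1 *s f2 \<and> (s4 ** s4) *v f1 = 1 *s f3"
    unfolding s4_def by (simp add: vector_3_eq_iff)
  obtain B p where B: "B \<in> {A, A ** s4, A ** (s4 ** s4)}" "Q1 B" "det B = 1" "B *v f1 = p *s f1"
    by (rule f_rotate[OF k' Q(2) det Q_t(3) det_t(4) disjI2[OF im]])
  have Q0: "Q0 B" using Q01_rotate(1)[OF B(1) Q(1)] .
  have "B \<in> L I"
    using k' B(2-4)
  proof (cases rule: f1_fixed_cases)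
    case (diag q r)
    then show ?thesis using f_diag_in_L[OF k' s B(3,4)] by blast
  next
    case (swap q r)
    \<comment> \<open>The columns are \<open>f1\<close>, \<open>f2\<close>, \<open>f3\<close>, so
      that \<open>B ** ?F\<close> shows the action of \<open>B\<close> on the triangle.\<close>
    let ?F = "M3 1 1 0 1 0 1 0 1 1 :: 'a^3^3"
    obtain a b c d e f g h j where M: "B = M3 a b c d e f g h j" by (rule M3_cases)
    have BF: "B ** ?F = M3 p 0 r p q 0 0 q r"
      using B(4) swap(4,5) unfolding M by (simp add: vector_3_eq_iff)
    obtain t where t: "t ^ 3 = 1" "transpose B ** N ** B = mat t ** N" using Q0_cases_m1[OF k' Q0] .
    have "transpose (B ** ?F) ** N ** (B ** ?F) = transpose ?F ** (transpose B ** N ** B) ** ?F"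
      by (simp only: matrix_transpose_mul matrix_mul_assoc)
    then have "transpose (M3 p 0 r p q 0 0 q r) ** N ** M3 p 0 r p q 0 0 q r = transpose ?F ** (mat t ** N) ** ?F"
      unfolding BF t(2) .
    \<comment> \<open>The form takes the values 2, \<open>2 * z^2\<close> and \<open>2 * z\<close>
      on \<open>f1\<close>, \<open>f2\<close>, \<open>f3\<close>. With \<open>p^2 = q^2\<close>,
      fixing the line of \<open>f1\<close> and sending \<open>f2\<close> to that of
      \<open>f3\<close> would require \<open>z = z^2\<close>.\<close>
    then have "p * p + p * p = t + t" "(q * q) * z + (q * q) * z = t * z^2 + t * z^2"
      unfolding N_def mat_M3 by (simp_all add: algebra_simps)
    then have pt: "p * p = t" "(q * q) * z = t * z^2" by (blast intro: two_x_eq)+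
    then have "t * (z - z^2) = 0" using swap(1) by (simp add: power2_eq_square algebra_simps)
    then have "t = 0" using z_diff_nonzero by simp
    then show ?thesis using t(1) by simp
  qed
  then show ?thesis using rotate_back[OF B(1) s(1)] det by blast
qed

lemma in_L_234:
  assumes I: "2 \<notin> I" "3 \<notin> I" "4 \<notin> I" and A: "det A = 1" "Q0 A" "Q1 A"
  shows "A \<in> L I"
  using k in_L_234_1[OF _ L_gen(3) L_gen(4) A] in_L_234_m1[OF _ L_gen(4) L_gen(7) A] I
  by blast

section \<open>The vertices 123\<close>

lemma eigen_step:
  assumes g: "g \<in> L I" "g *v u = x *s u" "g *v w = y *s w"
    and R: "\<forall>A. det A = 1 \<longrightarrow> A *v u = (a * x) *s u \<longrightarrow> A *v w = (b * y) *s w \<longrightarrow> A \<in> L I"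
  shows "\<forall>A. det A = 1 \<longrightarrow> A *v u = a *s u \<longrightarrow> A *v w = b *s w \<longrightarrow> A \<in> L I"
proof (intro allI impI)
  fix A
  assume A: "det A = 1" "A *v u = a *s u" "A *v w = b *s w"
  have "det (A ** g) = 1" using A(1) L_det[OF g(1)] by (simp add: det_mul)
  then have "A ** g \<in> L I" using R eigen_mult[OF A(2) g(2)] eigen_mult[OF A(3) g(3)] by blast
  then show "A \<in> L I" using L_cancel[OF g(1)] A(1) by blast
qed

text \<open>The identity plus the column \<open>x *s e1 + y *s v1\<close> times the row
  \<open>(0, z, - 1)\<close>, which kills \<open>e1\<close> and \<open>v1\<close>; hence products
  add the columns. Conjugation by \<open>s3\<close> acts on \<open>x\<close> and \<open>y\<close> by
  the distinct factors \<open>- (z^2)\<close> and \<open>z\<close>.\<close>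

lemma radical_123_in_L:
  assumes k1: "k = 1" and s: "s2 \<in> L I" "s3 \<in> L I"
  shows "M3 1 (z * (x + y)) (- (x + y)) 0 (1 + z^2 * y) (- (z * y)) 0 y (1 - z^2 * y) \<in> L I"
    (is "?T x y \<in> L I")
proof (rule prime_field_plane_induct[where P = "\<lambda>x y. ?T x y \<in> L I" and
      l = "- (z^2)" and m = z and ?x0.0 = "z^2 - z" and ?y0.0 = "- (z^2)", OF prime_card])
  show "?T 0 0 \<in> L I" using L_scalar[of 1 I] by (simp add: mat_M3)
  show "?T (x + x') (y + y') \<in> L I" if "?T x y \<in> L I" "?T x' y' \<in> L I" for x y x' y'
  proof -
    have "?T x y ** ?T x' y' = ?T (x + x') (y + y')" by (simp add: z_simps)
    then show ?thesis using L_mult[OF that] by (simp only:)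
  qed
  show "?T (- (z^2) * x) (z * y) \<in> L I" if "?T x y \<in> L I" for x y
  proof (rule L_cancel[OF s(2)])
    have "?T (- (z^2) * x) (z * y) ** s3 = s3 ** ?T x y"
      unfolding s3_def unfolding k1 by (simp add: z_simps)
    then show "?T (- (z^2) * x) (z * y) ** s3 \<in> L I" using L_mult[OF s(2) that] by (simp only:)
    show "det (?T (- (z^2) * x) (z * y)) = 1" by (simp add: det_M3 z_simps)
  qed
  have "(s2 ** s2) ** (s3 ** s3) = ?T (z^2 - z) (- (z^2))"
    unfolding s2_def s3_def unfolding k1 by (simp add: z_simps)
  then show "?T (z^2 - z) (- (z^2)) \<in> L I"
    using L_mult[OF L_mult[OF s(1,1)] L_mult[OF s(2,2)]] by (simp only:)
  have "- (z^2) = 1 + z" by (simp add: z_simps)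
  then show "- (z^2) \<noteq> z" by simp
  show "z^2 - z \<noteq> 0" "- (z^2) \<noteq> 0" using z_sq_neq by simp_all
qed

lemma in_L_123_1:
  assumes k1: "k = 1" and s: "s2 \<in> L I" "s3 \<in> L I" and det: "det A = 1" and Q: "Q0 A" "Q4 A"
  shows "A \<in> L I"
proof -
  obtain b where b: "A *v v1 = b *s v1" "b ^ 6 = 1" using Q0_cases_1[OF k1 Q(1)] .
  obtain a where a: "A *v e1 = a *s e1" "(a ^ 6) ^ 1 = 1"
    using Q(2) unfolding Q4_def by (rule monomial_on_singletonE)
  \<comment> \<open>The eigenvalues on \<open>e1\<close> and \<open>v1\<close> vary independently
    here: \<open>s3\<close> contributes \<open>(1, - (z^2))\<close> and \<open>s2\<close>
    contributes \<open>(- 1, z)\<close>, which calls for \<open>orbit_sixth_roots\<close>.\<close>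
  let ?R = "\<lambda>a b. \<forall>A. det A = 1 \<longrightarrow> A *v e1 = a *s e1 \<longrightarrow> A *v v1 = b *s v1 \<longrightarrow> A \<in> L I"
  have "?R a b"
  proof (rule orbit_sixth_roots[where R = ?R])
    show "?R a b" if "?R (z * a) (z * b)" for a b
      by (rule eigen_step[OF L_scalar[OF z_cube] mat_mult_vector mat_mult_vector])
        (use that in \<open>simp only: mult.commute[of _ z]\<close>)
    have s3: "s3 *v e1 = 1 *s e1" "s3 *v v1 = (- (z^2)) *s v1"
      unfolding s3_def unfolding k1 by (simp_all add: vector_3_eq_iff z_simps)
    show "?R a b" if "?R a (- (z^2 * b))" for a b
      by (rule eigen_step[OF s(2) s3])
        (use that in \<open>simp only: mult_1_right mult_minus_right mult.commute[of _ "z^2"]\<close>)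
    have s2: "s2 *v e1 = (- 1) *s e1" "s2 *v v1 = z *s v1"
      unfolding s2_def unfolding k1 by (simp_all add: vector_3_eq_iff z_simps)
    show "?R a b" if "?R (- a) (z * b)" for a b
      by (rule eigen_step[OF s(1) s2])
        (use that in \<open>simp only: mult_1_right mult_minus_right mult.commute[of _ z]\<close>)
    show "?R 1 1"
    proof (intro allI impI)
      fix B :: "'a^3^3"
      assume B: "det B = 1" "B *v e1 = 1 *s e1" "B *v v1 = 1 *s v1"
      obtain a b c d e f g h j where M: "B = M3 a b c d e f g h j" by (rule M3_cases)
      have M': "B = M3 1 b c 0 e f 0 h j" using B(2) M by (simp add: vector_3_eq_iff)
      have "vector [1 + b * z + c * z^2, e * z + f * z^2, h * z + j * z^2] = v1"
        using B(3) unfolding M' by simp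
      then have e: "1 + b * z + c * z^2 = 1" "e * z + f * z^2 = z" "h * z + j * z^2 = z^2"
        unfolding vector_3_eq_iff by blast+
      have "b + c * z = z^2 * (1 + b * z + c * z^2) - z^2" by (simp add: z_simps)
      then have b: "b = - (c * z)" unfolding e by (simp add: eq_neg_iff_add_eq_0)
      have "e + f * z = z^2 * (e * z + f * z^2)" by (simp add: z_simps)
      also have "\<dots> = 1" unfolding e by (simp add: z_simps)
      finally have e': "e = 1 - f * z" by (simp add: eq_diff_eq)
      have "h + j * z = z^2 * (h * z + j * z^2)" by (simp add: z_simps)
      also have "\<dots> = z" unfolding e by (simp add: z_simps)
      finally have h: "h = z - j * z" by (simp add: eq_diff_eq)
      have "j - f * z = e * j - f * h" unfolding e' h by (simp add: algebra_simps)
      also have "\<dots> = 1" using B(1) unfolding M' by (simp add: det_M3)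
      finally have j: "j = 1 + f * z" by (simp add: diff_eq_eq)
      \<comment> \<open>The parameters are solved from the last column: \<open>f = - (z * y)\<close>
        gives \<open>y\<close>, then \<open>c = - (x + y)\<close> gives \<open>x\<close>.\<close>
      have "B = M3 1 (z * ((z^2 * f - c) + - (z^2 * f))) (- ((z^2 * f - c) + - (z^2 * f))) 0
          (1 + z^2 * - (z^2 * f)) (- (z * - (z^2 * f))) 0 (- (z^2 * f)) (1 - z^2 * - (z^2 * f))"
        unfolding M' b e' h j by (simp add: z_simps)
      then show "B \<in> L I"
        using radical_123_in_L[OF k1 s, of "z^2 * f - c" "- (z^2 * f)"] by (simp only:)
    qed
    show "a ^ 6 = 1" "b ^ 6 = 1" using a b by simp_all
  qed
  then show ?thesis using det a b by blast
qed

text \<open>These are unipotent isometries of \<open>N\<close> fixing its isotropic vector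
  \<open>e1\<close>. They form a root subgroup of a three-dimensional orthogonal group, which
  explains the quadratic entries and the single additive parameter \<open>d\<close>.\<close>

lemma unipotent_123_in_L:
  assumes k': "k = - 1" and s: "s2 \<in> L I" "s3 \<in> L I"
  shows "M3 1 (d * d - z * d) (d + z^2 * (d * d)) 0 (1 - z^2 * d) (- (z * d)) 0 d (1 + z^2 * d) \<in> L I"
    (is "?U d \<in> L I")
proof (rule prime_field_line_induct[where P = "\<lambda>d. ?U d \<in> L I" and ?x0.0 = "z^2", OF prime_card])
  show "?U 0 \<in> L I" using L_scalar[of 1 I] by (simp add: mat_M3)
  show "?U (d + d') \<in> L I" if "?U d \<in> L I" "?U d' \<in> L I" for d d'
  proof -
    have "?U d ** ?U d' = ?U (d + d')" by (simp add: z_simps)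
    then show ?thesis using L_mult[OF that] by (simp only:)
  qed
  have "(s2 ** s2) ** (s3 ** s3) = ?U (z^2)"
    unfolding s2_def s3_def unfolding k' by (simp add: z_simps)
  then show "?U (z^2) \<in> L I"
    using L_mult[OF L_mult[OF s(1,1)] L_mult[OF s(2,2)]] by (simp only:)
qed simp

text \<open>Variant of \<open>eigen_step\<close> in which the factor of the form \<open>N\<close>
  takes the place of the second eigenvalue.\<close>

lemma similitude_step:
  assumes g: "g \<in> L I" "g *v u = x *s u" "transpose g ** N ** g = mat y ** N"
    and R: "\<forall>A. det A = 1 \<longrightarrow> A *v u = (a * x) *s u \<longrightarrow> transpose A ** N ** A = mat (t * y) ** N \<longrightarrow> A \<in> L I"
  shows "\<forall>A. det A = 1 \<longrightarrow> A *v u = a *s u \<longrightarrow> transpose A ** N ** A = mat t ** N \<longrightarrow> A \<in> L I"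
proof (intro allI impI)
  fix A
  assume A: "det A = 1" "A *v u = a *s u" "transpose A ** N ** A = mat t ** N"
  have "det (A ** g) = 1" using A(1) L_det[OF g(1)] by (simp add: det_mul)
  then have "A ** g \<in> L I" using R eigen_mult[OF A(2) g(2)] similitude_mult_factor[OF A(3) g(3)] by blast
  then show "A \<in> L I" using L_cancel[OF g(1)] A(1) by blast
qed

lemma in_L_123_m1:
  assumes k': "k = - 1" and s: "s2 \<in> L I" "s3 \<in> L I" and det: "det A = 1" and Q: "Q0 A" "Q4 A"
  shows "A \<in> L I"
proof -
  obtain t where t: "t ^ 3 = 1" "transpose A ** N ** A = mat t ** N" using Q0_cases_m1[OF k' Q(1)] .
  obtain a where a: "A *v e1 = a *s e1" "(a ^ 6) ^ 1 = 1"
    using Q(2) unfolding Q4_def by (rule monomial_on_singletonE)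
  let ?R = "\<lambda>a t. \<forall>A. det A = 1 \<longrightarrow> A *v e1 = a *s e1 \<longrightarrow> transpose A ** N ** A = mat t ** N \<longrightarrow> A \<in> L I"
  have "?R a t"
  proof (rule orbit_similitude[where R = ?R])
    show "?R a t" if "?R (z * a) (z^2 * t)" for a t
      by (rule similitude_step[OF L_scalar[OF z_cube] mat_mult_vector similitude_scalar_factor])
        (use that in \<open>simp only: mult.commute[of _ z] mult.commute[of _ "z^2"]\<close>)
    have s2: "s2 *v e1 = (- 1) *s e1" and s3: "s3 *v e1 = 1 *s e1"
      unfolding s2_def s3_def by simp_all
    show "?R a t" if "?R (- a) (z^2 * t)" for a t
      by (rule similitude_step[OF s(1) s2 similitude_factors(1)[OF k']])
        (use that in \<open>simp only: mult_1_right mult_minus_right mult.commute[of _ "z^2"]\<close>)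
    show "?R a t" if "?R a (z * t)" for a t
      by (rule similitude_step[OF s(2) s3 similitude_factors(2)[OF k']])
        (use that in \<open>simp only: mult_1_right mult.commute[of _ z]\<close>)
    show "?R 1 1"
    proof (intro allI impI)
      fix B :: "'a^3^3"
      assume B: "det B = 1" "B *v e1 = 1 *s e1" "transpose B ** N ** B = mat 1 ** N"
      obtain a x y d' b' b g d e where M: "B = M3 a x y d' b' b g d e" by (rule M3_cases)
      have M': "B = M3 1 x y 0 b' b 0 d e" using B(2) M by (simp add: vector_3_eq_iff)
      \<comment> \<open>The entries (1,2), (1,3), (2,2) and (3,3) of the equation. Symmetry of
        \<open>N\<close> doubles the diagonal ones, which are kept as sums so that
        \<open>two_x_eq\<close> can halve them.\<close>
      have N: "b' + z^2 * d = 1" "b + z^2 * e = z^2"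
        "x * b' + z^2 * (x * d) + z * (b' * d) + (x * b' + z^2 * (x * d) + z * (b' * d)) = 0 + 0"
        "y * b + z^2 * (y * e) + z * (b * e) + (y * b + z^2 * (y * e) + z * (b * e)) = 0 + 0"
        using B(3) unfolding M' N_def mat_M3 by (simp_all add: algebra_simps)
      have a: "b' = 1 - z^2 * d" "b = z^2 - z^2 * e" using N(1,2) by (simp_all add: eq_diff_eq)
      have "e - z^2 * d = b' * e - b * d" unfolding a by (simp add: algebra_simps)
      also have "\<dots> = 1" using B(1) unfolding M' by (simp add: det_M3)
      finally have e: "e = 1 + z^2 * d" by (simp add: diff_eq_eq)
      have b: "b = - (z * d)" unfolding a e by (simp add: z_simps)
      have x: "x = d * d - z * d" and y: "y = d + z^2 * (d * d)"
      proof -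
        have "x * (b' + z^2 * d) + z * (b' * d) = 0"
          using two_x_eq[OF N(3)] by (simp add: algebra_simps)
        then have "x + z * (b' * d) = 0" unfolding N(1) by simp
        then have "x = - (z * (b' * d))" by (simp add: eq_neg_iff_add_eq_0)
        then show "x = d * d - z * d" unfolding a by (simp add: z_simps)
        have "y * (b + z^2 * e) + z * (b * e) = 0"
          using two_x_eq[OF N(4)] by (simp add: algebra_simps)
        then have "y * z^2 + z * (b * e) = 0" unfolding N(2) .
        then have yz: "y * z^2 = - (z * (b * e))" by (simp add: eq_neg_iff_add_eq_0)
        have "y = z * (y * z^2)" by (simp add: z_simps)
        also have "\<dots> = d + z^2 * (d * d)" unfolding yz b e by (simp add: z_simps)
        finally show "y = d + z^2 * (d * d)" .
      qed
      show "B \<in> L I"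
        unfolding M' x y b e a(1) by (rule unipotent_123_in_L[OF k' s])
    qed
    show "a ^ 6 = 1" "t ^ 3 = 1" using a t by simp_all
  qed
  then show ?thesis using det a t by blast
qed

lemma in_L_123:
  assumes I: "1 \<notin> I" "2 \<notin> I" "3 \<notin> I" and A: "det A = 1" "Q0 A" "Q4 A"
  shows "A \<in> L I"
  using k in_L_123_1[OF _ L_gen(2) L_gen(3) A] in_L_123_m1[OF _ L_gen(2) L_gen(3) A] I
  by blast

text \<open>Each rule is indexed by the complement of \<open>I\<close>. If \<open>I\<close> contains
  all vertices, the rules for a single vertex apply, as they ask nothing of \<open>I\<close>; the
  fact \<open>pairs\<close> discards the six sets with fewer than two vertices.\<close>

lemma recognise:
  assumes I: "I \<subseteq> {0..4}" "a \<in> I" "b \<in> I" "a \<noteq> b" and det: "det A = 1"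
    and Q: "0 \<in> I \<Longrightarrow> Q0 A" "1 \<in> I \<Longrightarrow> Q1 A" "2 \<in> I \<Longrightarrow> Q2 A" "3 \<in> I \<Longrightarrow> Q3 A" "4 \<in> I \<Longrightarrow> Q4 A"
  shows "A \<in> L I"
proof -
  have ab: "a = 0 \<or> a = 1 \<or> a = 2 \<or> a = 3 \<or> a = 4" "b = 0 \<or> b = 1 \<or> b = 2 \<or> b = 3 \<or> b = 4"
    using I by auto
  have pairs: "0 \<in> I \<and> 1 \<in> I \<or> 0 \<in> I \<and> 2 \<in> I \<or> 0 \<in> I \<and> 3 \<in> I \<or> 0 \<in> I \<and> 4 \<in> I \<or> 1 \<in> I \<and> 2 \<in> I \<or>
    1 \<in> I \<and> 3 \<in> I \<or> 1 \<in> I \<and> 4 \<in> I \<or> 2 \<in> I \<and> 3 \<in> I \<or> 2 \<in> I \<and> 4 \<in> I \<or> 3 \<in> I \<and> 4 \<in> I"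
    using ab I(2-4) by (elim disjE) simp_all
  note rules = in_L_0 in_L_1 in_L_2 in_L_3 in_L_4 in_L_01 in_L_02 in_L_03 in_L_04 in_L_12 in_L_13 in_L_14 in_L_23
    in_L_24 in_L_34 in_L_012 in_L_013 in_L_014 in_L_023 in_L_024 in_L_034 in_L_123 in_L_124 in_L_134 in_L_234
  show ?thesis
    by (cases "0 \<in> I"; cases "1 \<in> I"; cases "2 \<in> I"; cases "3 \<in> I"; cases "4 \<in> I")
      (use pairs in \<open>simp_all add: det Q rules\<close>)
qed

lemma intersection: "intersection_property PSL 5 sigma"
  unfolding intersection_property_def
proof (intro allI impI)
  fix I J :: "nat set"
  assume IJ: "I \<subseteq> {0..5 - 1} \<and> J \<subseteq> {0..5 - 1}"
  let ?G = "chiral_subgroup PSL 5 sigma"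
  have mono: "?G K' \<subseteq> ?G K" if "K \<subseteq> K'" for K K'
    unfolding chiral_subgroup_sigma using that
    by (intro group.mono_generate[OF group_PSL]) blast
  show "?G I \<inter> ?G J = ?G (I \<union> J)"
  proof
    show "?G (I \<union> J) \<subseteq> ?G I \<inter> ?G J" using mono by simp
    show "?G I \<inter> ?G J \<subseteq> ?G (I \<union> J)"
    proof (cases "I \<subseteq> J \<or> J \<subseteq> I")
      case True
      then show ?thesis by (auto simp: Un_absorb1 Un_absorb2)
    next
      case False
      \<comment> \<open>Incomparability supplies two distinct vertices in the union, as
        \<open>recognise\<close> demands.\<close>
      then obtain a b where ab: "a \<in> I" "a \<notin> J" "b \<in> J" by blast
      show ?thesis
      proof
        fix X
        assume X: "X \<in> ?G I \<inter> ?G J"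
        then obtain A where A: "X = PSL_class A" "det A = 1"
          using chiral_subgroup_carrier[of I] by (auto simp: carrier_PSL)
        then have L: "A \<in> L I" "A \<in> L J" using X PSL_class_in_chiral_subgroup by blast+
        have "A \<in> L (I \<union> J)"
        proof (rule recognise[OF _ _ _ _ A(2)])
          show "I \<union> J \<subseteq> {0..4}" using IJ by simp
          show "a \<in> I \<union> J" "b \<in> I \<union> J" "a \<noteq> b" using ab by auto
        qed (use L L_Q0 L_Q1 L_Q2 L_Q3 L_Q4 in blast)+
        then show "X \<in> ?G (I \<union> J)" using A PSL_class_in_chiral_subgroup by blast
      qed
    qed
  qed
qed

section \<open>Generation of the whole group\<close>

lemma s4_conjugates:
  "s4 ** M3 1 0 x 0 1 0 0 0 1 = M3 1 0 0 0 1 0 0 x 1 ** s4"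
  "s4 ** M3 1 0 0 0 1 0 0 x 1 = M3 1 0 0 x 1 0 0 0 1 ** s4"
  "s4 ** M3 1 0 0 0 1 x 0 0 1 = M3 1 x 0 0 1 0 0 0 1 ** s4"
  "s4 ** M3 1 x 0 0 1 0 0 0 1 = M3 1 0 0 0 1 0 x 0 1 ** s4"
  by (simp_all add: s4_def)

lemma SL_subset_L: "det A = 1 \<Longrightarrow> A \<in> L {}"
proof -
  have g: "s1 \<in> L {}" "s2 \<in> L {}" "s4 \<in> L {}" by (simp_all add: L_gen)
  have conj: "B \<in> L {}" if "C \<in> L {}" "s4 ** C = B ** s4" "det B = 1" for B C
    using L_cancel[OF g(3), of B] L_mult[OF g(3) that(1)] that by simp
  have E13: "M3 1 0 x 0 1 0 0 0 1 \<in> L {}" and E23: "M3 1 0 0 0 1 x 0 0 1 \<in> L {}" for x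
    by (rule translation_in_L[OF g(1,2)])+
  \<comment> \<open>Conjugation by the cyclic permutation \<open>s4\<close> moves positions along
    13, 32, 21 and along 23, 12, 31, which reaches all six root positions.\<close>
  have E32: "M3 1 0 0 0 1 0 0 x 1 \<in> L {}" and E12: "M3 1 x 0 0 1 0 0 0 1 \<in> L {}" for x
    by (rule conj[OF E13 s4_conjugates(1)], simp add: det_M3, rule conj[OF E23 s4_conjugates(3)], simp add: det_M3)
  have E21: "M3 1 0 0 x 1 0 0 0 1 \<in> L {}" and E31: "M3 1 0 0 0 1 0 x 0 1 \<in> L {}" for x
    by (rule conj[OF E32 s4_conjugates(2)], simp add: det_M3, rule conj[OF E12 s4_conjugates(4)], simp add: det_M3)
  have left: "A \<in> L {}" if "det A = 1" "B \<in> L {}" "B ** A \<in> L {}" for A B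
    using that PSL_lift_cancel_left[OF tau_table_carrier] unfolding L_def by blast
  show "A \<in> L {}" if "det A = 1"
    by (rule SL3_elementary_induct[where C = "\<lambda>A. A \<in> L {}", OF _ left E12 E13 E21 E23 E31 E32 that])
      (rule L_cancel)
qed

text \<open>\<open>SL_subset_L\<close> concerns the group generated by all \<tau>s; what remains is
  that each of them is a word in the four generators.\<close>

lemma group_generated: "generate PSL (set sigma) = carrier PSL"
proof
  interpret group "PSL :: ('a^3^3) set monoid" by (rule group_PSL)
  have sub: "set sigma \<subseteq> carrier PSL" by (simp add: sigma_def)
  then show "generate PSL (set sigma) \<subseteq> carrier PSL" using generate_in_carrier by blast
  have gens: "PSL_class s \<in> generate PSL (set sigma)" if "s \<in> {s1, s2, s3, s4}" for s
    using that by (intro generate.incl) (auto simp: sigma_def)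
  have mult: "PSL_class (A ** B) \<in> generate PSL (set sigma)"
    if "PSL_class A \<in> generate PSL (set sigma)" "PSL_class B \<in> generate PSL (set sigma)"
      "det A = 1" "det B = 1" for A B
    using generate.eng[OF that(1,2)] that(3,4) by (simp add: PSL_class_mult)
  have s: "PSL_class s1 \<in> generate PSL (set sigma)" "PSL_class s2 \<in> generate PSL (set sigma)"
    "PSL_class s3 \<in> generate PSL (set sigma)" "PSL_class s4 \<in> generate PSL (set sigma)"
    by (rule gens, simp)+
  have two: "PSL_class t12 \<in> generate PSL (set sigma)" "PSL_class t23 \<in> generate PSL (set sigma)"
    "PSL_class t34 \<in> generate PSL (set sigma)"
    using mult[OF s(1,2)] mult[OF s(2,3)] mult[OF s(3,4)] by (simp_all add: t_products)
  have three: "PSL_class t13 \<in> generate PSL (set sigma)" "PSL_class t24 \<in> generate PSL (set sigma)"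
    "PSL_class t14 \<in> generate PSL (set sigma)"
    using mult[OF s(1) two(2)] mult[OF two(2) s(4)] mult[OF two(1,3)] by (simp_all add: t_products)
  have "{PSL_class t | a b t. (a, b, t) \<in> tau_table \<and> a \<notin> {} \<and> b \<notin> {}} \<subseteq> generate PSL (set sigma)"
  proof clarify
    fix a b t
    assume "(a, b, t) \<in> tau_table"
    then show "PSL_class t \<in> generate PSL (set sigma)"
      unfolding tau_table_def by (elim insertE emptyE Pair_inject) (simp_all add: s two three)
  qed
  then have "generate PSL {PSL_class t | a b t. (a, b, t) \<in> tau_table \<and> a \<notin> {} \<and> b \<notin> {}}
      \<subseteq> generate PSL (set sigma)"
    by (intro generate_subgroup_incl generate_is_subgroup sub)
  then show "carrier PSL \<subseteq> generate PSL (set sigma)"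
    using SL_subset_L by (auto simp: carrier_PSL L_def PSL_lift_def)
qed

section \<open>Orders of the generators and the string property\<close>

lemma PSL_class_eq_one_iff:
  fixes A :: "'a^3^3"
  assumes "det A = 1"
  shows "PSL_class A = \<one>\<^bsub>PSL\<^esub> \<longleftrightarrow> (\<exists>c. c ^ 3 = 1 \<and> A = mat c)"
  unfolding PSL_class_one[symmetric] using assms
  by (subst PSL_class_eq_iff) (simp_all add: det_mat_3)

lemma ord_eq_primeI:
  fixes A :: "'a^3^3"
  assumes "det A = 1" "prime p" "PSL_class A [^]\<^bsub>PSL\<^esub> p = \<one>\<^bsub>PSL\<^esub>" "PSL_class A \<noteq> \<one>\<^bsub>PSL\<^esub>"
  shows "group.ord PSL (PSL_class A) = p"
proof -
  interpret group "PSL :: ('a^3^3) set monoid" by (rule group_PSL)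
  have "ord (PSL_class A) dvd p" using assms pow_eq_id by simp
  moreover have "ord (PSL_class A) \<noteq> 1" using assms ord_eq_1 by simp
  ultimately show ?thesis using assms(2) by (auto simp: prime_nat_iff)
qed

lemma ord_2I:
  fixes A :: "'a^3^3"
  assumes "det A = 1" "A ** A = mat c" "c ^ 3 = 1" "\<And>c. A \<noteq> mat c"
  shows "group.ord PSL (PSL_class A) = 2"
proof (rule ord_eq_primeI)
  show "PSL_class A [^]\<^bsub>PSL\<^esub> (2::nat) = \<one>\<^bsub>PSL\<^esub>"
    using PSL_class_pow[OF assms(1), of 2] assms(2,3) PSL_class_eq_one_iff[of "mat c"]
    by (auto simp: numeral_2_eq_2 det_mat_3)
  show "PSL_class A \<noteq> \<one>\<^bsub>PSL\<^esub>" using assms by (simp add: PSL_class_eq_one_iff)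
qed (use assms in simp_all)

lemma ord_3I:
  fixes A :: "'a^3^3"
  assumes "det A = 1" "A ** (A ** A) = mat c" "c ^ 3 = 1" "\<And>c. A \<noteq> mat c"
  shows "group.ord PSL (PSL_class A) = 3"
proof (rule ord_eq_primeI)
  show "PSL_class A [^]\<^bsub>PSL\<^esub> (3::nat) = \<one>\<^bsub>PSL\<^esub>"
    using PSL_class_pow[OF assms(1), of 3] assms(2,3) PSL_class_eq_one_iff[of "mat c"]
    by (auto simp: numeral_3_eq_3 det_mat_3)
  show "PSL_class A \<noteq> \<one>\<^bsub>PSL\<^esub>" using assms by (simp add: PSL_class_eq_one_iff)
qed (use assms in simp_all)

text \<open>The sixth power is trivial while \<open>B\<close>, the square, and
  \<open>A ** B\<close>, the cube, are not scalar; this rules out the divisors 1, 2 and 3 of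
  6.\<close>

lemma ord_6I:
  fixes A :: "'a^3^3"
  assumes "det A = 1" "A ** A = B" "B ** (B ** B) = mat c" "c ^ 3 = 1" "\<And>c. B \<noteq> mat c" "\<And>c. A ** B \<noteq> mat c"
  shows "group.ord PSL (PSL_class A) = 6"
proof -
  interpret group "PSL :: ('a^3^3) set monoid" by (rule group_PSL)
  let ?X = "PSL_class A"
  have X: "?X \<in> carrier PSL" and B: "det B = 1" using assms(1,2) by (auto simp: det_mul)
  have 2: "?X [^]\<^bsub>PSL\<^esub> (2::nat) = PSL_class B"
    using PSL_class_pow[OF assms(1), of 2] assms(2) by (simp add: numeral_2_eq_2)
  have 3: "?X [^]\<^bsub>PSL\<^esub> (3::nat) = PSL_class (A ** B)"
    using PSL_class_pow[OF assms(1), of 3] assms(2) by (simp add: numeral_3_eq_3)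
  have "?X [^]\<^bsub>PSL\<^esub> (2 * 3 :: nat) = \<one>\<^bsub>PSL\<^esub>"
    unfolding nat_pow_pow[OF X, symmetric] 2
    using PSL_class_pow[OF B, of 3] assms(3,4) PSL_class_eq_one_iff[of "mat c"]
    by (auto simp: numeral_3_eq_3 det_mat_3)
  then have "ord ?X dvd 6" using pow_eq_id[OF X] by simp
  moreover have "\<not> ord ?X dvd 2" "\<not> ord ?X dvd 3"
    using pow_eq_id[OF X, of 2] pow_eq_id[OF X, of 3] assms B
    by (simp_all add: 2 3 PSL_class_eq_one_iff det_mul)
  moreover have "n \<in> {1, 2, 3, 6}" if "n dvd 6" for n :: nat
  proof -
    have "n \<le> 6" using that by (rule dvd_imp_le) simp
    then have "n = 0 \<or> n = 1 \<or> n = 2 \<or> n = 3 \<or> n = 4 \<or> n = 5 \<or> n = 6" by arith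
    then show ?thesis using that by auto
  qed
  ultimately show ?thesis by fastforce
qed

lemma ord_s1: "group.ord PSL (PSL_class s1) = 3"
  by (rule ord_3I[OF det_t(1), of 1]) (use z_neq_1 in \<open>auto simp: s1_def mat_M3 z_simps\<close>)

lemma ord_s4: "group.ord PSL (PSL_class s4) = 3"
  by (rule ord_3I[OF det_t(4), of 1]) (auto simp: s4_def mat_M3)

lemma ord_s2: "group.ord PSL (PSL_class s2) = 6"
proof (rule ord_6I[OF det_t(2), of "s2 ** s2" 1])
  have s22: "s2 ** s2 = M3 1 0 (k - k * z) 0 z (k * z - k) 0 0 (z^2)"
    by (simp add: s2_def z_simps)
  show "(s2 ** s2) ** ((s2 ** s2) ** (s2 ** s2)) = mat 1"
    unfolding s22 by (simp add: mat_M3 z_simps)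
  show "s2 ** s2 \<noteq> mat c" for c
    unfolding s22 using z_neq_1 by (auto simp: mat_M3)
  show "s2 ** (s2 ** s2) \<noteq> mat c" for c
    unfolding s22 s2_def using z_neq_1 two_nonzero by (auto simp: mat_M3 z_simps)
qed simp_all

lemma ord_s3_1: "k = 1 \<Longrightarrow> group.ord PSL (PSL_class s3) = 6"
proof (rule ord_6I[OF det_t(3), of "s3 ** s3" 1])
  assume k1: "k = 1"
  have s33: "s3 ** s3 = M3 1 2 1 0 0 1 0 (- 1) (- 1)"
    unfolding s3_def unfolding k1 by simp
  show "(s3 ** s3) ** ((s3 ** s3) ** (s3 ** s3)) = mat 1"
    unfolding s33 by (simp add: mat_M3)
  show "s3 ** s3 \<noteq> mat c" for c unfolding s33 by (auto simp: mat_M3)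
  show "s3 ** (s3 ** s3) \<noteq> mat c" for c
    unfolding s33 s3_def unfolding k1 using two_nonzero by (auto simp: mat_M3)
qed simp_all

lemma ord_s3_m1: "k = - 1 \<Longrightarrow> group.ord PSL (PSL_class s3) = 3"
proof (rule ord_3I[OF det_t(3), of 1])
  assume k': "k = - 1"
  show "s3 ** (s3 ** s3) = mat 1" unfolding s3_def unfolding k' by (simp add: mat_M3)
  show "s3 \<noteq> mat c" for c by (auto simp: s3_def mat_M3)
qed simp_all

lemma string: "string_property PSL 5 sigma"
proof -
  have ord2: "group.ord PSL (PSL_class t) = 2" if "t \<in> {t12, t23, t34, t13, t24, t14}" for t
    using that
  proof (elim insertE emptyE; hypsubst)
    show "group.ord PSL (PSL_class t12) = 2"
      by (rule ord_2I[OF det_t(5), of 1]) (use two_nonzero minus_one_neq_1 in \<open>auto simp: t12_def mat_M3\<close>)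
    show "group.ord PSL (PSL_class t23) = 2"
      by (rule ord_2I[OF det_t(6), of 1]) (auto simp: t23_def mat_M3 z_simps)
    show "group.ord PSL (PSL_class t34) = 2"
      by (rule ord_2I[OF det_t(7), of 1]) (use k_sq in \<open>auto simp: t34_def mat_M3\<close>)
    show "group.ord PSL (PSL_class t13) = 2"
      by (rule ord_2I[OF det_t(8), of 1]) (auto simp: t13_def mat_M3)
    \<comment> \<open>Here the square is the scalar \<open>z^2\<close>: this matrix is an involution
      only modulo scalars.\<close>
    show "group.ord PSL (PSL_class t24) = 2"
      by (rule ord_2I[OF det_t(9), of "z^2"]) (simp add: t24_def mat_M3 z_simps, rule z_square_cube, simp add: t24_def mat_M3)
    show "group.ord PSL (PSL_class t14) = 2"
      by (rule ord_2I[OF det_t(10), of 1]) (auto simp: t14_def mat_M3)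
  qed
  show ?thesis
    unfolding string_property_def
  proof (intro allI impI)
    fix i j :: nat
    assume ij: "1 \<le> i \<and> i < j \<and> j \<le> 5 - 1"
    then have "i = 1 \<and> j = 2 \<or> i = 2 \<and> j = 3 \<or> i = 3 \<and> j = 4 \<or> i = 1 \<and> j = 3 \<or> i = 2 \<and> j = 4 \<or> i = 1 \<and> j = 4"
      by arith
    then show "group.ord PSL (chiral_tau PSL sigma i j) = 2"
      by (elim disjE conjE) (simp_all add: tau_eq ord2)
  qed
qed

section \<open>Chirality\<close>

lemma chiral: "chirality PSL 5 sigma"
  unfolding chirality_def
proof (rule notI, elim bexE conjE)
  interpret group "PSL :: ('a^3^3) set monoid" by (rule group_PSL)
  let ?c = "PSL_class :: 'a^3^3 \<Rightarrow> _"
  fix \<phi>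
  assume iso: "\<phi> \<in> iso PSL PSL" and inv: "\<phi> (sigma ! 0) = inv\<^bsub>PSL\<^esub> (sigma ! 0)"
    and fixed: "\<forall>i\<in>{2..5 - 1}. \<phi> (chiral_tau PSL sigma 1 i) = chiral_tau PSL sigma 1 i"
  interpret \<phi>: group_hom PSL PSL \<phi>
    using iso by (simp add: group_hom_def group_hom_axioms_def iso_def group_PSL)
  have mult: "\<phi> (?c (A ** B)) = \<phi> (?c A) \<otimes>\<^bsub>PSL\<^esub> \<phi> (?c B)" if "det A = 1" "det B = 1" for A B
    using that \<phi>.hom_mult by (simp flip: PSL_class_mult)
  \<comment> \<open>\<open>\<phi>\<close> respects conjugation; the relations
    \<open>B = g A g^-1\<close> and \<open>B' = g' A' g'^-1\<close> are multiplied out to avoid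
    inverse matrices.\<close>
  have move: "\<phi> (?c B) = ?c B'"
    if "\<phi> (?c g) = ?c g'" "\<phi> (?c A) = ?c A'" "g ** A = B ** g" "B' ** g' = g' ** A'"
      "det A = 1" "det B = 1" "det A' = 1" "det B' = 1" "det g = 1" "det g' = 1" for A A' B B' g g'
  proof -
    have "\<phi> (?c B) \<otimes>\<^bsub>PSL\<^esub> ?c g' = \<phi> (?c (B ** g))"
      using mult[of B g] that by simp
    also have "\<dots> = ?c g' \<otimes>\<^bsub>PSL\<^esub> ?c A'"
      using mult[of g A] that by simp
    also have "\<dots> = ?c B' \<otimes>\<^bsub>PSL\<^esub> ?c g'"
      using that by (simp add: PSL_class_mult)
    finally show ?thesis
      using that \<phi>.hom_closed by simp
  qed
  have s1_inv: "s1 ** (s1 ** s1) = mat 1" by (simp add: s1_def mat_M3 z_simps)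
  have "?c (s1 ** s1) \<otimes>\<^bsub>PSL\<^esub> ?c s1 = \<one>\<^bsub>PSL\<^esub>"
    using s1_inv by (simp add: PSL_class_mult det_mul PSL_class_one matrix_mul_assoc)
  then have "inv\<^bsub>PSL\<^esub> ?c s1 = ?c (s1 ** s1)"
    by (intro inv_equality) (simp_all add: det_mul)
  then have f1: "\<phi> (?c s1) = ?c (s1 ** s1)" using inv by (simp add: sigma_def)
  have t: "\<phi> (?c t12) = ?c t12" "\<phi> (?c t13) = ?c t13" "\<phi> (?c t14) = ?c t14"
    using bspec[OF fixed, of 2] bspec[OF fixed, of 3] bspec[OF fixed, of 4] by (simp_all add: tau_eq)
  have f4: "\<phi> (?c s4) = ?c s4"
  proof -
    have "?c t13 \<otimes>\<^bsub>PSL\<^esub> \<phi> (?c s4) = ?c t13 \<otimes>\<^bsub>PSL\<^esub> ?c s4"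
      using mult[of t13 s4] t by (simp add: t_products PSL_class_mult)
    then show ?thesis using \<phi>.hom_closed by simp
  qed
  \<comment> \<open>From \<open>s1 ** s2 = t12\<close> and the inversion of \<open>s1\<close>: the
    image of \<open>s2\<close> is that of \<open>t12\<close> multiplied by \<open>s1\<close> from
    the left.\<close>
  have f2: "\<phi> (?c s2) = ?c (s1 ** t12)"
  proof -
    have "?c (s1 ** s1) \<otimes>\<^bsub>PSL\<^esub> \<phi> (?c s2) = ?c t12"
      using mult[of s1 s2] t(1) f1 by (simp add: t_products)
    also have "\<dots> = ?c (s1 ** s1) \<otimes>\<^bsub>PSL\<^esub> ?c (s1 ** t12)"
    proof -
      have "(s1 ** s1) ** (s1 ** t12) = (s1 ** (s1 ** s1)) ** t12" by (simp only: matrix_mul_assoc)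
      then have "(s1 ** s1) ** (s1 ** t12) = t12" unfolding s1_inv by simp
      then show ?thesis by (simp add: PSL_class_mult det_mul)
    qed
    finally show ?thesis using \<phi>.hom_closed by (simp add: det_mul)
  qed
  let ?T = "\<lambda>x y. M3 1 0 x 0 1 y 0 0 1 :: 'a^3^3"
  \<comment> \<open>The product \<open>(s2 ** s2) ** (s1 ** s1)\<close> has last-column entries
    \<open>c\<close> and \<open>- c\<close> above the diagonal, and its image, computed from
    \<open>f1\<close> and \<open>f2\<close>, has \<open>- c\<close> and \<open>c\<close>: the
    entries are exchanged. Conjugation by \<open>s1\<close> on one side and by its square on the
    other extends this to all entries.\<close>
  have swap: "\<phi> (?c (?T x y)) = ?c (?T y x)" for x y
  proof (rule prime_field_plane_induct[where P = "\<lambda>x y. \<phi> (?c (?T x y)) = ?c (?T y x)" and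
      l = z and m = "z^2" and ?x0.0 = "k * (1 + 2 * z)" and ?y0.0 = "- (k * (1 + 2 * z))", OF prime_card])
    show "\<phi> (?c (?T 0 0)) = ?c (?T 0 0)"
      using \<phi>.hom_one by (simp add: PSL_class_one mat_M3[symmetric])
    show "\<phi> (?c (?T (x + x') (y + y'))) = ?c (?T (y + y') (x + x'))"
      if "\<phi> (?c (?T x y)) = ?c (?T y x)" "\<phi> (?c (?T x' y')) = ?c (?T y' x')" for x y x' y'
      using mult[of "?T x y" "?T x' y'"] that by (simp add: det_M3 PSL_class_mult add.commute)
    show "\<phi> (?c (?T (z * x) (z^2 * y))) = ?c (?T (z^2 * y) (z * x))"
      if "\<phi> (?c (?T x y)) = ?c (?T y x)" for x y
      by (rule move[OF f1 that]) (simp_all add: det_M3 det_mul, simp_all add: s1_def z_simps)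
    have "(s2 ** s2) ** (s1 ** s1) = ?T (k * (1 + 2 * z)) (- (k * (1 + 2 * z)))"
      by (simp add: s1_def s2_def z_simps)
    moreover have "((s1 ** t12) ** (s1 ** t12)) ** ((s1 ** s1) ** (s1 ** s1)) = ?T (- (k * (1 + 2 * z))) (k * (1 + 2 * z))"
      by (simp add: s1_def t12_def z_simps)
    ultimately show "\<phi> (?c (?T (k * (1 + 2 * z)) (- (k * (1 + 2 * z))))) = ?c (?T (- (k * (1 + 2 * z))) (k * (1 + 2 * z)))"
      using mult[of "s2 ** s2" "s1 ** s1"] mult[of s2 s2] mult[of s1 s1] f1 f2
      by (simp add: det_mul PSL_class_mult del: M3_mult)
    show "z \<noteq> z^2" using z_sq_neq by metis
  qed (use one_plus_two_z in simp_all)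
  let ?E32 = "M3 1 0 0 0 1 0 0 1 1 :: 'a^3^3" and ?E12 = "M3 1 1 0 0 1 0 0 0 1 :: 'a^3^3"
  have E32: "\<phi> (?c ?E32) = ?c ?E12"
    by (rule move[OF f4 swap[of 1 0]]) (simp_all add: s4_conjugates det_M3)
  have E12: "\<phi> (?c ?E12) = ?c ?E32"
    by (rule move[OF f4 swap[of 0 1]]) (simp_all add: s4_conjugates det_M3)
  \<comment> \<open>The commutator relation written without inverses. Its image under
    \<open>\<phi>\<close> would be a relation between \<open>?T 0 1\<close>, \<open>?E12\<close> and
    \<open>?E32\<close> that fails even up to scalars.\<close>
  have "?T 1 0 ** ?E32 = ?E12 ** (?E32 ** ?T 1 0)" by simp
  then have "\<phi> (?c (?T 1 0 ** ?E32)) = \<phi> (?c (?E12 ** (?E32 ** ?T 1 0)))" by (simp only:)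
  then have "?c (?T 0 1 ** ?E12) = ?c (?E32 ** (?E12 ** ?T 0 1))"
    by (simp add: mult det_mul det_M3 swap E12 E32 PSL_class_mult del: M3_mult)
  then show False
    by (subst (asm) PSL_class_eq_iff) (auto simp: det_M3 mat_M3)
qed

lemma gives_polytope: "gives_chiral_polytope PSL 5 sigma"
  unfolding gives_chiral_polytope_def
  using group_PSL group_generated string intersection chiral by (auto simp: sigma_def)

end

theorem theorem1p2:
  fixes p i :: nat
    and \<omega> k :: "'a::{field,finite}"
    and \<sigma>1 \<sigma>2 \<sigma>3 \<sigma>4 :: "('a^3^3) set"
  assumes "prime p" and "[p = 1] (mod 6)" and "CARD('a) = p"
    and "primitive_root_of_unity 3 \<omega>"
    and "k \<in> {1, -1}" and "i \<in> {1, 2}"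
    and "\<sigma>1 = PSL_class (vector [vector [1, 0, 0],
                                  vector [0, \<omega> ^ i, 0],
                                  vector [0, 0, \<omega> ^ (2 * i)]])"
    and "\<sigma>2 = PSL_class (vector [vector [-1, 0, -k],
                                  vector [0, - (\<omega> ^ (2 * i)), - k * \<omega> ^ (2 * i)],
                                  vector [0, 0, \<omega> ^ i]])"
    and "\<sigma>3 = PSL_class (vector [vector [1, k, 0],
                                  vector [0, k, 1],
                                  vector [0, -1, 0]])"
    and "\<sigma>4 = PSL_class (vector [vector [0, 1, 0],
                                  vector [0, 0, 1],
                                  vector [1, 0, 0]])"
  shows "gives_chiral_polytope (PSL :: ('a^3^3) set monoid) 5 [\<sigma>1, \<sigma>2, \<sigma>3, \<sigma>4]
    \<and> (k = 1 \<longrightarrow> schlaefli_type (PSL :: ('a^3^3) set monoid) [\<sigma>1, \<sigma>2, \<sigma>3, \<sigma>4] = [3, 6, 6, 3])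
    \<and> (k = -1 \<longrightarrow> schlaefli_type (PSL :: ('a^3^3) set monoid) [\<sigma>1, \<sigma>2, \<sigma>3, \<sigma>4] = [3, 6, 3, 3])"
proof -
  \<comment> \<open>For \<open>i = 2\<close> this is the other primitive cube root of unity, so both
    values of \<open>i\<close> are treated at once.\<close>
  define z where "z = \<omega> ^ i"
  have \<omega>: "\<omega> ^ 3 = 1" "\<omega> \<noteq> 1" "\<omega>^2 \<noteq> 1"
    using assms(4) unfolding primitive_root_of_unity_def
    by (auto dest: spec[of _ 1] spec[of _ 2])
  have z3: "z ^ 3 = 1"
    unfolding z_def power_mult[symmetric] mult.commute[of i 3] by (simp add: power_mult \<omega>)
  have z1: "z \<noteq> 1"
    using assms(6) \<omega> by (auto simp: z_def)
  have "(z - 1) * (z^2 + z + 1) = z ^ 3 - 1"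
    by Groebner_Basis.algebra
  then have zz: "z^2 + z + 1 = 0"
    using z1 z3 by simp
  have prime: "prime CARD('a)"
    using assms(1,3) by simp
  have two: "(2 :: 'a) \<noteq> 0"
  proof
    assume "(2 :: 'a) = 0"
    then have "of_nat 2 = (0 :: 'a)" by simp
    then have "p dvd 2"
      using CHAR_eq_CARD[OF prime] assms(3) by (simp only: of_nat_eq_0_iff_char_dvd)
    then have "p = 2"
      using assms(1) two_is_prime_nat primes_dvd_imp_eq by blast
    then show False
      using assms(2) by (simp add: cong_def)
  qed
  interpret five_polytope z k
    using zz z1 two prime assms(5) by unfold_locales auto
  have z2: "\<omega> ^ (2 * i) = z^2"
    by (simp add: z_def mult.commute flip: power_mult)
  have list: "[\<sigma>1, \<sigma>2, \<sigma>3, \<sigma>4] = sigma"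
    unfolding assms(7-10) sigma_def s1_def s2_def s3_def s4_def M3_def z2 z_def[symmetric] ..
  have type: "schlaefli_type PSL sigma = [3, 6, group.ord PSL (PSL_class s3), 3]"
    by (simp add: schlaefli_type_def sigma_def ord_s1 ord_s2 ord_s4)
  show ?thesis
    unfolding list
  proof (intro conjI impI)
    show "gives_chiral_polytope PSL 5 sigma" by (rule gives_polytope)
    show "schlaefli_type PSL sigma = [3, 6, 6, 3]" if "k = 1"
      unfolding type ord_s3_1[OF that] ..
    show "schlaefli_type PSL sigma = [3, 6, 3, 3]" if "k = - 1"
      unfolding type ord_s3_m1[OF that] ..
  qed
qed

end
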